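(* Let $P_n$ be embedded into $IA_n\subseteq\mathrm{Aut}(F_n)$ via the Artin action. Then for every $j\ge1$, \[\Gamma_j(P_n)=\Gamma_j(IA_n)\cap P_n=\mathcal A_j\cap P_n.\]
   Context: $F_n$ is free on $(x_1,\dots,x_n)$, $\Gamma_*$ is the lower central series, $IA_n$ is the group of automorphisms of $F_n$ acting trivially on $F_n^{ab}$, and $\mathcal A_j$ is the subgroup of automorphisms $\sigma$ of $F_n$ with $\sigma(x)x^{-1}\in\Gamma_{j+1}(F_n)$ for all $x\in F_n$. The braid group $B_n$ (generators $\sigma_1,\dots,\sigma_{n-1}$) acts faithfully on $F_n$ by the Artin action: $\sigma_i(x_i)=x_ix_{i+1}x_i^{-1}$, $\sigma_i(x_{i+1})=x_i$, $\sigma_i(x_t)=x_t$ for $t\ne i,i+1$ (this is conjugation action of $B_n\subseteq B_{n+1}$ on $x_i=A_{i,n+1}$). The pure braid group $P_n$ (kernel of $B_n\to S_n$) maps into $IA_n$ and $B_n\cap IA_n=P_n$. *)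

theory Defs
  imports "HOL-Algebra.Algebra"
begin

text \<open>lcs G j is Gamma_j(G), indexed so that Gamma_1(G) = G and
  Gamma_(j+1)(G) = [Gamma_j(G), G]. (The value at index 0 is also set to G.)\<close>
fun lcs :: "('a, 'b) monoid_scheme \<Rightarrow> nat \<Rightarrow> 'a set" where
  "lcs G 0 = carrier G"
| "lcs G (Suc 0) = carrier G"
| "lcs G (Suc (Suc k)) =
     generate G {x \<otimes>\<^bsub>G\<^esub> y \<otimes>\<^bsub>G\<^esub> inv\<^bsub>G\<^esub> x \<otimes>\<^bsub>G\<^esub> inv\<^bsub>G\<^esub> y
                 | x y. x \<in> lcs G (Suc k) \<and> y \<in> carrier G}"

text \<open>A letter (i, True) stands for x_i, (i, False) for x_i^{-1}.\<close>
type_synonym letter = "nat \<times> bool"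
type_synonym word = "letter list"

definition inverse_letters :: "letter \<Rightarrow> letter \<Rightarrow> bool" where
  "inverse_letters a b \<longleftrightarrow> fst a = fst b \<and> snd a \<noteq> snd b"

fun reduced :: "word \<Rightarrow> bool" where
  "reduced [] = True"
| "reduced [a] = True"
| "reduced (a # b # w) = (\<not> inverse_letters a b \<and> reduced (b # w))"

fun red_cons :: "letter \<Rightarrow> word \<Rightarrow> word" where
  "red_cons a [] = [a]"
| "red_cons a (b # w) = (if inverse_letters a b then w else a # b # w)"

definition word_mult :: "word \<Rightarrow> word \<Rightarrow> word" where
  "word_mult v w = foldr red_cons v w"

definition FreeGrp :: "nat \<Rightarrow> word monoid" where
  "FreeGrp n = \<lparr> carrier = {w. set w \<subseteq> {1..n} \<times> UNIV \<and> reduced w},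
                 monoid.mult = word_mult, one = [] \<rparr>"

definition word_inv :: "word \<Rightarrow> word" where
  "word_inv w = rev (map (\<lambda>(i, b). (i, \<not> b)) w)"

definition subst_hom :: "(nat \<Rightarrow> word) \<Rightarrow> word \<Rightarrow> word" where
  "subst_hom \<phi> w =
     foldr (\<lambda>(i, b) acc. word_mult (if b then \<phi> i else word_inv (\<phi> i)) acc) w []"

definition artin_gen :: "nat \<Rightarrow> nat \<Rightarrow> word \<Rightarrow> word" where
  "artin_gen n i = restrict
     (subst_hom (\<lambda>t. if t = i then [(i, True), (Suc i, True), (i, False)]
                     else if t = Suc i then [(i, True)] else [(t, True)]))
     (carrier (FreeGrp n))"

abbreviation AutF :: "nat \<Rightarrow> (word \<Rightarrow> word) monoid" where
  "AutF n \<equiv> AutoGroup (FreeGrp n)"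

text \<open>The image of B_n in Aut(F_n) together with the permutation homomorphism
  B_n -> S_n: the subgroup of Aut(F_n) x S_n generated by the pairs (sigma_i, (i i+1)).
  Since the Artin action is faithful, this subgroup is the graph of B_n -> S_n
  transported to Aut(F_n).\<close>
definition braid_graph :: "nat \<Rightarrow> ((word \<Rightarrow> word) \<times> (nat \<Rightarrow> nat)) set" where
  "braid_graph n = generate (AutF n \<times>\<times> sym_group n)
     {(artin_gen n i, transpose i (Suc i)) | i. 1 \<le> i \<and> i < n}"

definition PureBraid :: "nat \<Rightarrow> (word \<Rightarrow> word) set" where
  "PureBraid n = {\<alpha>. (\<alpha>, id) \<in> braid_graph n}"

definition IA :: "nat \<Rightarrow> (word \<Rightarrow> word) set" where
  "IA n = {\<sigma> \<in> auto (FreeGrp n). \<forall>x \<in> carrier (FreeGrp n).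
      lcs (FreeGrp n) 2 #>\<^bsub>FreeGrp n\<^esub> \<sigma> x = lcs (FreeGrp n) 2 #>\<^bsub>FreeGrp n\<^esub> x}"

definition Afilt :: "nat \<Rightarrow> nat \<Rightarrow> (word \<Rightarrow> word) set" where
  "Afilt n j = {\<sigma> \<in> auto (FreeGrp n). \<forall>x \<in> carrier (FreeGrp n).
      \<sigma> x \<otimes>\<^bsub>FreeGrp n\<^esub> inv\<^bsub>FreeGrp n\<^esub> x \<in> lcs (FreeGrp n) (Suc j)}"

end

theory Submission
  imports Defs "HOL-Library.List_Lexorder" "HOL-Library.Sublist" "HOL-Library.Multiset"
begin

text \<open>Since \<open>[\<A>\<^sub>i, \<A>\<^sub>j] \<subseteq> \<A>\<^sub>i\<^sub>+\<^sub>j\<close> and \<open>P\<^sub>n \<subseteq> IA\<^sub>n = \<A>\<^sub>1\<close>, only \<open>\<A>\<^sub>j \<inter> P\<^sub>n \<subseteq> \<Gamma>\<^sub>j(P\<^sub>n)\<close> is in question, and one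
  argues by induction on \<open>n\<close>. Combing writes a pure braid on \<open>n + 1\<close> strands as \<open>\<kappa>\<alpha>\<close>, where \<open>\<alpha>\<close> comes
  from \<open>P\<^sub>n\<close> and \<open>\<kappa>\<close> moves only the last strand. Killing \<open>x\<^sub>n\<^sub>+\<^sub>1\<close> shows that \<open>\<alpha>\<close> still lies in \<open>\<A>\<^sub>j\<close>, hence
  in \<open>\<Gamma>\<^sub>j\<close> by induction, so \<open>\<kappa>\<close> lies in \<open>\<A>\<^sub>j\<close> too. The braids \<open>\<kappa>\<close> form a free group on \<open>n\<close> generators, \<open>\<kappa>\<close>
  being given by the image \<open>v\<close> in \<open>F\<^sub>n\<close> of the element \<open>w\<close> with \<open>\<kappa>(x\<^sub>n\<^sub>+\<^sub>1) = w x\<^sub>n\<^sub>+\<^sub>1 w\<inverse>\<close>. From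
  \<open>[w, x\<^sub>n\<^sub>+\<^sub>1] \<in> \<Gamma>\<^sub>j\<^sub>+\<^sub>1\<close> the Magnus expansion of \<open>v\<close> is seen to be trivial below degree \<open>j\<close>, so
  \<open>v \<in> \<Gamma>\<^sub>j(F\<^sub>n)\<close> by Magnus' theorem and \<open>\<kappa> \<in> \<Gamma>\<^sub>j\<close>. Magnus' theorem itself follows from Lazard
  elimination, which writes every element modulo \<open>\<Gamma>\<^sub>j\<close> as a product of powers of iterated
  commutators whose Magnus expansions have distinct leading monomials with coefficient 1.\<close>

section \<open>The lower central series\<close>

text \<open>The degrees match because \<open>\<kappa>(x_(n+1)) x_(n+1)^-1\<close> is the commutator
  \<open>[w, x_(n+1)]\<close>: bracketing with a generator accounts for the one degree by which
  \<open>\<A>_j\<close> is shifted against \<open>\<Gamma>_j\<close>. The conjugator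
  \<open>w\<close> is unique only up to powers of \<open>x_(n+1)\<close> on its right, and in a
  composite the conjugators are twisted by the automorphisms themselves. Both effects vanish once
  \<open>x_(n+1)\<close> is killed, but products then appear in reversed order. For this reason
  \<open>\<kappa>\<close> is tied to \<open>v\<close> by an equation
  \<open>\<kappa> push(v) = 1\<close> with a homomorphism \<open>push\<close> from
  \<open>F_n\<close> to \<open>P_(n+1)\<close>; being a homomorphism, it carries
  \<open>\<Gamma>_j\<close> into \<open>\<Gamma>_j\<close>. Braids are kept as pairs of an
  automorphism and a permutation, since combing an arbitrary word in the generators leaves a coset
  representative behind, and the permutation shows that it is trivial. In the elimination the
  leading monomials form a prefix code, so that \<open>v < \<lambda>\<close> implies
  \<open>v \<lambda> < \<lambda> v\<close>; this decides which of the two products in a commutator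
  leads.\<close>

definition commutator :: "('a, 'b) monoid_scheme \<Rightarrow> 'a \<Rightarrow> 'a \<Rightarrow> 'a" where
  "commutator G x y = x \<otimes>\<^bsub>G\<^esub> y \<otimes>\<^bsub>G\<^esub> inv\<^bsub>G\<^esub> x \<otimes>\<^bsub>G\<^esub> inv\<^bsub>G\<^esub> y"

lemma lcs_Suc:
  "1 \<le> k \<Longrightarrow> lcs G (Suc k) = generate G {commutator G x y | x y. x \<in> lcs G k \<and> y \<in> carrier G}"
  by (cases k) (simp_all add: commutator_def)

context group
begin

lemma inv_mult_cancel [simp]:
  assumes "x \<in> carrier G" "y \<in> carrier G"
  shows "inv x \<otimes> (x \<otimes> y) = y" and "x \<otimes> (inv x \<otimes> y) = y"
  using assms by (simp_all add: m_assoc [symmetric])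

lemma commutator_closed [simp]:
  "x \<in> carrier G \<Longrightarrow> y \<in> carrier G \<Longrightarrow> commutator G x y \<in> carrier G"
  by (simp add: commutator_def)

lemma commutator_mult:
  "x \<in> carrier G \<Longrightarrow> y \<in> carrier G \<Longrightarrow> commutator G x y \<otimes> (y \<otimes> x) = x \<otimes> y"
  by (simp add: commutator_def m_assoc)

lemma lcs_subgroup: "subgroup (lcs G k) G"
proof -
  have "lcs G k \<subseteq> carrier G \<and> subgroup (lcs G k) G"
  proof (induction k)
    case 0
    then show ?case by (simp add: subgroup_self)
  next
    case (Suc k)
    show ?case
    proof (cases "k = 0")
      case True
      then show ?thesis by (simp add: subgroup_self)
    next
      case False
      have "{commutator G x y | x y. x \<in> lcs G k \<and> y \<in> carrier G} \<subseteq> carrier G"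
        using Suc by auto
      then show ?thesis
        using False generate_is_subgroup generate_incl by (simp add: lcs_Suc)
    qed
  qed
  then show ?thesis by simp
qed

lemma lcs_closed: "x \<in> lcs G k \<Longrightarrow> x \<in> carrier G"
  using subgroup.subset [OF lcs_subgroup] by blast

lemma lcs_group_ops:
  shows lcs_m_closed: "x \<in> lcs G k \<Longrightarrow> y \<in> lcs G k \<Longrightarrow> x \<otimes> y \<in> lcs G k"
    and lcs_inv_closed: "x \<in> lcs G k \<Longrightarrow> inv x \<in> lcs G k"
    and lcs_one: "\<one> \<in> lcs G k"
  using lcs_subgroup by (auto simp: subgroup.m_closed subgroup.m_inv_closed subgroup.one_closed)

lemma commutator_lcs:
  "1 \<le> k \<Longrightarrow> x \<in> lcs G k \<Longrightarrow> y \<in> carrier G \<Longrightarrow> commutator G x y \<in> lcs G (Suc k)"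
  by (auto simp: lcs_Suc intro!: generate.incl)

text \<open>The two claims feed each other: as \<open>\<Gamma>_(k+1)\<close> lies in
  \<open>\<Gamma>_k\<close>, the identity \<open>x h x^-1 = [h,x]^-1 h\<close> shows that it is
  normal, and normality puts \<open>[x,y] = x (y x^-1 y^-1)\<close> back into it, which is the next
  inclusion.\<close>

lemma lcs_normal_and_decreasing: "lcs G k \<lhd> G \<and> lcs G (Suc k) \<subseteq> lcs G k"
proof (induction k)
  case 0
  then show ?case by (simp add: normal_self)
next
  case (Suc k)
  have nrm: "lcs G (Suc k) \<lhd> G"
  proof (cases "k = 0")
    case True
    then show ?thesis by (simp add: normal_self)
  next
    case False
    show ?thesis
    proof (rule normal_invI)
      fix x h assume x: "x \<in> carrier G" and h: "h \<in> lcs G (Suc k)"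
      then have hk: "h \<in> lcs G k" and hc: "h \<in> carrier G"
        using Suc lcs_closed by auto
      have "inv (commutator G h x) \<in> lcs G (Suc k)"
        using False hk x by (intro lcs_inv_closed commutator_lcs) auto
      then have "inv (commutator G h x) \<otimes> h \<in> lcs G (Suc k)"
        using h lcs_m_closed by blast
      then show "x \<otimes> h \<otimes> inv x \<in> lcs G (Suc k)"
        using x hc by (simp add: inv_mult_group commutator_def m_assoc)
    qed (rule lcs_subgroup)
  qed
  have "generate G {commutator G x y | x y. x \<in> lcs G (Suc k) \<and> y \<in> carrier G} \<subseteq> lcs G (Suc k)"
  proof (rule generate_subgroup_incl)
    show "{commutator G x y | x y. x \<in> lcs G (Suc k) \<and> y \<in> carrier G} \<subseteq> lcs G (Suc k)"
    proof clarify
      fix x y assume x: "x \<in> lcs G (Suc k)" and y: "y \<in> carrier G"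
      then have "x \<otimes> (y \<otimes> inv x \<otimes> inv y) \<in> lcs G (Suc k)"
        using normal.inv_op_closed2 [OF nrm] lcs_inv_closed lcs_m_closed by blast
      then show "commutator G x y \<in> lcs G (Suc k)"
        using x y lcs_closed by (simp add: commutator_def m_assoc)
    qed
  qed (rule lcs_subgroup)
  with nrm show ?case using lcs_Suc [of "Suc k" G] by simp
qed

lemma lcs_normal: "lcs G k \<lhd> G"
  using lcs_normal_and_decreasing by blast

lemma lcs_antimono: "k \<le> l \<Longrightarrow> lcs G l \<subseteq> lcs G k"
  by (rule lift_Suc_antimono_le [of "lcs G"]) (use lcs_normal_and_decreasing in blast)

text \<open>Conjugation is controlled in both directions, as a single one could map
  \<open>generate G S\<close> onto a smaller subgroup. This serves twice: to split off the powers of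
  one element in the Lazard elimination, and to comb braids.\<close>

lemma generate_normalized_product:
  assumes S: "S \<subseteq> carrier G" and T: "T \<subseteq> carrier G"
    and conj: "\<And>x y. x \<in> S \<Longrightarrow> y \<in> T \<Longrightarrow> y \<otimes> x \<otimes> inv y \<in> generate G S"
    and conj_inv: "\<And>x y. x \<in> S \<Longrightarrow> y \<in> T \<Longrightarrow> inv y \<otimes> x \<otimes> y \<in> generate G S"
    and g: "g \<in> generate G (S \<union> T)"
  shows "\<exists>a\<in>generate G S. \<exists>b\<in>generate G T. g = a \<otimes> b"
proof -
  note GX = generate_in_carrier [OF S] and GY = generate_in_carrier [OF T]
  have conj_gen: "y \<otimes> a \<otimes> inv y \<in> generate G S"
    if y: "y \<in> carrier G" and yc: "\<And>x. x \<in> S \<Longrightarrow> y \<otimes> x \<otimes> inv y \<in> generate G S"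
      and a: "a \<in> generate G S" for y a
    using a
  proof (induction a rule: generate.induct)
    case one
    then show ?case using y by (simp add: generate.one)
  next
    case (incl h)
    then show ?case using yc by blast
  next
    case (inv h)
    then have "inv (y \<otimes> h \<otimes> inv y) \<in> generate G S"
      using yc generate_m_inv_closed S by blast
    then show ?case using y inv S by (simp add: inv_mult_group m_assoc subsetD)
  next
    case (eng h1 h2)
    then have "(y \<otimes> h1 \<otimes> inv y) \<otimes> (y \<otimes> h2 \<otimes> inv y) \<in> generate G S"
      by (blast intro: generate.eng)
    then show ?case using y GX eng.hyps by (simp add: m_assoc)
  qed
  have normalize: "b \<otimes> a \<otimes> inv b \<in> generate G S"
    if "b \<in> generate G T" "a \<in> generate G S" for a b
    using that
  proof (induction b arbitrary: a rule: generate.induct)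
    case one
    then show ?case using GX by simp
  next
    case (incl h)
    then show ?case using conj_gen conj T by blast
  next
    case (inv h)
    then show ?case using conj_gen [of "inv h" a] conj_inv [of _ h] T by (auto simp: subsetD)
  next
    case (eng h1 h2)
    then have "h1 \<otimes> (h2 \<otimes> a \<otimes> inv h2) \<otimes> inv h1 \<in> generate G S" by blast
    then show ?case using GX GY eng.hyps eng.prems by (simp add: m_assoc inv_mult_group)
  qed
  show ?thesis
    using g
  proof (induction g rule: generate.induct)
    case one
    then show ?case using generate.one [of G S] generate.one [of G T] by force
  next
    case (incl h)
    show ?case
    proof (cases "h \<in> S")
      case True
      then show ?thesis
        using S generate.incl [of h S G] generate.one [of G T] by (metis GX r_one)
    next
      case False
      then show ?thesis
        using incl T generate.incl [of h T G] generate.one [of G S] by (metis GY Un_iff l_one)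
    qed
  next
    case (inv h)
    show ?case
    proof (cases "h \<in> S")
      case True
      then show ?thesis
        using S generate.inv [of h S G] generate.one [of G T] by (metis GX r_one)
    next
      case False
      then show ?thesis
        using inv T generate.inv [of h T G] generate.one [of G S] by (metis GY Un_iff l_one)
    qed
  next
    case (eng h1 h2)
    then obtain a1 b1 a2 b2 where ab: "a1 \<in> generate G S" "b1 \<in> generate G T" "h1 = a1 \<otimes> b1"
      "a2 \<in> generate G S" "b2 \<in> generate G T" "h2 = a2 \<otimes> b2" by blast
    have "h1 \<otimes> h2 = (a1 \<otimes> (b1 \<otimes> a2 \<otimes> inv b1)) \<otimes> (b1 \<otimes> b2)"
      using ab GX GY by (simp add: m_assoc)
    moreover have "a1 \<otimes> (b1 \<otimes> a2 \<otimes> inv b1) \<in> generate G S" "b1 \<otimes> b2 \<in> generate G T"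
      using ab normalize by (auto intro: generate.eng)
    ultimately show ?case by blast
  qed
qed

end

section \<open>Lower central series under homomorphisms\<close>

context group_hom
begin

lemma hom_commutator:
  "x \<in> carrier G \<Longrightarrow> y \<in> carrier G \<Longrightarrow> h (commutator G x y) = commutator H (h x) (h y)"
  by (simp add: commutator_def)

lemma hom_image_lcs: "h ` lcs G k \<subseteq> lcs H k"
proof (induction k)
  case (Suc k)
  show ?case
  proof (cases "k = 0")
    case False
    let ?C = "{commutator G x y | x y. x \<in> lcs G k \<and> y \<in> carrier G}"
    have "h ` ?C \<subseteq> {commutator H x y | x y. x \<in> lcs H k \<and> y \<in> carrier H}"
      using Suc G.lcs_closed by (force simp: hom_commutator)
    then have "generate H (h ` ?C) \<subseteq> lcs H (Suc k)"
      using False H.mono_generate by (simp add: lcs_Suc)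
    moreover have "?C \<subseteq> carrier G" using G.lcs_closed by auto
    ultimately show ?thesis using False generate_img [of ?C] by (simp add: lcs_Suc)
  qed auto
qed auto

text \<open>Both entries of a commutator can be lifted separately. This is how an element of
  \<open>\<Gamma>_j(P_n)\<close> gets lifted to braids with one more strand.\<close>

lemma surj_hom_image_lcs:
  assumes "h ` carrier G = carrier H"
  shows "h ` lcs G k = lcs H k"
proof (induction k)
  case (Suc k)
  show ?case
  proof (cases "k = 0")
    case False
    let ?C = "{commutator G x y | x y. x \<in> lcs G k \<and> y \<in> carrier G}"
    have "{commutator H x y | x y. x \<in> lcs H k \<and> y \<in> carrier H} \<subseteq> h ` ?C"
    proof clarify
      fix x y assume "x \<in> lcs H k" "y \<in> carrier H"
      then obtain x' y' where x': "x' \<in> lcs G k" "x = h x'" and y': "y' \<in> carrier G" "y = h y'"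
        using assms Suc by blast
      then have "commutator H x y = h (commutator G x' y')"
        using G.lcs_closed by (simp add: hom_commutator)
      then show "commutator H x y \<in> h ` ?C" using x' y' by blast
    qed
    then have "lcs H (Suc k) \<subseteq> generate H (h ` ?C)"
      using False H.mono_generate by (simp add: lcs_Suc)
    moreover have "?C \<subseteq> carrier G" using G.lcs_closed by auto
    ultimately have "lcs H (Suc k) \<subseteq> h ` lcs G (Suc k)"
      using False generate_img [of ?C] by (simp add: lcs_Suc)
    then show ?thesis using hom_image_lcs by blast
  qed (use assms in auto)
qed (use assms in auto)

end

context group
begin

lemma lcs_subgroup_mono:
  assumes "subgroup H G"
  shows "lcs (G\<lparr>carrier := H\<rparr>) k \<subseteq> lcs G k"
proof -
  interpret i: group_hom "G\<lparr>carrier := H\<rparr>" G id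
    using assms by (auto simp: group_hom_def group_hom_axioms_def hom_def is_group
        subgroup_imp_group subgroup.mem_carrier)
  show ?thesis using i.hom_image_lcs by simp
qed

section \<open>Commutator identities and congruences modulo a normal subgroup\<close>

lemma commute_inv:
  assumes "x \<in> carrier G" "y \<in> carrier G" "x \<otimes> y = y \<otimes> x"
  shows "x \<otimes> inv y = inv y \<otimes> x"
proof -
  have "inv y \<otimes> (x \<otimes> y) \<otimes> inv y = inv y \<otimes> (y \<otimes> x) \<otimes> inv y" using assms by simp
  then show ?thesis using assms(1,2) by (simp add: m_assoc)
qed

lemma commute_mult:
  assumes "x \<in> carrier G" "y \<in> carrier G" "z \<in> carrier G" "x \<otimes> y = y \<otimes> x" "x \<otimes> z = z \<otimes> x"
  shows "x \<otimes> (y \<otimes> z) = y \<otimes> z \<otimes> x"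
proof -
  have "x \<otimes> (y \<otimes> z) = y \<otimes> x \<otimes> z" using assms by (simp add: m_assoc [symmetric])
  also have "\<dots> = y \<otimes> z \<otimes> x" using assms by (simp add: m_assoc)
  finally show ?thesis .
qed

text \<open>First \<open>c\<close> cancels against its inverse; what remains is a conjugate of
  \<open>[a,b]\<close> by \<open>d\<close>, which is \<open>[a,b]\<close> again. With
  \<open>c a\<close> and \<open>d b\<close> read as perturbed values of \<open>a\<close> and
  \<open>b\<close>, this is the common core of the commutator estimates.\<close>

lemma commutator_central_mult:
  assumes c: "c \<in> carrier G" "a \<in> carrier G" "b \<in> carrier G" "d \<in> carrier G"
    and central: "c \<otimes> (a \<otimes> d \<otimes> b \<otimes> inv a) = (a \<otimes> d \<otimes> b \<otimes> inv a) \<otimes> c"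
    and da: "d \<otimes> a = a \<otimes> d"
    and dab: "d \<otimes> commutator G a b = commutator G a b \<otimes> d"
  shows "commutator G (c \<otimes> a) (d \<otimes> b) = commutator G a b"
proof -
  have "commutator G (c \<otimes> a) (d \<otimes> b) = c \<otimes> (a \<otimes> d \<otimes> b \<otimes> inv a) \<otimes> inv c \<otimes> inv (d \<otimes> b)"
    using c by (simp add: commutator_def inv_mult_group m_assoc)
  also have "\<dots> = a \<otimes> d \<otimes> b \<otimes> inv a \<otimes> inv (d \<otimes> b)"
    unfolding central using c by (simp add: m_assoc)
  also have "\<dots> = d \<otimes> commutator G a b \<otimes> inv d"
    unfolding da [symmetric] using c by (simp add: commutator_def inv_mult_group m_assoc)
  also have "\<dots> = commutator G a b"
    unfolding dab using c by (simp add: m_assoc)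
  finally show ?thesis .
qed

text \<open>An element form of the three subgroups lemma: conjugation by \<open>x\<close> turns
  \<open>y\<close> into \<open>[x,y] y\<close> and \<open>z\<close> into \<open>[x,z] z\<close>, and
  these perturbations leave \<open>[y,z]\<close> unchanged.\<close>

lemma commute_with_commutator:
  assumes c: "x \<in> carrier G" "y \<in> carrier G" "z \<in> carrier G"
    and central: "\<And>w. w \<in> carrier G \<Longrightarrow> commutator G x y \<otimes> w = w \<otimes> commutator G x y"
    and y: "commutator G x z \<otimes> y = y \<otimes> commutator G x z"
    and yz: "commutator G x z \<otimes> commutator G y z = commutator G y z \<otimes> commutator G x z"
  shows "x \<otimes> commutator G y z = commutator G y z \<otimes> x"
proof -
  have "x \<otimes> commutator G y z \<otimes> inv x = commutator G (commutator G x y \<otimes> y) (commutator G x z \<otimes> z)"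
    using c by (simp add: commutator_def inv_mult_group m_assoc)
  also have "\<dots> = commutator G y z"
    using c y yz central by (intro commutator_central_mult) auto
  finally have "x \<otimes> commutator G y z \<otimes> inv x \<otimes> x = commutator G y z \<otimes> x" by simp
  then show ?thesis using c by (simp add: m_assoc)
qed

lemma rcos_eq_iff:
  assumes "subgroup N G" "x \<in> carrier G" "y \<in> carrier G"
  shows "N #> x = N #> y \<longleftrightarrow> x \<otimes> inv y \<in> N"
proof -
  have "N #> x = N #> y \<longleftrightarrow> x \<in> N #> y"
    using assms rcos_self repr_independence by blast
  then show ?thesis using assms subgroup.rcos_module [OF assms(1) is_group] by blast
qed

end

text \<open>Congruences modulo \<open>N\<close> become equations in \<open>H\<close>, which can be
  rewritten with; the cosets themselves stay hidden.\<close>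

locale quotient_hom = group_hom G H h for G (structure) and H (structure) and h +
  fixes N
  assumes surj: "h ` carrier G = carrier H"
    and hom_eq_iff: "x \<in> carrier G \<Longrightarrow> y \<in> carrier G \<Longrightarrow> h x = h y \<longleftrightarrow> x \<otimes>\<^bsub>G\<^esub> inv\<^bsub>G\<^esub> y \<in> N"
begin

lemma commute_iff:
  assumes x: "x \<in> carrier G" and y: "y \<in> carrier G"
  shows "h x \<otimes>\<^bsub>H\<^esub> h y = h y \<otimes>\<^bsub>H\<^esub> h x \<longleftrightarrow> commutator G x y \<in> N"
proof -
  have "h x \<otimes>\<^bsub>H\<^esub> h y = h y \<otimes>\<^bsub>H\<^esub> h x \<longleftrightarrow> h (x \<otimes>\<^bsub>G\<^esub> y) = h (y \<otimes>\<^bsub>G\<^esub> x)"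
    using x y by simp
  also have "\<dots> \<longleftrightarrow> commutator G x y \<in> N"
    using x y hom_eq_iff [of "x \<otimes>\<^bsub>G\<^esub> y" "y \<otimes>\<^bsub>G\<^esub> x"]
    by (simp add: commutator_def G.inv_mult_group G.m_assoc)
  finally show ?thesis .
qed

end

context group
begin

lemma quotient_hom_exists:
  assumes N: "N \<lhd> G"
  shows "\<exists>(Q :: 'a set monoid) h. quotient_hom G Q h N"
proof -
  have sub: "subgroup N G" using N by (rule normal_imp_subgroup)
  have q: "group_hom G (G Mod N) ((#>) N)"
    by (simp add: N group_hom_def group_hom_axioms_def is_group normal.factorgroup_is_group
        normal.r_coset_hom_Mod)
  have "(#>) N ` carrier G = carrier (G Mod N)"
    by (auto simp: FactGroup_def RCOSETS_def)
  then have "quotient_hom G (G Mod N) ((#>) N) N"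
    using q rcos_eq_iff [OF sub] by (simp add: quotient_hom_def quotient_hom_axioms_def)
  then show ?thesis by blast
qed

text \<open>Modulo \<open>\<Gamma>\<^sub>i\<^sub>+\<^sub>j\<^sub>+\<^sub>1\<close> the commutator \<open>[x, y]\<close> is central and \<open>[x, z]\<close> commutes with
  \<open>\<Gamma>\<^sub>j\<close>, so conjugation by \<open>x\<close> fixes \<open>[y, z]\<close>.\<close>

lemma lcs_commutator:
  assumes "1 \<le> j" "1 \<le> i" "x \<in> lcs G i" "y \<in> lcs G j"
  shows "commutator G x y \<in> lcs G (i + j)"
  using assms
proof (induction j arbitrary: i x y rule: nat_induct_at_least)
  case base
  then show ?case using commutator_lcs lcs_closed by simp
next
  case (Suc j)
  let ?N = "lcs G (i + Suc j)"
  have N: "?N \<lhd> G" by (rule lcs_normal)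
  obtain Q :: "'a set monoid" and h where q: "quotient_hom G Q h ?N"
    using quotient_hom_exists [OF N] by blast
  interpret q: quotient_hom G Q h ?N by (rule q)
  have xc: "x \<in> carrier G" using Suc.prems lcs_closed by blast
  let ?C = "{commutator G a b | a b. a \<in> lcs G j \<and> b \<in> carrier G}"
  have Cc: "?C \<subseteq> carrier G" using lcs_closed by auto
  have comm: "h x \<otimes>\<^bsub>Q\<^esub> h y = h y \<otimes>\<^bsub>Q\<^esub> h x"
    if y: "y \<in> generate G ?C" for y
    using y
  proof (induction y rule: generate.induct)
    case one
    then show ?case using xc by simp
  next
    have "h x \<otimes>\<^bsub>Q\<^esub> h y = h y \<otimes>\<^bsub>Q\<^esub> h x" if C: "y \<in> ?C" for y
    proof -
      obtain a b where a: "a \<in> lcs G j" and b: "b \<in> carrier G" and y: "y = commutator G a b"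
        using C by blast
      have ac: "a \<in> carrier G" using a lcs_closed by blast
      have xa: "commutator G x a \<in> lcs G (i + j)" using Suc.IH Suc.prems a by blast
      \<comment> \<open>The bracket with \<open>b\<close> raises the index of the left entry, so the
        induction hypothesis for \<open>j\<close> is used with \<open>i + 1\<close> in place of
        \<open>i\<close>; this is why \<open>i\<close> is generalised.\<close>
      have xb: "commutator G x b \<in> lcs G (Suc i)" using Suc.prems b commutator_lcs by blast
      have ab: "commutator G a b \<in> lcs G j"
        using commutator_lcs [OF Suc.hyps a b] lcs_antimono [of j "Suc j"] by auto
      have "h x \<otimes>\<^bsub>Q\<^esub> commutator Q (h a) (h b)
          = commutator Q (h a) (h b) \<otimes>\<^bsub>Q\<^esub> h x"
      proof (rule q.H.commute_with_commutator)
        fix w assume "w \<in> carrier Q"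
        then obtain g where g: "g \<in> carrier G" "w = h g" using q.surj by blast
        have "commutator G (commutator G x a) g \<in> ?N"
          using commutator_lcs [OF _ xa g(1)] Suc.hyps by simp
        then show "commutator Q (h x) (h a) \<otimes>\<^bsub>Q\<^esub> w
            = w \<otimes>\<^bsub>Q\<^esub> commutator Q (h x) (h a)"
          using g xc ac q.commute_iff by (simp add: q.hom_commutator [symmetric])
      next
        have "commutator G (commutator G x b) a \<in> ?N" using Suc.IH [OF _ xb a] by simp
        then show "commutator Q (h x) (h b) \<otimes>\<^bsub>Q\<^esub> h a
            = h a \<otimes>\<^bsub>Q\<^esub> commutator Q (h x) (h b)"
          using xc ac b q.commute_iff by (simp add: q.hom_commutator [symmetric])
      next
        have "commutator G (commutator G x b) (commutator G a b) \<in> ?N"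
          using Suc.IH [OF _ xb ab] by simp
        then show "commutator Q (h x) (h b) \<otimes>\<^bsub>Q\<^esub> commutator Q (h a) (h b)
            = commutator Q (h a) (h b) \<otimes>\<^bsub>Q\<^esub> commutator Q (h x) (h b)"
          using xc ac b q.commute_iff by (simp add: q.hom_commutator [symmetric])
      qed (use xc ac b in auto)
      then show ?thesis using y ac b by (simp add: q.hom_commutator)
    qed note C = this
    {
      case (incl y)
      then show ?case by (rule C)
    next
      case (inv y)
      then have yc: "y \<in> carrier G" using lcs_closed by auto
      have "h x \<otimes>\<^bsub>Q\<^esub> h y = h y \<otimes>\<^bsub>Q\<^esub> h x" using inv by (rule C)
      then show ?case using xc yc by (simp add: q.H.commute_inv)
    next
      case (eng y z)
      then have "y \<in> carrier G" "z \<in> carrier G"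
        using generate_in_carrier [OF Cc] by blast+
      then show ?case using eng xc by (simp add: q.H.commute_mult)
    }
  qed
  have "y \<in> generate G ?C" using Suc.prems(3) unfolding lcs_Suc [OF Suc.hyps] .
  then show ?case
    using comm [of y] q.commute_iff [OF xc, of y] lcs_closed [OF Suc.prems(3)] by simp
qed

section \<open>Products and inverses of automorphisms, evaluated at elements\<close>

lemma auto_group_hom: "\<sigma> \<in> auto G \<Longrightarrow> group_hom G G \<sigma>"
  by (simp add: auto_def group_hom_def group_hom_axioms_def is_group)

lemma auto_mult_apply:
  "\<sigma> \<in> auto G \<Longrightarrow> \<tau> \<in> auto G \<Longrightarrow> x \<in> carrier G \<Longrightarrow> (\<sigma> \<otimes>\<^bsub>AutoGroup G\<^esub> \<tau>) x = \<sigma> (\<tau> x)"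
  by (simp add: AutoGroup_def BijGroup_def auto_def compose_def)

lemma auto_one_apply: "x \<in> carrier G \<Longrightarrow> \<one>\<^bsub>AutoGroup G\<^esub> x = x"
  by (simp add: AutoGroup_def BijGroup_def)

lemma carrier_AutoGroup [simp]: "carrier (AutoGroup G) = auto G"
  by (simp add: AutoGroup_def)

lemma auto_closed [simp]: "\<sigma> \<in> auto G \<Longrightarrow> x \<in> carrier G \<Longrightarrow> \<sigma> x \<in> carrier G"
  by (auto simp: auto_def hom_def)

lemma auto_eqI:
  assumes "\<sigma> \<in> auto G" "\<tau> \<in> auto G" "\<And>x. x \<in> carrier G \<Longrightarrow> \<sigma> x = \<tau> x"
  shows "\<sigma> = \<tau>"
  using assms by (auto simp: auto_def Bij_def intro: extensionalityI)

lemma auto_inv_apply: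
  assumes "\<sigma> \<in> auto G" "x \<in> carrier G"
  shows "inv\<^bsub>AutoGroup G\<^esub> \<sigma> \<in> auto G"
    and "\<sigma> ((inv\<^bsub>AutoGroup G\<^esub> \<sigma>) x) = x" and "(inv\<^bsub>AutoGroup G\<^esub> \<sigma>) (\<sigma> x) = x"
proof -
  interpret A: group "AutoGroup G" by (rule AutoGroup)
  show inv: "inv\<^bsub>AutoGroup G\<^esub> \<sigma> \<in> auto G" using assms A.inv_closed by simp
  have "\<sigma> \<otimes>\<^bsub>AutoGroup G\<^esub> inv\<^bsub>AutoGroup G\<^esub> \<sigma> = \<one>\<^bsub>AutoGroup G\<^esub>"
    "inv\<^bsub>AutoGroup G\<^esub> \<sigma> \<otimes>\<^bsub>AutoGroup G\<^esub> \<sigma> = \<one>\<^bsub>AutoGroup G\<^esub>"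
    using assms by (simp_all add: A.r_inv A.l_inv)
  then show "\<sigma> ((inv\<^bsub>AutoGroup G\<^esub> \<sigma>) x) = x" "(inv\<^bsub>AutoGroup G\<^esub> \<sigma>) (\<sigma> x) = x"
    using auto_mult_apply [OF assms(1) inv assms(2)] auto_mult_apply [OF inv assms]
      auto_one_apply [OF assms(2)] by simp_all
qed

end

section \<open>The Andreadakis filtration\<close>

text \<open>\<open>Afilt\<close> for an arbitrary group: its compatibility with commutators is a
  fact about all groups, proved before free groups enter.\<close>

definition andreadakis :: "('a, 'b) monoid_scheme \<Rightarrow> nat \<Rightarrow> ('a \<Rightarrow> 'a) set" where
  "andreadakis G j = {\<sigma> \<in> auto G. \<forall>x \<in> carrier G. \<sigma> x \<otimes>\<^bsub>G\<^esub> inv\<^bsub>G\<^esub> x \<in> lcs G (Suc j)}"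

context group
begin

lemma andreadakis_auto: "\<sigma> \<in> andreadakis G i \<Longrightarrow> \<sigma> \<in> auto G"
  by (simp add: andreadakis_def)

text \<open>For a generator \<open>[a,b]\<close> of \<open>\<Gamma>_(k+1)\<close> write
  \<open>\<sigma> a = c a\<close> and \<open>\<sigma> b = d b\<close>. Modulo
  \<open>\<Gamma>_(k+1+i)\<close> the element \<open>c\<close> of \<open>\<Gamma>_(k+i)\<close> is
  central and \<open>d\<close> of \<open>\<Gamma>_(i+1)\<close> commutes with
  \<open>\<Gamma>_k\<close>, so \<open>[c a, d b] = [a,b]\<close>.\<close>

lemma andreadakis_lcs:
  assumes "1 \<le> k" "x \<in> lcs G k" and \<sigma>: "\<sigma> \<in> andreadakis G i"
  shows "\<sigma> x \<otimes> inv x \<in> lcs G (k + i)"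
  using assms(1,2)
proof (induction k arbitrary: x rule: nat_induct_at_least)
  case base
  then show ?case using \<sigma> by (simp add: andreadakis_def)
next
  case (Suc k)
  let ?N = "lcs G (Suc k + i)"
  have N: "?N \<lhd> G" by (rule lcs_normal)
  obtain Q :: "'a set monoid" and h where q: "quotient_hom G Q h ?N"
    using quotient_hom_exists [OF N] by blast
  interpret q: quotient_hom G Q h ?N by (rule q)
  interpret s: group_hom G G \<sigma> using auto_group_hom andreadakis_auto [OF \<sigma>] by blast
  let ?C = "{commutator G a b | a b. a \<in> lcs G k \<and> b \<in> carrier G}"
  have Cc: "?C \<subseteq> carrier G" using lcs_closed by auto
  have C: "h (\<sigma> y) = h y" if "y \<in> ?C" for y
  proof -
    obtain a b where a: "a \<in> lcs G k" and b: "b \<in> carrier G" and y: "y = commutator G a b"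
      using \<open>y \<in> ?C\<close> by blast
    have ac: "a \<in> carrier G" using a lcs_closed by blast
    define c d where "c = \<sigma> a \<otimes> inv a" and "d = \<sigma> b \<otimes> inv b"
    have c: "c \<in> lcs G (k + i)" using Suc.IH a by (simp add: c_def)
    have d: "d \<in> lcs G (Suc i)" using \<sigma> b by (simp add: d_def andreadakis_def)
    have cc: "c \<in> carrier G" and dc: "d \<in> carrier G" using c d lcs_closed by auto
    have ca: "\<sigma> a = c \<otimes> a" and db: "\<sigma> b = d \<otimes> b"
      using ac b by (simp_all add: c_def d_def m_assoc)
    have ab: "commutator G a b \<in> lcs G k"
      using commutator_lcs [OF Suc.hyps a b] lcs_antimono [of k "Suc k"] by auto
    have d_commute: "h d \<otimes>\<^bsub>Q\<^esub> h w = h w \<otimes>\<^bsub>Q\<^esub> h d" if "w \<in> lcs G k" for w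
      using lcs_commutator [OF _ _ d that] Suc.hyps q.commute_iff [OF dc] that lcs_closed
      by (simp add: add.commute)
    have "commutator G c (a \<otimes> d \<otimes> b \<otimes> inv a) \<in> ?N"
      using commutator_lcs [OF _ c] Suc.hyps ac b dc by simp
    then have central: "h c \<otimes>\<^bsub>Q\<^esub> h (a \<otimes> d \<otimes> b \<otimes> inv a) = h (a \<otimes> d \<otimes> b \<otimes> inv a) \<otimes>\<^bsub>Q\<^esub> h c"
      by (subst q.commute_iff) (use cc ac b dc in auto)
    have "commutator Q (h c \<otimes>\<^bsub>Q\<^esub> h a) (h d \<otimes>\<^bsub>Q\<^esub> h b) = commutator Q (h a) (h b)"
      using central d_commute [OF a] d_commute [OF ab] cc ac b dc
      by (intro q.H.commutator_central_mult) (simp_all add: q.hom_commutator)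
    then show ?thesis
      using y ac b cc dc ca db by (simp add: s.hom_commutator q.hom_commutator)
  qed
  have "h (\<sigma> y) = h y" if "y \<in> generate G ?C" for y
    using that
  proof (induction y rule: generate.induct)
    case (inv y)
    then have "h (\<sigma> y) = h y" and "y \<in> carrier G" using C Cc by blast+
    then show ?case by simp
  next
    case (eng y z)
    then have "y \<in> carrier G" "z \<in> carrier G" using generate_in_carrier [OF Cc] by blast+
    then show ?case using eng by simp
  next
    case one
    then show ?case by simp
  next
    case (incl y)
    then show ?case by (rule C)
  qed
  then have "h (\<sigma> x) = h x" using Suc.prems unfolding lcs_Suc [OF Suc.hyps] .
  then show ?case using q.hom_eq_iff [of "\<sigma> x" x] lcs_closed [OF Suc.prems] by simp
qed

lemma subgroup_andreadakis: "subgroup (andreadakis G j) (AutoGroup G)"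
proof -
  interpret A: group "AutoGroup G" by (rule AutoGroup)
  have N: "subgroup (lcs G (Suc j)) G" by (rule lcs_subgroup)
  have iff: "\<sigma> \<in> andreadakis G j \<longleftrightarrow>
      \<sigma> \<in> auto G \<and> (\<forall>x\<in>carrier G. lcs G (Suc j) #> \<sigma> x = lcs G (Suc j) #> x)" for \<sigma>
    unfolding andreadakis_def using rcos_eq_iff [OF N] auto_closed by blast
  show ?thesis
  proof (rule A.subgroupI)
    show "andreadakis G j \<subseteq> carrier (AutoGroup G)" using andreadakis_auto by auto
    have "\<one>\<^bsub>AutoGroup G\<^esub> \<in> andreadakis G j"
      using A.one_closed by (simp add: iff auto_one_apply)
    then show "andreadakis G j \<noteq> {}" by blast
  next
    fix \<sigma> assume \<sigma>: "\<sigma> \<in> andreadakis G j"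
    have "lcs G (Suc j) #> (inv\<^bsub>AutoGroup G\<^esub> \<sigma>) x = lcs G (Suc j) #> x" if "x \<in> carrier G" for x
    proof -
      have "(inv\<^bsub>AutoGroup G\<^esub> \<sigma>) x \<in> carrier G"
        using that \<sigma> andreadakis_auto auto_inv_apply(1) by simp
      then have "lcs G (Suc j) #> (inv\<^bsub>AutoGroup G\<^esub> \<sigma>) x = lcs G (Suc j) #> \<sigma> ((inv\<^bsub>AutoGroup G\<^esub> \<sigma>) x)"
        using \<sigma> iff by simp
      then show ?thesis using auto_inv_apply(2) [OF andreadakis_auto [OF \<sigma>] that] by simp
    qed
    then show "inv\<^bsub>AutoGroup G\<^esub> \<sigma> \<in> andreadakis G j"
      using \<sigma> A.inv_closed by (simp add: iff)
  next
    fix \<sigma> \<tau> assume "\<sigma> \<in> andreadakis G j" "\<tau> \<in> andreadakis G j"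
    then show "\<sigma> \<otimes>\<^bsub>AutoGroup G\<^esub> \<tau> \<in> andreadakis G j"
      using A.m_closed by (simp add: iff auto_mult_apply)
  qed
qed

text \<open>Write \<open>\<sigma> x = s x\<close> and \<open>\<tau> x = t x\<close>. Modulo
  \<open>\<Gamma>_(i+2)\<close>, \<open>\<sigma>\<close> fixes \<open>t\<close>,
  \<open>\<tau>\<close> fixes \<open>s\<close>, and \<open>s\<close> and \<open>t\<close> commute,
  so the two composites agree. The second automorphism is taken from \<open>\<A>_1\<close> because
  every step of \<open>lcs\<close> brackets with the whole group.\<close>

lemma commutator_andreadakis:
  assumes \<sigma>: "\<sigma> \<in> andreadakis G i" and \<tau>: "\<tau> \<in> andreadakis G 1"
  shows "commutator (AutoGroup G) \<sigma> \<tau> \<in> andreadakis G (Suc i)"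
proof -
  interpret A: group "AutoGroup G" by (rule AutoGroup)
  note auts = andreadakis_auto [OF \<sigma>] andreadakis_auto [OF \<tau>]
  interpret s: group_hom G G \<sigma> using auto_group_hom auts by blast
  interpret t: group_hom G G \<tau> using auto_group_hom auts by blast
  let ?N = "lcs G (Suc (Suc i))"
  have N: "?N \<lhd> G" by (rule lcs_normal)
  obtain Q :: "'a set monoid" and h where q: "quotient_hom G Q h ?N"
    using quotient_hom_exists [OF N] by blast
  interpret q: quotient_hom G Q h ?N by (rule q)
  have h: "h (\<sigma> (\<tau> x)) = h (\<tau> (\<sigma> x))" if x: "x \<in> carrier G" for x
  proof -
    define s where "s = \<sigma> x \<otimes> inv x"
    define t where "t = \<tau> x \<otimes> inv x"
    have s: "s \<in> lcs G (Suc i)" and t: "t \<in> lcs G 2"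
      using \<sigma> \<tau> x by (simp_all add: s_def t_def andreadakis_def numeral_2_eq_2)
    have sc: "s \<in> carrier G" and tc: "t \<in> carrier G" using s t lcs_closed by auto
    have sx: "\<sigma> x = s \<otimes> x" and tx: "\<tau> x = t \<otimes> x"
      using x by (simp_all add: s_def t_def m_assoc)
    have "\<sigma> t \<otimes> inv t \<in> ?N" using andreadakis_lcs [OF _ t \<sigma>] by simp
    then have ht: "h (\<sigma> t) = h t" using q.hom_eq_iff tc by simp
    have "\<tau> s \<otimes> inv s \<in> ?N" using andreadakis_lcs [OF _ s \<tau>] by simp
    then have hs: "h (\<tau> s) = h s" using q.hom_eq_iff sc by simp
    have "h t \<otimes>\<^bsub>Q\<^esub> h s = h s \<otimes>\<^bsub>Q\<^esub> h t"
      using commutator_lcs [OF _ s tc] q.commute_iff [OF sc tc] by simp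
    then show ?thesis
      using sc tc x sx tx ht hs by (simp add: q.H.m_assoc [symmetric])
  qed
  let ?k = "commutator (AutoGroup G) \<sigma> \<tau>"
  have k: "?k \<in> auto G" using A.commutator_closed auts by simp
  have "h (?k x) = h x" if x: "x \<in> carrier G" for x
  proof -
    \<comment> \<open>Writing \<open>x = \<tau> (\<sigma> y)\<close> turns the claim about
      \<open>[\<sigma>,\<tau>]\<close> into one about composites, as
      \<open>[\<sigma>,\<tau>] \<tau> \<sigma> = \<sigma> \<tau>\<close>.\<close>
    obtain y where y: "y \<in> carrier G" "x = \<tau> (\<sigma> y)"
    proof
      show "(inv\<^bsub>AutoGroup G\<^esub> \<sigma>) ((inv\<^bsub>AutoGroup G\<^esub> \<tau>) x) \<in> carrier G"
        "x = \<tau> (\<sigma> ((inv\<^bsub>AutoGroup G\<^esub> \<sigma>) ((inv\<^bsub>AutoGroup G\<^esub> \<tau>) x)))"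
        using auts x by (simp_all add: auto_inv_apply)
    qed
    have "?k x = (?k \<otimes>\<^bsub>AutoGroup G\<^esub> (\<tau> \<otimes>\<^bsub>AutoGroup G\<^esub> \<sigma>)) y"
      using auts k y A.m_closed by (simp add: auto_mult_apply)
    also have "\<dots> = (\<sigma> \<otimes>\<^bsub>AutoGroup G\<^esub> \<tau>) y" using A.commutator_mult auts by simp
    finally show ?thesis using h y auts by (simp add: auto_mult_apply)
  qed
  then show ?thesis using k q.hom_eq_iff by (simp add: andreadakis_def)
qed

text \<open>Stated for any subgroup of \<open>\<A>_1\<close>, so as to cover \<open>P_n\<close> and
  \<open>IA_n\<close> alike.\<close>

lemma lcs_andreadakis:
  assumes H: "subgroup H (AutoGroup G)" "H \<subseteq> andreadakis G 1" and "1 \<le> j"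
  shows "lcs ((AutoGroup G)\<lparr>carrier := H\<rparr>) j \<subseteq> andreadakis G j"
  using \<open>1 \<le> j\<close>
proof (induction j rule: nat_induct_at_least)
  case base
  then show ?case using H by simp
next
  case (Suc j)
  interpret A: group "AutoGroup G" by (rule AutoGroup)
  let ?H = "(AutoGroup G)\<lparr>carrier := H\<rparr>"
  interpret H: group ?H using H A.subgroup_imp_group by blast
  have sub: "subgroup (andreadakis G (Suc j) \<inter> H) ?H"
  proof (rule A.subgroup_incl)
    show "subgroup (andreadakis G (Suc j) \<inter> H) (AutoGroup G)"
      using subgroup_andreadakis H A.subgroups_Inter_pair by blast
  qed (use H in auto)
  have "{commutator ?H x y | x y. x \<in> lcs ?H j \<and> y \<in> carrier ?H} \<subseteq> andreadakis G (Suc j) \<inter> H"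
  proof clarify
    fix x y assume x: "x \<in> lcs ?H j" and y: "y \<in> carrier ?H"
    then have xH: "x \<in> H" and yH: "y \<in> H" using H.lcs_closed by auto
    have "commutator ?H x y = commutator (AutoGroup G) x y"
      using xH yH H(1) A.m_inv_consistent by (simp add: commutator_def)
    moreover have "commutator (AutoGroup G) x y \<in> andreadakis G (Suc j)"
      using x yH Suc H by (intro commutator_andreadakis) auto
    moreover have "commutator ?H x y \<in> H" using H.commutator_closed xH yH by simp
    ultimately show "commutator ?H x y \<in> andreadakis G (Suc j) \<inter> H" by simp
  qed
  then have "lcs ?H (Suc j) \<subseteq> andreadakis G (Suc j) \<inter> H"
    using H.generate_subgroup_incl [OF _ sub] lcs_Suc [OF Suc.hyps, of ?H] by simp
  then show ?case by blast
qed

end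

section \<open>Free groups\<close>

lemma inverse_letters_iff: "inverse_letters a b \<longleftrightarrow> b = (fst a, \<not> snd a)"
  by (cases a; cases b) (auto simp: inverse_letters_def)

lemma reduced_iff_successively: "reduced w \<longleftrightarrow> successively (\<lambda>a b. \<not> inverse_letters a b) w"
  by (induction w rule: reduced.induct) auto

lemma reduced_Cons: "reduced (a # w) \<Longrightarrow> reduced w"
  by (cases w) auto

lemma red_cons_reduced: "reduced (a # w) \<Longrightarrow> red_cons a w = a # w"
  by (cases w) auto

lemma reduced_red_cons: "reduced w \<Longrightarrow> reduced (red_cons a w)"
  by (cases w) (auto dest: reduced_Cons)

lemma set_red_cons: "set (red_cons a w) \<subseteq> insert a (set w)"
  by (cases w) auto

text \<open>Van der Waerden's argument: letters act on reduced words by \<open>red_cons\<close>,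
  inverse letters act inversely to each other, and \<open>word_mult\<close> is this action, whence
  its associativity.\<close>

lemma red_cons_inverse:
  assumes "reduced w" "inverse_letters a b"
  shows "red_cons a (red_cons b w) = w"
proof (cases w)
  case Nil
  then show ?thesis using assms by simp
next
  case (Cons c v)
  show ?thesis
  proof (cases "inverse_letters b c")
    case True
    then have "c = a" using assms by (auto simp: inverse_letters_iff prod_eq_iff)
    then show ?thesis using Cons True assms red_cons_reduced [of a v] by simp
  next
    case False
    then show ?thesis using Cons assms by simp
  qed
qed

lemma word_mult_simps [simp]:
  "word_mult [] w = w" "word_mult (a # v) w = red_cons a (word_mult v w)"
  by (simp_all add: word_mult_def)

lemma word_mult_append: "word_mult (u @ v) w = word_mult u (word_mult v w)"
  by (simp add: word_mult_def)

lemma reduced_word_mult: "reduced w \<Longrightarrow> reduced (word_mult v w)"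
  by (induction v) (auto simp: reduced_red_cons)

lemma word_mult_red_cons:
  assumes "reduced w"
  shows "word_mult (red_cons a v) w = red_cons a (word_mult v w)"
  using assms red_cons_inverse reduced_word_mult by (cases v) auto

lemma word_mult_assoc:
  "reduced w \<Longrightarrow> word_mult (word_mult u v) w = word_mult u (word_mult v w)"
  by (induction u) (auto simp: word_mult_red_cons)

lemma word_mult_Nil: "reduced v \<Longrightarrow> word_mult v [] = v"
proof (induction v)
  case (Cons a v)
  then show ?case using reduced_Cons [OF Cons.prems] by (simp add: red_cons_reduced)
qed simp

lemma set_word_mult: "set (word_mult v w) \<subseteq> set v \<union> set w"
  by (induction v) (use set_red_cons in fastforce)+

lemma word_inv_Cons: "word_inv (a # w) = word_inv w @ [(fst a, \<not> snd a)]"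
  by (cases a) (simp add: word_inv_def)

lemma reduced_word_inv: "reduced w \<Longrightarrow> reduced (word_inv w)"
  unfolding word_inv_def reduced_iff_successively successively_rev successively_map
  by (erule successively_mono) (auto simp: inverse_letters_def)

lemma set_word_inv: "set w \<subseteq> I \<times> UNIV \<Longrightarrow> set (word_inv w) \<subseteq> I \<times> UNIV"
  by (auto simp: word_inv_def)

lemma word_mult_inv: "reduced w \<Longrightarrow> word_mult (word_inv w) w = []"
proof (induction w)
  case Nil
  then show ?case by (simp add: word_inv_def)
next
  case (Cons a w)
  have "red_cons (fst a, \<not> snd a) (a # w) = w"
    by (simp add: inverse_letters_def)
  then show ?case using Cons reduced_Cons by (simp add: word_inv_Cons word_mult_append)
qed

section \<open>The free group on n letters\<close>

lemma carrier_FreeGrp: "w \<in> carrier (FreeGrp n) \<longleftrightarrow> set w \<subseteq> {1..n} \<times> UNIV \<and> reduced w"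
  by (simp add: FreeGrp_def)

lemma mult_FreeGrp [simp]: "v \<otimes>\<^bsub>FreeGrp n\<^esub> w = word_mult v w"
  by (simp add: FreeGrp_def)

lemma one_FreeGrp [simp]: "\<one>\<^bsub>FreeGrp n\<^esub> = []"
  by (simp add: FreeGrp_def)

lemma word_mult_closed:
  "v \<in> carrier (FreeGrp n) \<Longrightarrow> w \<in> carrier (FreeGrp n) \<Longrightarrow> word_mult v w \<in> carrier (FreeGrp n)"
  using set_word_mult [of v w] reduced_word_mult by (auto simp: carrier_FreeGrp)

lemma word_inv_closed: "w \<in> carrier (FreeGrp n) \<Longrightarrow> word_inv w \<in> carrier (FreeGrp n)"
  using set_word_inv reduced_word_inv by (simp add: carrier_FreeGrp)

lemma group_FreeGrp: "group (FreeGrp n)"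
proof (rule groupI)
  show "\<exists>v\<in>carrier (FreeGrp n). v \<otimes>\<^bsub>FreeGrp n\<^esub> w = \<one>\<^bsub>FreeGrp n\<^esub>" if "w \<in> carrier (FreeGrp n)" for w
    using word_inv_closed [OF that] word_mult_inv that by (metis carrier_FreeGrp mult_FreeGrp one_FreeGrp)
next
  fix u v w assume "u \<in> carrier (FreeGrp n)" "v \<in> carrier (FreeGrp n)" "w \<in> carrier (FreeGrp n)"
  then show "u \<otimes>\<^bsub>FreeGrp n\<^esub> v \<otimes>\<^bsub>FreeGrp n\<^esub> w = u \<otimes>\<^bsub>FreeGrp n\<^esub> (v \<otimes>\<^bsub>FreeGrp n\<^esub> w)"
    by (simp add: carrier_FreeGrp word_mult_assoc)
qed (simp_all add: word_mult_closed, simp add: carrier_FreeGrp)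

interpretation F: group "FreeGrp n" for n
  by (rule group_FreeGrp)

lemma inv_FreeGrp: "w \<in> carrier (FreeGrp n) \<Longrightarrow> inv\<^bsub>FreeGrp n\<^esub> w = word_inv w"
  by (rule F.inv_equality) (simp_all add: word_inv_closed word_mult_inv, simp add: carrier_FreeGrp word_mult_inv)

abbreviation gen :: "nat \<Rightarrow> word" where "gen i \<equiv> [(i, True)]"

lemma gen_closed: "i \<in> {1..n} \<Longrightarrow> gen i \<in> carrier (FreeGrp n)"
  by (simp add: carrier_FreeGrp)

lemma inv_gen: "i \<in> {1..n} \<Longrightarrow> inv\<^bsub>FreeGrp n\<^esub> (gen i) = [(i, False)]"
  using gen_closed by (simp add: inv_FreeGrp word_inv_def)

text \<open>Removing the first letter of a reduced word is a multiplication without cancellation, so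
  list induction becomes an induction phrased in group operations only.\<close>

lemma FreeGrp_induct [consumes 1, case_names one gen inv]:
  assumes "w \<in> carrier (FreeGrp n)" and one: "P \<one>\<^bsub>FreeGrp n\<^esub>"
    and gen: "\<And>i w. i \<in> {1..n} \<Longrightarrow> w \<in> carrier (FreeGrp n) \<Longrightarrow> P w \<Longrightarrow> P (gen i \<otimes>\<^bsub>FreeGrp n\<^esub> w)"
    and inv: "\<And>i w. i \<in> {1..n} \<Longrightarrow> w \<in> carrier (FreeGrp n) \<Longrightarrow> P w \<Longrightarrow>
      P (inv\<^bsub>FreeGrp n\<^esub> (gen i) \<otimes>\<^bsub>FreeGrp n\<^esub> w)"
  shows "P w"
  using assms(1)
proof (induction w)
  case Nil
  then show ?case using one by simp
next
  case (Cons a w)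
  then have w: "w \<in> carrier (FreeGrp n)" "P w" and a: "fst a \<in> {1..n}"
    by (auto simp: carrier_FreeGrp dest: reduced_Cons)
  have eq: "word_mult [a] w = a # w"
    using Cons.prems by (simp add: carrier_FreeGrp red_cons_reduced)
  show ?case
  proof (cases "snd a")
    case True
    then have "a = (fst a, True)" by (simp add: prod_eq_iff)
    then show ?thesis using gen [OF a w] eq by simp
  next
    case False
    then have "a = (fst a, False)" by (simp add: prod_eq_iff)
    then show ?thesis using inv [OF a w] eq inv_gen [OF a] by simp
  qed
qed

lemma generate_FreeGrp: "generate (FreeGrp n) (gen ` {1..n}) = carrier (FreeGrp n)"
proof
  have sub: "gen ` {1..n} \<subseteq> carrier (FreeGrp n)" using gen_closed by auto
  then show "generate (FreeGrp n) (gen ` {1..n}) \<subseteq> carrier (FreeGrp n)" by (rule F.generate_incl)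
  show "carrier (FreeGrp n) \<subseteq> generate (FreeGrp n) (gen ` {1..n})"
  proof
    fix w assume "w \<in> carrier (FreeGrp n)"
    then show "w \<in> generate (FreeGrp n) (gen ` {1..n})"
      by (induction rule: FreeGrp_induct)
        (blast intro: generate.one generate.eng generate.incl generate.inv)+
  qed
qed

lemma FreeGrp_hom_eqI:
  assumes "group_hom (FreeGrp n) H f" "group_hom (FreeGrp n) H g"
    and "\<And>i. i \<in> {1..n} \<Longrightarrow> f (gen i) = g (gen i)" and "w \<in> carrier (FreeGrp n)"
  shows "f w = g w"
proof -
  interpret f: group_hom "FreeGrp n" H f by (rule assms(1))
  interpret g: group_hom "FreeGrp n" H g by (rule assms(2))
  show ?thesis
    using assms(4)
  proof (induction rule: FreeGrp_induct)
    case one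
    show ?case using f.hom_one g.hom_one by simp
  next
    case (gen i w)
    then show ?case
      using f.hom_mult [of "gen i" w] g.hom_mult [of "gen i" w] gen_closed [OF gen(1)] assms(3) by simp
  next
    case (inv i w)
    then show ?case
      using f.hom_mult [of "inv\<^bsub>FreeGrp n\<^esub> (gen i)" w] g.hom_mult [of "inv\<^bsub>FreeGrp n\<^esub> (gen i)" w]
        f.hom_inv [of "gen i"] g.hom_inv [of "gen i"]
        gen_closed [OF inv(1)] assms(3) by simp
  qed
qed

text \<open>The universal property for targets in any group; \<open>subst_hom\<close> is the case of
  a free target, whereas \<open>push\<close> below maps to a group of automorphisms.\<close>

definition free_lift :: "('a, 'b) monoid_scheme \<Rightarrow> (nat \<Rightarrow> 'a) \<Rightarrow> word \<Rightarrow> 'a" where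
  "free_lift G \<phi> w =
     foldr (\<lambda>(i, b) acc. (if b then \<phi> i else inv\<^bsub>G\<^esub> \<phi> i) \<otimes>\<^bsub>G\<^esub> acc) w \<one>\<^bsub>G\<^esub>"

lemma free_lift_simps:
  "free_lift G \<phi> [] = \<one>\<^bsub>G\<^esub>"
  "free_lift G \<phi> ((i, b) # w) = (if b then \<phi> i else inv\<^bsub>G\<^esub> \<phi> i) \<otimes>\<^bsub>G\<^esub> free_lift G \<phi> w"
  by (simp_all add: free_lift_def)

lemma group_hom_free_lift:
  assumes "group G" and \<phi>: "\<And>i. i \<in> {1..n} \<Longrightarrow> \<phi> i \<in> carrier G"
  shows "group_hom (FreeGrp n) G (free_lift G \<phi>)"
proof -
  interpret G: group G by (rule assms)
  have closed: "free_lift G \<phi> w \<in> carrier G" if "set w \<subseteq> {1..n} \<times> UNIV" for w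
    using that by (induction w) (auto simp: free_lift_simps \<phi>)
  have cons: "free_lift G \<phi> (red_cons (i, b) w) = free_lift G \<phi> ((i, b) # w)"
    if "i \<in> {1..n}" "set w \<subseteq> {1..n} \<times> UNIV" for i b w
    using that closed \<phi> by (cases w) (auto simp: free_lift_simps inverse_letters_def)
  have "free_lift G \<phi> (word_mult v w) = free_lift G \<phi> v \<otimes>\<^bsub>G\<^esub> free_lift G \<phi> w"
    if "set v \<subseteq> {1..n} \<times> UNIV" and w: "set w \<subseteq> {1..n} \<times> UNIV" for v w
    using that(1)
  proof (induction v)
    case Nil
    then show ?case using closed [OF w] by (simp add: free_lift_simps)
  next
    case (Cons a v)
    obtain i b where a: "a = (i, b)" by (cases a)
    have i: "i \<in> {1..n}" and v: "set v \<subseteq> {1..n} \<times> UNIV" using Cons.prems a by auto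
    have vw: "set (word_mult v w) \<subseteq> {1..n} \<times> UNIV" using set_word_mult [of v w] v w by blast
    show ?case
      using cons [OF i vw] Cons.IH [OF v] closed [OF v] closed [OF w] \<phi> [OF i]
      by (simp add: a free_lift_simps G.m_assoc)
  qed
  then show ?thesis
    using closed by (auto simp: group_hom_def group_hom_axioms_def hom_def carrier_FreeGrp
        group_FreeGrp assms(1))
qed

lemma free_lift_gen: "group G \<Longrightarrow> \<phi> i \<in> carrier G \<Longrightarrow> free_lift G \<phi> (gen i) = \<phi> i"
  by (simp add: free_lift_simps group.is_monoid monoid.r_one)

lemma subst_hom_Cons:
  "subst_hom \<phi> [] = []"
  "subst_hom \<phi> ((i, b) # w) = word_mult (if b then \<phi> i else word_inv (\<phi> i)) (subst_hom \<phi> w)"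
  by (simp_all add: subst_hom_def)

lemma subst_hom_eq_free_lift:
  assumes "set w \<subseteq> {1..n} \<times> UNIV" and "\<And>i. i \<in> {1..n} \<Longrightarrow> \<phi> i \<in> carrier (FreeGrp m)"
  shows "subst_hom \<phi> w = free_lift (FreeGrp m) \<phi> w"
  using assms(1)
proof (induction w)
  case (Cons a w)
  then show ?case using assms(2) by (cases a) (auto simp: free_lift_simps subst_hom_Cons inv_FreeGrp)
qed (simp add: free_lift_simps subst_hom_Cons)

lemma group_hom_subst_hom:
  assumes \<phi>: "\<And>i. i \<in> {1..n} \<Longrightarrow> \<phi> i \<in> carrier (FreeGrp m)"
  shows "group_hom (FreeGrp n) (FreeGrp m) (subst_hom \<phi>)"
proof -
  interpret l: group_hom "FreeGrp n" "FreeGrp m" "free_lift (FreeGrp m) \<phi>"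
    by (rule group_hom_free_lift [OF group_FreeGrp \<phi>])
  have eq: "subst_hom \<phi> w = free_lift (FreeGrp m) \<phi> w" if "w \<in> carrier (FreeGrp n)" for w
    using that \<phi> by (intro subst_hom_eq_free_lift) (auto simp: carrier_FreeGrp)
  have "subst_hom \<phi> \<in> hom (FreeGrp n) (FreeGrp m)"
  proof (rule homI)
    fix v w assume v: "v \<in> carrier (FreeGrp n)" and w: "w \<in> carrier (FreeGrp n)"
    show "subst_hom \<phi> (v \<otimes>\<^bsub>FreeGrp n\<^esub> w) = subst_hom \<phi> v \<otimes>\<^bsub>FreeGrp m\<^esub> subst_hom \<phi> w"
      using l.hom_mult [OF v w] eq v w F.m_closed [OF v w] by simp
  qed (simp add: eq)
  then show ?thesis by (simp add: group_hom_def group_hom_axioms_def group_FreeGrp)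
qed

lemma subst_hom_gen: "reduced (\<phi> i) \<Longrightarrow> subst_hom \<phi> (gen i) = \<phi> i"
  by (simp add: subst_hom_Cons word_mult_Nil)

section \<open>The Magnus expansion\<close>

text \<open>Formal power series over the integers in noncommuting variables indexed by \<open>nat\<close>,
  given by their coefficients on monomials.\<close>

typedef series = "UNIV :: (nat list \<Rightarrow> int) set"
  morphisms mcoeff Series ..

declare Series_inverse [OF UNIV_I, simp]

lemma series_eqI: "(\<And>u. mcoeff f u = mcoeff g u) \<Longrightarrow> f = g"
  by (simp add: mcoeff_inject [symmetric] fun_eq_iff)

text \<open>The Cauchy product, summed over all splittings of a monomial into prefix and suffix
  (\<open>conv_eq_sum\<close>). The recursive form makes bilinearity and associativity plain list
  inductions.\<close>

primrec conv :: "nat list \<Rightarrow> (nat list \<Rightarrow> int) \<Rightarrow> (nat list \<Rightarrow> int) \<Rightarrow> int" where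
  "conv [] f g = f [] * g []"
| "conv (a # u) f g = f [] * g (a # u) + conv u (\<lambda>v. f (a # v)) g"

lemma conv_linear_left:
  "conv u (\<lambda>v. c * f v + f' v) g = c * conv u f g + conv u f' g"
  by (induction u arbitrary: f f') (simp_all add: algebra_simps)

lemma conv_add_left: "conv u (\<lambda>v. f v + f' v) g = conv u f g + conv u f' g"
  using conv_linear_left [of u 1] by simp

lemma conv_add_right: "conv u f (\<lambda>v. g v + g' v) = conv u f g + conv u f g'"
  by (induction u arbitrary: f) (simp_all add: algebra_simps)

lemma conv_zero_left: "conv u (\<lambda>_. 0) g = 0"
  by (induction u) simp_all

lemma conv_assoc: "conv u (\<lambda>v. conv v f g) h = conv u f (\<lambda>v. conv v g h)"
  by (induction u arbitrary: f) (simp_all add: conv_linear_left algebra_simps)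

lemma conv_one_left: "conv u (\<lambda>v. if v = [] then 1 else 0) g = g u"
  by (cases u) (simp_all add: conv_zero_left)

lemma conv_one_right: "conv u f (\<lambda>v. if v = [] then 1 else 0) = f u"
  by (induction u arbitrary: f) simp_all

lemma conv_eq_sum: "conv u f g = (\<Sum>k\<le>length u. f (take k u) * g (drop k u))"
  by (induction u arbitrary: f) (simp_all add: sum.atMost_Suc_shift del: sum.atMost_Suc)

instantiation series :: ring_1
begin

definition "0 = Series (\<lambda>_. 0)"
definition "1 = Series (\<lambda>u. if u = [] then 1 else 0)"
definition "f + g = Series (\<lambda>u. mcoeff f u + mcoeff g u)"
definition "- f = Series (\<lambda>u. - mcoeff f u)"
definition "f - g = Series (\<lambda>u. mcoeff f u - mcoeff g u)"
definition "f * g = Series (\<lambda>u. conv u (mcoeff f) (mcoeff g))"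

lemma coeff_simps [simp]:
  "mcoeff 0 u = 0" "mcoeff 1 u = (if u = [] then 1 else 0)"
  "mcoeff (f + g) u = mcoeff f u + mcoeff g u" "mcoeff (- f) u = - mcoeff f u"
  "mcoeff (f - g) u = mcoeff f u - mcoeff g u"
  by (simp_all add: zero_series_def one_series_def plus_series_def uminus_series_def minus_series_def)

lemma coeff_mult: "mcoeff (f * g) u = conv u (mcoeff f) (mcoeff g)"
  by (simp add: times_series_def)

instance
proof
  fix a b c :: series
  show "a * b * c = a * (b * c)"
    by (rule series_eqI) (simp add: times_series_def conv_assoc)
  show "1 * a = a" "a * 1 = a"
    by (rule series_eqI, simp add: times_series_def one_series_def conv_one_left conv_one_right)+
  show "(a + b) * c = a * c + b * c" "a * (b + c) = a * b + a * c"
    by (rule series_eqI, simp add: times_series_def plus_series_def conv_add_left conv_add_right)+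
  show "(0 :: series) \<noteq> 1"
    by (metis coeff_simps(1,2) zero_neq_one)
qed (rule series_eqI, simp)+

end

section \<open>The expansion of letters and words\<close>

definition svar :: "nat \<Rightarrow> series" where
  "svar i = Series (\<lambda>u. if u = [i] then 1 else 0)"

text \<open>Magnus' substitution of \<open>1 + X_i\<close> for \<open>x_i\<close>; the inverse
  letter is sent to the geometric series with coefficient \<open>(-1)^k\<close> at the
  \<open>k\<close>-th power of \<open>X_i\<close>.\<close>

definition sletter :: "letter \<Rightarrow> series" where
  "sletter a = (if snd a then 1 + svar (fst a)
     else Series (\<lambda>u. if set u \<subseteq> {fst a} then (- 1) ^ length u else 0))"

primrec magnus :: "word \<Rightarrow> series" where
  "magnus [] = 1"
| "magnus (a # w) = sletter a * magnus w"

lemma coeff_svar [simp]: "mcoeff (svar i) u = (if u = [i] then 1 else 0)"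
  by (simp add: svar_def)

lemma coeff_svar_mult: "mcoeff (svar i * f) (a # u) = (if a = i then mcoeff f u else 0)"
  using conv_one_left [of u "mcoeff f"] by (simp add: coeff_mult conv_zero_left)

lemma coeff_mult_svar:
  "mcoeff (f * svar i) [] = 0" "mcoeff (f * svar i) (u @ [a]) = (if a = i then mcoeff f u else 0)"
proof -
  have "conv (u @ [a]) g (\<lambda>u. if u = [i] then 1 else 0) = (if a = i then g u else 0)" for g
    by (induction u arbitrary: g) auto
  then show "mcoeff (f * svar i) (u @ [a]) = (if a = i then mcoeff f u else 0)"
    by (simp add: coeff_mult svar_def)
qed (simp add: coeff_mult)

lemma sletter_inverse:
  assumes "inverse_letters a b"
  shows "sletter a * sletter b = 1"
proof -
  define g where "g = (\<lambda>i. \<lambda>u. if set u \<subseteq> {i :: nat} then (- 1 :: int) ^ length u else 0)"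
  have left: "(1 + svar i) * Series (g i) = 1" for i
  proof (rule series_eqI)
    fix u show "mcoeff ((1 + svar i) * Series (g i)) u = mcoeff 1 u"
      by (cases u) (simp_all add: distrib_right coeff_svar_mult g_def, simp add: coeff_mult)
  qed
  have right: "Series (g i) * (1 + svar i) = 1" for i
  proof (rule series_eqI)
    fix u show "mcoeff (Series (g i) * (1 + svar i)) u = mcoeff 1 u"
      by (cases u rule: rev_cases) (simp_all add: distrib_left coeff_mult_svar g_def)
  qed
  show ?thesis
    using assms left [unfolded g_def] right [unfolded g_def]
    by (cases "snd a") (auto simp: sletter_def inverse_letters_def)
qed

lemma magnus_red_cons: "magnus (red_cons a w) = sletter a * magnus w"
  using sletter_inverse by (cases w) (auto simp: mult.assoc [symmetric])

lemma magnus_word_mult: "magnus (word_mult v w) = magnus v * magnus w"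
  by (induction v) (simp_all add: magnus_red_cons mult.assoc)

lemma coeff_mult_Nil: "mcoeff (f * g) [] = mcoeff f [] * mcoeff g []"
  by (simp add: coeff_mult)

lemma coeff_magnus_Nil [simp]: "mcoeff (magnus w) [] = 1"
  by (induction w) (simp_all add: coeff_mult_Nil sletter_def)

lemma magnus_inv:
  assumes "x \<in> carrier (FreeGrp n)"
  shows "magnus x * magnus (inv\<^bsub>FreeGrp n\<^esub> x) = 1" "magnus (inv\<^bsub>FreeGrp n\<^esub> x) * magnus x = 1"
proof -
  have "word_mult x (inv\<^bsub>FreeGrp n\<^esub> x) = []" "word_mult (inv\<^bsub>FreeGrp n\<^esub> x) x = []"
    using F.r_inv [OF assms] F.l_inv [OF assms] by simp_all
  then show "magnus x * magnus (inv\<^bsub>FreeGrp n\<^esub> x) = 1" "magnus (inv\<^bsub>FreeGrp n\<^esub> x) * magnus x = 1"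
    by (simp_all add: magnus_word_mult [symmetric])
qed

lemma magnus_mult_minus_one:
  "magnus (word_mult x y) - 1 = (magnus x - 1) + (magnus y - 1) + (magnus x - 1) * (magnus y - 1)"
  by (simp add: magnus_word_mult algebra_simps)

lemma magnus_inv_minus_one:
  assumes "x \<in> carrier (FreeGrp n)"
  shows "magnus (inv\<^bsub>FreeGrp n\<^esub> x) - 1 = - ((magnus x - 1) * magnus (inv\<^bsub>FreeGrp n\<^esub> x))"
  using magnus_inv [OF assms] by (simp add: algebra_simps)

text \<open>Up to a factor with constant term 1, the expansion turns the group commutator into the
  ring commutator. Both the degree estimate and the leading monomials of commutators are read off
  from this.\<close>

lemma magnus_commutator:
  assumes x: "x \<in> carrier (FreeGrp n)" and y: "y \<in> carrier (FreeGrp n)"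
  shows "magnus (commutator (FreeGrp n) x y) - 1 =
    ((magnus x - 1) * (magnus y - 1) - (magnus y - 1) * (magnus x - 1))
      * magnus (word_mult (inv\<^bsub>FreeGrp n\<^esub> x) (inv\<^bsub>FreeGrp n\<^esub> y))"
proof -
  let ?X = "magnus x" and ?Y = "magnus y"
  let ?X' = "magnus (inv\<^bsub>FreeGrp n\<^esub> x)" and ?Y' = "magnus (inv\<^bsub>FreeGrp n\<^esub> y)"
  have "?Y * ?X * (?X' * ?Y') = ?Y * (?X * ?X') * ?Y'" by (simp only: mult.assoc)
  then have one: "?Y * ?X * (?X' * ?Y') = 1" using magnus_inv [OF x] magnus_inv [OF y] by simp
  have "magnus (commutator (FreeGrp n) x y) - 1 = ?X * ?Y * (?X' * ?Y') - ?Y * ?X * (?X' * ?Y')"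
    unfolding one by (simp add: commutator_def magnus_word_mult mult.assoc)
  also have "\<dots> = (?X * ?Y - ?Y * ?X) * (?X' * ?Y')" by (simp add: left_diff_distrib)
  also have "?X * ?Y - ?Y * ?X = (?X - 1) * (?Y - 1) - (?Y - 1) * (?X - 1)"
    by (simp add: algebra_simps)
  finally show ?thesis by (simp add: magnus_word_mult)
qed

section \<open>The degree filtration\<close>

definition vanishes :: "nat \<Rightarrow> series \<Rightarrow> bool" where
  "vanishes k f \<longleftrightarrow> (\<forall>u. length u < k \<longrightarrow> mcoeff f u = 0)"

lemma vanishes_mult:
  assumes "vanishes k f" "vanishes l g"
  shows "vanishes (k + l) (f * g)"
  unfolding vanishes_def
proof (intro allI impI)
  fix u :: "nat list" assume "length u < k + l"
  then have "mcoeff f (take i u) * mcoeff g (drop i u) = 0" if "i \<le> length u" for i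
    using assms that by (cases "i < k") (auto simp: vanishes_def)
  then show "mcoeff (f * g) u = 0" unfolding coeff_mult conv_eq_sum by (intro sum.neutral) auto
qed

lemma vanishes_mult_left: "vanishes k f \<Longrightarrow> vanishes k (f * g)"
  using vanishes_mult [of k f 0 g] by (simp add: vanishes_def)

lemma vanishes_arith:
  assumes "vanishes k f"
  shows vanishes_add: "vanishes k g \<Longrightarrow> vanishes k (f + g)"
    and vanishes_diff: "vanishes k g \<Longrightarrow> vanishes k (f - g)"
    and vanishes_minus: "vanishes k (- f)"
  using assms by (auto simp: vanishes_def)

lemma vanishes_magnus: "vanishes 1 (magnus w - 1)"
  by (simp add: vanishes_def)

text \<open>The easy half of Magnus' theorem: a ring commutator of series of orders \<open>k\<close>
  and 1 has order at least \<open>k + 1\<close>.\<close>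

lemma lcs_vanishes: "w \<in> lcs (FreeGrp n) k \<Longrightarrow> vanishes k (magnus w - 1)"
proof (induction k arbitrary: w)
  case 0
  then show ?case by (simp add: vanishes_def)
next
  case (Suc k)
  show ?case
  proof (cases "k = 0")
    case True
    then show ?thesis using vanishes_magnus by simp
  next
    case False
    let ?C = "{commutator (FreeGrp n) x y | x y. x \<in> lcs (FreeGrp n) k \<and> y \<in> carrier (FreeGrp n)}"
    have C: "vanishes (Suc k) (magnus c - 1) \<and> c \<in> carrier (FreeGrp n)" if "c \<in> ?C" for c
    proof -
      obtain x y where x: "x \<in> lcs (FreeGrp n) k" and y: "y \<in> carrier (FreeGrp n)"
        and c: "c = commutator (FreeGrp n) x y" using \<open>c \<in> ?C\<close> by blast
      have xc: "x \<in> carrier (FreeGrp n)" using x F.lcs_closed by blast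
      have "vanishes (k + 1) ((magnus x - 1) * (magnus y - 1))"
        "vanishes (1 + k) ((magnus y - 1) * (magnus x - 1))"
        using Suc.IH [OF x] vanishes_magnus vanishes_mult by blast+
      then have "vanishes (Suc k) ((magnus x - 1) * (magnus y - 1) - (magnus y - 1) * (magnus x - 1))"
        using vanishes_diff by simp
      then show ?thesis
        using xc y vanishes_mult_left unfolding c magnus_commutator [OF xc y] by simp
    qed
    have "w \<in> generate (FreeGrp n) ?C" using Suc.prems False lcs_Suc [of k "FreeGrp n"] by simp
    then show ?thesis
    proof (induction w rule: generate.induct)
      case one
      then show ?case by (simp add: vanishes_def)
    next
      case (incl c)
      then show ?case using C by blast
    next
      case (inv c)
      then show ?case
        using C [OF inv] by (simp add: magnus_inv_minus_one vanishes_minus vanishes_mult_left)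
    next
      case (eng v w)
      then show ?case
        by (simp add: magnus_mult_minus_one vanishes_add vanishes_mult_left)
    qed
  qed
qed

section \<open>Magnus' theorem\<close>

definition leads :: "series \<Rightarrow> nat list \<Rightarrow> int \<Rightarrow> bool" where
  "leads f v c \<longleftrightarrow> mcoeff f v = c \<and>
     (\<forall>u. length u < length v \<or> length u = length v \<and> u < v \<longrightarrow> mcoeff f u = 0)"

lemma append_less_append_iff:
  "length a = length v \<Longrightarrow> a @ b < v @ w \<longleftrightarrow> a < v \<or> a = v \<and> b < (w :: nat list)"
  by (induction a v rule: list_induct2) auto

text \<open>The comparison is decided at a position inside both words and therefore survives any
  continuation.\<close>

lemma not_prefix_less_append:
  "v < w \<Longrightarrow> \<not> prefix v w \<Longrightarrow> v @ a < w @ (b :: nat list)"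
proof (induction v arbitrary: w)
  case (Cons x v)
  then show ?case by (cases w) auto
qed simp

text \<open>Up to degree \<open>|v| + |w|\<close>, the only splitting that can contribute to the
  product is the one after \<open>|v|\<close> letters in exactly that degree; there the order on
  concatenations is lexicographic in the two parts.\<close>

lemma leads_mult:
  assumes f: "leads f v c" and g: "leads g w d"
  shows "leads (f * g) (v @ w) (c * d)"
proof -
  have coeff: "mcoeff (f * g) u =
      (if length u = length v + length w then mcoeff f (take (length v) u) * mcoeff g (drop (length v) u) else 0)"
    if u: "length u \<le> length v + length w" for u
  proof -
    let ?t = "\<lambda>k. mcoeff f (take k u) * mcoeff g (drop k u)"
    have zero: "?t k = 0" if "k \<le> length u" "k \<noteq> length v \<or> length u < length v + length w" for k
      using that u f g by (cases "k < length v") (auto simp: leads_def)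
    show ?thesis
    proof (cases "length u = length v + length w")
      case True
      have "(\<Sum>k\<le>length u. ?t k) = (\<Sum>k\<in>{length v}. ?t k)"
        by (rule sum.mono_neutral_right) (use True zero in auto)
      then show ?thesis using True by (simp add: coeff_mult conv_eq_sum)
    next
      case False
      then have "(\<Sum>k\<le>length u. ?t k) = 0"
        by (intro sum.neutral ballI zero) (use u in auto)
      then show ?thesis using False by (simp add: coeff_mult conv_eq_sum)
    qed
  qed
  have "mcoeff (f * g) u = 0" if u: "length u = length v + length w" "u < v @ w" for u
  proof -
    have "take (length v) u @ drop (length v) u < v @ w" using u by simp
    then have "take (length v) u < v \<or> take (length v) u = v \<and> drop (length v) u < w"
      using u append_less_append_iff [of "take (length v) u" v "drop (length v) u" w] by simp
    then show ?thesis using u f g by (auto simp: coeff leads_def)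
  qed
  then show ?thesis using f g by (auto simp: leads_def coeff)
qed

lemma leads_add:
  assumes "leads f v c"
    and "\<And>u. length u < length v \<or> length u = length v \<and> u \<le> v \<Longrightarrow> mcoeff g u = 0"
  shows "leads (f + g) v c"
  using assms by (auto simp: leads_def)

lemma leads_short: "leads f v c \<Longrightarrow> length u < length v \<Longrightarrow> mcoeff f u = 0"
  by (simp add: leads_def)

text \<open>Of the two products in the ring commutator the one with the smaller monomial
  \<open>v w\<close> leads, and the remaining factor has constant term 1.\<close>

lemma leads_commutator:
  assumes x: "x \<in> carrier (FreeGrp n)" and y: "y \<in> carrier (FreeGrp n)"
    and v: "leads (magnus x - 1) v 1" and w: "leads (magnus y - 1) w 1" and less: "v @ w < w @ v"
  shows "leads (magnus (commutator (FreeGrp n) x y) - 1) (v @ w) 1"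
proof -
  have "leads ((magnus x - 1) * (magnus y - 1)) (v @ w) 1"
    "leads ((magnus y - 1) * (magnus x - 1)) (w @ v) 1"
    using leads_mult [OF v w] leads_mult [OF w v] by simp_all
  then have "leads ((magnus x - 1) * (magnus y - 1) - (magnus y - 1) * (magnus x - 1)) (v @ w) 1"
    using less by (auto simp: leads_def)
  moreover have "leads (magnus (word_mult (inv\<^bsub>FreeGrp n\<^esub> x) (inv\<^bsub>FreeGrp n\<^esub> y))) [] 1"
    by (simp add: leads_def)
  ultimately show ?thesis
    unfolding magnus_commutator [OF x y] using leads_mult by fastforce
qed

text \<open>Modulo terms of higher degree, \<open>M(g^a) - 1\<close> is \<open>a (M(g) - 1)\<close>,
  the correction terms starting in degree \<open>2 |v|\<close>; this exceeds \<open>|v|\<close>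
  because \<open>v\<close> is nonempty.\<close>

lemma leads_int_pow:
  assumes g: "g \<in> carrier (FreeGrp n)" and v: "v \<noteq> []" "leads (magnus g - 1) v 1"
  shows "leads (magnus (g [^]\<^bsub>FreeGrp n\<^esub> (a :: int)) - 1) v a"
proof -
  have pow: "leads (magnus (g [^]\<^bsub>FreeGrp n\<^esub> m) - 1) v (int m)" for m :: nat
  proof (induction m)
    case 0
    then show ?case by (simp add: leads_def)
  next
    case (Suc m)
    have "leads ((magnus (g [^]\<^bsub>FreeGrp n\<^esub> m) - 1) * (magnus g - 1)) (v @ v) (int m)"
      using leads_mult [OF Suc v(2)] by simp
    then show ?case
      using Suc v by (auto simp: leads_def magnus_mult_minus_one)
  qed
  show ?thesis
  proof (cases a rule: int_cases2)
    case (nonneg m)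
    then show ?thesis using pow g by (simp add: int_pow_int)
  next
    case (nonpos m)
    let ?p = "g [^]\<^bsub>FreeGrp n\<^esub> m"
    have p: "?p \<in> carrier (FreeGrp n)" using g by simp
    have "leads (magnus (inv\<^bsub>FreeGrp n\<^esub> ?p)) [] 1" by (simp add: leads_def)
    then have "leads ((magnus ?p - 1) * magnus (inv\<^bsub>FreeGrp n\<^esub> ?p)) v (int m)"
      using leads_mult [OF pow [of m]] by fastforce
    then have "leads (magnus (inv\<^bsub>FreeGrp n\<^esub> ?p) - 1) v (- int m)"
      unfolding magnus_inv_minus_one [OF p] by (simp add: leads_def)
    then show ?thesis using nonpos g by (simp add: F.int_pow_neg_int)
  qed
qed

lemma concat_replicate_commute: "v @ concat (replicate k v) = concat (replicate k v) @ v"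
  by (induction k) simp_all

text \<open>Lazard elimination, carried out modulo \<open>\<Gamma>\<^sub>j\<close>: if \<open>g\<close> is the element with the
  lexicographically least monomial \<open>v\<close>, the subgroup generated by the family is the product of
  the subgroup generated by the iterated commutators \<open>[g, [g, \<dots>, [g, h]]]\<close> of the remaining
  elements \<open>h\<close>, which \<open>g\<close> normalises, and of the powers of \<open>g\<close>. These commutators have leading monomials
  \<open>v\<^sup>k \<lambda>\<close>, again a prefix code; the multiset of the numbers \<open>j - |\<lambda>|\<close> has decreased.\<close>

lemma magnus_elimination:
  fixes Y :: "(nat list \<times> word) set" and j n :: nat
  defines "F \<equiv> FreeGrp n"
  assumes "finite Y"
    and "\<And>p. p \<in> Y \<Longrightarrow> fst p \<noteq> [] \<and> length (fst p) < j \<and> snd p \<in> lcs F (length (fst p)) \<and>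
      leads (magnus (snd p) - 1) (fst p) 1"
    and "\<And>p q. p \<in> Y \<Longrightarrow> q \<in> Y \<Longrightarrow> p \<noteq> q \<Longrightarrow> \<not> prefix (fst p) (fst q)"
    and "x \<in> generate F (snd ` Y \<union> lcs F j)" and "x \<notin> lcs F j"
  shows "\<exists>w c. leads (magnus x - 1) w c \<and> c \<noteq> 0 \<and> length w < j \<and> (\<exists>p\<in>Y. fst p \<le> w)"
proof -
  define weight where
    "weight = (\<lambda>Y :: (nat list \<times> word) set. image_mset (\<lambda>p. j - length (fst p)) (mset_set Y))"
  have wf: "wf (inv_image (mult less_than) weight)"
    by (intro wf_inv_image wf_mult wf_less_than)
  interpret F: group F unfolding F_def by (rule group_FreeGrp)
  show ?thesis
    using assms(2-)
  proof (induction Y arbitrary: x rule: wf_induct_rule [OF wf])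
    case (1 Y)
    note IH = 1(1) and fin = 1(2) and item = 1(3) and code = 1(4) and x = 1(5,6)
    have "Y \<noteq> {}"
    proof
      assume "Y = {}"
      then have "x \<in> lcs F j"
        using x(1) F.generate_subgroup_incl [of "lcs F j" "lcs F j"] F.lcs_subgroup by auto
      then show False using x(2) by blast
    qed
    then have "Min (fst ` Y) \<in> fst ` Y" using fin by simp
    then obtain g where vg: "(Min (fst ` Y), g) \<in> Y" by auto
    define v where "v = Min (fst ` Y)"
    have vg: "(v, g) \<in> Y" using vg by (simp add: v_def)
    have v: "v \<noteq> []" "length v < j" "g \<in> lcs F (length v)" "leads (magnus g - 1) v 1"
      using item [OF vg] by simp_all
    have gc: "g \<in> carrier F" using v(3) F.lcs_closed by blast
    define Z where "Z = Y - {(v, g)}"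
    have finZ: "finite Z" using fin by (simp add: Z_def)
    have incomp: "\<not> prefix v (fst p)" "\<not> prefix (fst p) v" if "p \<in> Z" for p
      using that code [OF vg, of p] code [OF _ vg, of p] by (auto simp: Z_def)
    have vless: "v < fst p" if "p \<in> Z" for p
    proof -
      have "v \<le> fst p" using that fin by (simp add: v_def Z_def)
      moreover have "v \<noteq> fst p" using incomp [OF that] by auto
      ultimately show ?thesis by simp
    qed
    define E where "E = (\<lambda>k p. (concat (replicate k v) @ fst p, (commutator F g ^^ k) (snd p)))"
    \<comment> \<open>Only the commutators of degree below \<open>j\<close> are kept, which are
      finitely many; the others lie in \<open>lcs F j\<close>, which belongs to the generating set
      anyway.\<close>
    define Y' where "Y' = {E k p | k p. p \<in> Z \<and> length (fst (E k p)) < j}"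
    have E_Suc: "E (Suc k) p = (v @ fst (E k p), commutator F g (snd (E k p)))" for k p
      by (simp add: E_def)
    have E_item: "fst (E k p) \<noteq> [] \<and> snd (E k p) \<in> lcs F (length (fst (E k p))) \<and>
        leads (magnus (snd (E k p)) - 1) (fst (E k p)) 1" if p: "p \<in> Z" for k p
    proof (induction k)
      case 0
      show ?case using p item [of p] by (simp add: E_def Z_def)
    next
      case (Suc k)
      let ?w = "fst (E k p)" and ?h = "snd (E k p)"
      have h: "?h \<in> carrier F" using Suc F.lcs_closed by blast
      \<comment> \<open>For the original monomial \<open>\<lambda>\<close> this holds since
        \<open>v < \<lambda>\<close> is decided within both words. Putting \<open>v^k\<close> in
        front of both sides and moving \<open>v\<close> past its own powers gives the same for
        \<open>v^k \<lambda>\<close>.\<close>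
      have "v @ fst p < fst p @ v" using not_prefix_less_append vless incomp p by blast
      then have "concat (replicate k v) @ v @ fst p < concat (replicate k v) @ fst p @ v"
        by (simp add: append_less_append_iff)
      then have "v @ ?w < ?w @ v"
        using concat_replicate_commute [of v k] by (simp add: E_def flip: append_assoc)
      then have "leads (magnus (commutator F g ?h) - 1) (v @ ?w) 1"
        unfolding F_def using gc h v(4) Suc by (intro leads_commutator) (auto simp: F_def)
      moreover have "commutator F g ?h \<in> lcs F (length v + length ?w)"
        using v Suc by (intro F.lcs_commutator) (auto simp: Suc_le_eq)
      ultimately show ?case using v(1) by (simp add: E_Suc)
    qed
    have Ec: "snd (E k p) \<in> carrier F" if "p \<in> Z" for k p
      using E_item [OF that] F.lcs_closed by blast
    have vE: "v < fst (E k p)" if "p \<in> Z" for k p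
    proof (cases k)
      case 0
      then show ?thesis using vless that by (simp add: E_def)
    next
      case (Suc l)
      then have "fst (E k p) = v @ fst (E l p)" by (simp add: E_Suc)
      moreover have "[] < fst (E l p)" using E_item [OF that, of l] by (cases "fst (E l p)") auto
      ultimately show ?thesis using append_less_append_iff [of v v "[]" "fst (E l p)"] by simp
    qed
    have length_E: "length (fst (E k p)) = k * length v + length (fst p)" for k p
      by (simp add: E_def length_concat sum_list_replicate)
    have fin': "finite Y'"
    proof (rule finite_subset)
      show "Y' \<subseteq> (\<lambda>(k, p). E k p) ` ({..<j} \<times> Z)"
      proof
        fix q assume "q \<in> Y'"
        then obtain k p where q: "q = E k p" "p \<in> Z" "length (fst (E k p)) < j"
          by (auto simp: Y'_def)
        have "k \<le> k * length v" using v(1) by (cases v) auto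
        then have "k < j" using q(3) length_E [of k p] by linarith
        then show "q \<in> (\<lambda>(k, p). E k p) ` ({..<j} \<times> Z)" using q by auto
      qed
    qed (use finZ in simp)
    have item': "fst q \<noteq> [] \<and> length (fst q) < j \<and> snd q \<in> lcs F (length (fst q)) \<and>
        leads (magnus (snd q) - 1) (fst q) 1" if "q \<in> Y'" for q
      using that E_item by (auto simp: Y'_def)
    have code': "\<not> prefix (fst p') (fst q')" if p': "p' \<in> Y'" and q': "q' \<in> Y'" and "p' \<noteq> q'" for p' q'
    proof
      assume pre: "prefix (fst p') (fst q')"
      obtain k p where p: "p' = E k p" "p \<in> Z" using p' by (auto simp: Y'_def)
      obtain l q where q: "q' = E l q" "q \<in> Z" using q' by (auto simp: Y'_def)
      have pre: "prefix (concat (replicate k v) @ fst p) (concat (replicate l v) @ fst q)"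
        using pre p q by (simp add: E_def)
      \<comment> \<open>After cancelling the common power of \<open>v\<close>, either two original
        monomials are comparable as prefixes, or one of them is comparable with \<open>v\<close>;
        the old prefix code excludes both.\<close>
      consider "k = l" | m where "l = k + Suc m" | m where "k = l + Suc m"
        by (metis less_iff_Suc_add add_Suc_right linorder_neqE_nat)
      then show False
      proof cases
        case 1
        then have "prefix (fst p) (fst q)" using pre by simp
        moreover have "p \<noteq> q" using 1 p q \<open>p' \<noteq> q'\<close> by auto
        ultimately show False using code p q by (auto simp: Z_def)
      next
        case 2
        have "prefix (fst p) (v @ concat (replicate m v) @ fst q)"
          using pre unfolding 2 replicate_add by simp
        then have "prefix (fst p) v \<or> prefix v (fst p)"
          by (rule prefix_same_cases) simp
        then show False using incomp p by blast
      next
        case 3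
        have "prefix (v @ concat (replicate m v) @ fst p) (fst q)"
          using pre unfolding 3 replicate_add by simp
        then have "prefix v (fst q)" by (rule append_prefixD)
        then show False using incomp q by blast
      qed
    qed
    have ZY': "Z \<subseteq> Y'"
    proof
      fix p assume p: "p \<in> Z"
      then have "p = E 0 p" "length (fst (E 0 p)) < j" using item [of p] by (auto simp: E_def Z_def)
      then show "p \<in> Y'" using p unfolding Y'_def by blast
    qed
    have decrease: "(weight Y', weight Y) \<in> mult less_than"
    proof -
      have "mset_set Y' = mset_set Z + mset_set (Y' - Z)"
        using ZY' fin' finZ mset_set_Union [of Z "Y' - Z"] by (simp add: Un_absorb1)
      then have w': "weight Y' = weight Z + weight (Y' - Z)" by (simp add: weight_def)
      have Y: "Y = insert (v, g) Z" and "(v, g) \<notin> Z" using vg by (auto simp: Z_def)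
      then have w: "weight Y = weight Z + {# j - length v #}"
        unfolding Y using finZ by (simp add: weight_def)
      have "j - length (fst q) < j - length v" if q: "q \<in> Y' - Z" for q
      proof -
        obtain k p where kp: "q = E k p" "p \<in> Z" using q by (auto simp: Y'_def)
        then obtain l where "k = Suc l" using q by (cases k) (auto simp: E_def)
        then have "length v < length (fst q)"
          using kp E_item [of p l] by (simp add: E_Suc)
        then show ?thesis using v(2) by linarith
      qed
      then show ?thesis
        unfolding w w' using fin' by (intro one_step_implies_mult) (auto simp: weight_def)
    qed
    let ?S = "snd ` Y' \<union> lcs F j"
    have S: "?S \<subseteq> carrier F"
    proof -
      have "snd ` Y' \<subseteq> carrier F" using Ec unfolding Y'_def by auto
      then show ?thesis using F.lcs_closed by auto
    qed
    have E_gen: "snd (E k p) \<in> generate F ?S" if "p \<in> Z" for k p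
    proof (cases "length (fst (E k p)) < j")
      case True
      then have "E k p \<in> Y'" using that unfolding Y'_def by blast
      then show ?thesis by (intro generate.incl) blast
    next
      case False
      then have "snd (E k p) \<in> lcs F j"
        using E_item [OF that, of k] F.lcs_antimono [of j "length (fst (E k p))"] by auto
      then show ?thesis by (intro generate.incl) blast
    qed
    have gen_lcs: "y \<in> generate F ?S" if "y \<in> lcs F j" for y
      using that by (intro generate.incl) blast
    have conj: "g \<otimes>\<^bsub>F\<^esub> s \<otimes>\<^bsub>F\<^esub> inv\<^bsub>F\<^esub> g \<in> generate F ?S" if "s \<in> ?S" for s
    proof (cases "s \<in> lcs F j")
      case True
      then show ?thesis using gen_lcs normal.inv_op_closed2 [OF F.lcs_normal gc] by blast
    next
      case False
      then obtain k p where p: "p \<in> Z" and s: "s = snd (E k p)"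
        using \<open>s \<in> ?S\<close> by (auto simp: Y'_def)
      have "snd (E (Suc k) p) \<otimes>\<^bsub>F\<^esub> snd (E k p) \<in> generate F ?S"
        using E_gen p by (blast intro: generate.eng)
      then show ?thesis using gc Ec [OF p] by (simp add: s E_Suc commutator_def F.m_assoc)
    qed
    \<comment> \<open>Downward induction on \<open>k\<close>. With \<open>h_(k+1) = [g, h_k]\<close>
      and \<open>a = g^-1 h_(k+1) g\<close>, one has \<open>g^-1 h_k g = a^-1 h_k\<close>; for
      \<open>k \<ge> j\<close> the commutator already lies in the normal subgroup
      \<open>lcs F j\<close>.\<close>
    have conj_E: "inv\<^bsub>F\<^esub> g \<otimes>\<^bsub>F\<^esub> snd (E k p) \<otimes>\<^bsub>F\<^esub> g \<in> generate F ?S" if p: "p \<in> Z" for k p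
    proof (induction "j - k" arbitrary: k)
      case 0
      have "k \<le> k * length v" using v(1) by (cases v) auto
      then have "j \<le> length (fst (E k p))" using 0 length_E [of k p] by linarith
      then have "snd (E k p) \<in> lcs F j" using E_item [OF p, of k] F.lcs_antimono by blast
      then show ?case using gen_lcs normal.inv_op_closed1 [OF F.lcs_normal gc] by blast
    next
      case (Suc m)
      let ?a = "inv\<^bsub>F\<^esub> g \<otimes>\<^bsub>F\<^esub> snd (E (Suc k) p) \<otimes>\<^bsub>F\<^esub> g"
      have "?a \<in> generate F ?S" using Suc by simp
      then have "inv\<^bsub>F\<^esub> ?a \<otimes>\<^bsub>F\<^esub> snd (E k p) \<in> generate F ?S"
        using F.generate_m_inv_closed [OF S] E_gen [OF p] generate.eng by metis
      moreover have "inv\<^bsub>F\<^esub> ?a \<otimes>\<^bsub>F\<^esub> snd (E k p) = inv\<^bsub>F\<^esub> g \<otimes>\<^bsub>F\<^esub> snd (E k p) \<otimes>\<^bsub>F\<^esub> g"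
        using gc Ec [OF p] by (simp add: E_Suc commutator_def F.m_assoc F.inv_mult_group)
      ultimately show ?case by simp
    qed
    have conj_inv: "inv\<^bsub>F\<^esub> g \<otimes>\<^bsub>F\<^esub> s \<otimes>\<^bsub>F\<^esub> g \<in> generate F ?S" if "s \<in> ?S" for s
    proof (cases "s \<in> lcs F j")
      case True
      then show ?thesis using gen_lcs normal.inv_op_closed1 [OF F.lcs_normal gc] by blast
    next
      case False
      then obtain k p where "p \<in> Z" "s = snd (E k p)"
        using \<open>s \<in> ?S\<close> by (auto simp: Y'_def)
      then show ?thesis using conj_E by blast
    qed
    have "snd ` Y \<union> lcs F j \<subseteq> ?S \<union> {g}" using ZY' by (auto simp: Z_def)
    then have "x \<in> generate F (?S \<union> {g})" using x(1) F.mono_generate by blast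
    then obtain y z where y: "y \<in> generate F ?S" and z: "z \<in> generate F {g}" and xyz: "x = y \<otimes>\<^bsub>F\<^esub> z"
      using F.generate_normalized_product [OF S, of "{g}" x] gc conj conj_inv by auto
    have yc: "y \<in> carrier F" using y F.generate_in_carrier [OF S] by blast
    obtain a :: int where a: "z = g [^]\<^bsub>F\<^esub> a" using z F.generate_pow [OF gc] by auto
    have zl: "leads (magnus z - 1) v a"
      unfolding a F_def using gc v by (intro leads_int_pow) (auto simp: F_def)
    have Mx: "magnus x - 1 = (magnus y - 1) + (magnus z - 1) + (magnus y - 1) * (magnus z - 1)"
      unfolding xyz F_def by (simp add: magnus_mult_minus_one)
    \<comment> \<open>This is where the lower bound on \<open>w\<close> in the conclusion pays off:
      all monomials of \<open>Y'\<close> exceed \<open>v\<close>, so the leading monomial of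
      \<open>y\<close> does as well.\<close>
    have IHy: "\<exists>w c. leads (magnus y - 1) w c \<and> c \<noteq> 0 \<and> length w < j \<and> v < w" if "y \<notin> lcs F j"
    proof -
      have "\<exists>w c. leads (magnus y - 1) w c \<and> c \<noteq> 0 \<and> length w < j \<and> (\<exists>q\<in>Y'. fst q \<le> w)"
        by (rule IH [OF _ fin' item' code' y that]) (use decrease in auto)
      moreover have "v < fst q" if "q \<in> Y'" for q using that vE by (auto simp: Y'_def)
      ultimately show ?thesis by (meson less_le_trans)
    qed
    show ?case
    proof (cases "a = 0")
      case True
      then have "x = y" using a xyz yc by simp
      then obtain w c where "leads (magnus x - 1) w c" "c \<noteq> 0" "length w < j" "v < w"
        using IHy x by blast
      then show ?thesis using vg by force
    next
      case a0: False
      show ?thesis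
      proof (cases "y \<in> lcs F j")
        case True
        then have "vanishes j (magnus y - 1)" unfolding F_def by (rule lcs_vanishes)
        then have "vanishes j ((magnus y - 1) + (magnus y - 1) * (magnus z - 1))"
          using vanishes_add vanishes_mult_left by blast
        then have "leads ((magnus z - 1) + ((magnus y - 1) + (magnus y - 1) * (magnus z - 1))) v a"
          using v(2) by (intro leads_add zl) (auto simp: vanishes_def simp del: coeff_simps(3,5))
        then have "leads (magnus x - 1) v a" by (simp only: Mx add_ac)
        then show ?thesis using a0 v vg by force
      next
        case False
        then obtain w c where w: "leads (magnus y - 1) w c" "c \<noteq> 0" "length w < j" "v < w"
          using IHy by blast
        have "w \<noteq> []" using w by auto
        \<comment> \<open>The product term starts only in degree \<open>|w| + |v|\<close>, above
          both factors. So \<open>x = y z\<close> is led by the monomial of smaller degree among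
          \<open>w\<close> and \<open>v\<close>, and by \<open>v\<close> in a tie, since
          \<open>v < w\<close>.\<close>
        note prod = leads_short [OF leads_mult [OF w(1) zl]]
        show ?thesis
        proof (cases "length w < length v")
          case True
          then have "leads ((magnus y - 1) + ((magnus z - 1) + (magnus y - 1) * (magnus z - 1))) w c"
            using v(1) by (intro leads_add w(1)) (auto simp: prod leads_short [OF zl] simp del: coeff_simps(5))
          then have "leads (magnus x - 1) w c" by (simp only: Mx add_ac)
          then show ?thesis using w vg by force
        next
          case False
          have "mcoeff (magnus y - 1) u = 0"
            if "length u < length v \<or> length u = length v \<and> u \<le> v" for u
          proof -
            have "length u < length w \<or> length u = length w \<and> u < w"
              using that False w(4) by auto
            then show ?thesis using w(1) unfolding leads_def by blast
          qed
          then have "leads ((magnus z - 1) + ((magnus y - 1) + (magnus y - 1) * (magnus z - 1))) v a"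
            using \<open>w \<noteq> []\<close> by (intro leads_add zl) (auto simp: prod simp del: coeff_simps(5))
          then have "leads (magnus x - 1) v a" by (simp only: Mx add_ac)
          then show ?thesis using a0 v vg by force
        qed
      qed
    qed
  qed
qed

text \<open>The hard half of Magnus' theorem. The elimination starts from the generators with the
  one-letter monomials, and the coefficient it produces for an element outside
  \<open>\<Gamma>_j\<close> sits in a degree below \<open>j\<close>.\<close>

theorem vanishes_imp_lcs:
  assumes w: "w \<in> carrier (FreeGrp n)" and "vanishes j (magnus w - 1)"
  shows "w \<in> lcs (FreeGrp n) j"
proof (rule ccontr)
  assume not: "w \<notin> lcs (FreeGrp n) j"
  \<comment> \<open>The initial monomials have length 1, which must be below \<open>j\<close>; for
    \<open>j \<le> 1\<close> the term \<open>lcs\<close> is the whole group.\<close>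
  have j: "2 \<le> j"
  proof (rule ccontr)
    assume "\<not> 2 \<le> j"
    then have "j = 0 \<or> j = Suc 0" by linarith
    then show False using not w by auto
  qed
  let ?Y = "(\<lambda>i. ([i], gen i)) ` {1..n}"
  have "\<exists>v c. leads (magnus w - 1) v c \<and> c \<noteq> 0 \<and> length v < j \<and> (\<exists>p\<in>?Y. fst p \<le> v)"
  proof (rule magnus_elimination [OF _ _ _ _ not])
    fix p assume "p \<in> ?Y"
    then obtain i where i: "i \<in> {1..n}" and p: "p = ([i], gen i)" by blast
    have "leads (magnus (gen i) - 1) [i] 1" by (auto simp: leads_def sletter_def)
    then show "fst p \<noteq> [] \<and> length (fst p) < j \<and> snd p \<in> lcs (FreeGrp n) (length (fst p)) \<and>
        leads (magnus (snd p) - 1) (fst p) 1"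
      using j gen_closed [OF i] by (simp add: p)
  next
    have "w \<in> generate (FreeGrp n) (gen ` {1..n})" using w generate_FreeGrp by simp
    moreover have "gen ` {1..n} \<subseteq> snd ` ?Y \<union> lcs (FreeGrp n) j" by force
    ultimately show "w \<in> generate (FreeGrp n) (snd ` ?Y \<union> lcs (FreeGrp n) j)"
      using F.mono_generate by blast
  qed auto
  then show False using assms(2) by (auto simp: leads_def vanishes_def simp del: coeff_simps(5))
qed

section \<open>Combing braids\<close>

context group
begin

lemma generate_inv_image:
  assumes S: "S \<subseteq> carrier G"
  shows "generate G (m_inv G ` S) = generate G S"
proof -
  have sub: "generate G T \<subseteq> generate G (m_inv G ` T)" if T: "T \<subseteq> carrier G" for T
  proof
    fix x assume "x \<in> generate G T"
    then show "x \<in> generate G (m_inv G ` T)"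
    proof (induction x rule: generate.induct)
      case (incl x)
      then have "inv (inv x) \<in> generate G (m_inv G ` T)" by (intro generate.inv) blast
      then show ?case using T incl by (simp add: subset_iff)
    next
      case (inv x)
      then show ?case by (intro generate.incl) blast
    qed (auto intro: generate.one generate.eng)
  qed
  have "(\<lambda>x. inv (inv x)) ` S = S" using S by (force simp: subset_iff)
  then show ?thesis using sub [OF S] sub [of "m_inv G ` S"] S by (auto simp: image_image)
qed

text \<open>To be read with \<open>a = s k\<close>, \<open>b = s (Suc k)\<close> and
  \<open>t = tau (Suc (Suc k))\<close>: the two long conjugates are then \<open>pure_gen k\<close>
  and \<open>pure_gen (Suc k)\<close>, and the claims say how \<open>s k\<close> moves them.\<close>

lemma braid_conj_commuting:
  assumes "a \<in> carrier G" "b \<in> carrier G" "t \<in> carrier G"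
    and at: "a \<otimes> t = t \<otimes> a" and aba: "a \<otimes> b \<otimes> a = b \<otimes> a \<otimes> b"
  shows "a \<otimes> (t \<otimes> b \<otimes> a \<otimes> a \<otimes> inv (t \<otimes> b)) = (t \<otimes> b \<otimes> b \<otimes> inv t) \<otimes> a"
    and "(t \<otimes> b \<otimes> b \<otimes> inv t) \<otimes> a \<otimes> (t \<otimes> b \<otimes> b \<otimes> inv t)
      = (t \<otimes> b \<otimes> a \<otimes> a \<otimes> inv (t \<otimes> b)) \<otimes> (t \<otimes> b \<otimes> b \<otimes> inv t) \<otimes> a"
proof -
  note [simp] = assms(1-3)
  have at': "a \<otimes> inv t = inv t \<otimes> a" using at by (intro commute_inv) simp_all
  have "a \<otimes> (t \<otimes> b \<otimes> a \<otimes> a \<otimes> inv (t \<otimes> b)) = (a \<otimes> t) \<otimes> (b \<otimes> a \<otimes> a \<otimes> inv b \<otimes> inv t)"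
    by (simp add: m_assoc inv_mult_group)
  also have "\<dots> = t \<otimes> (a \<otimes> b \<otimes> a) \<otimes> (a \<otimes> inv b \<otimes> inv t)"
    unfolding at by (simp add: m_assoc)
  also have "\<dots> = t \<otimes> (b \<otimes> a \<otimes> b) \<otimes> (a \<otimes> inv b \<otimes> inv t)"
    by (simp only: aba)
  also have "\<dots> = t \<otimes> b \<otimes> (a \<otimes> b \<otimes> a) \<otimes> (inv b \<otimes> inv t)"
    by (simp add: m_assoc)
  also have "\<dots> = t \<otimes> b \<otimes> b \<otimes> (a \<otimes> inv t)"
    unfolding aba by (simp add: m_assoc)
  also have "\<dots> = (t \<otimes> b \<otimes> b \<otimes> inv t) \<otimes> a"
    unfolding at' by (simp add: m_assoc)
  finally show "a \<otimes> (t \<otimes> b \<otimes> a \<otimes> a \<otimes> inv (t \<otimes> b)) = (t \<otimes> b \<otimes> b \<otimes> inv t) \<otimes> a" .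
  have "(t \<otimes> b \<otimes> b \<otimes> inv t) \<otimes> a \<otimes> (t \<otimes> b \<otimes> b \<otimes> inv t)
      = t \<otimes> b \<otimes> b \<otimes> (inv t \<otimes> a) \<otimes> (t \<otimes> b \<otimes> b \<otimes> inv t)"
    by (simp add: m_assoc)
  also have "\<dots> = t \<otimes> b \<otimes> (b \<otimes> a \<otimes> b) \<otimes> (b \<otimes> inv t)"
    unfolding at' [symmetric] by (simp add: m_assoc)
  also have "\<dots> = t \<otimes> b \<otimes> (a \<otimes> b \<otimes> a) \<otimes> (b \<otimes> inv t)"
    by (simp only: aba)
  also have "\<dots> = t \<otimes> b \<otimes> a \<otimes> (b \<otimes> a \<otimes> b) \<otimes> inv t"
    by (simp add: m_assoc)
  also have "\<dots> = t \<otimes> b \<otimes> a \<otimes> a \<otimes> b \<otimes> (a \<otimes> inv t)"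
    unfolding aba [symmetric] by (simp add: m_assoc)
  also have "\<dots> = (t \<otimes> b \<otimes> a \<otimes> a \<otimes> inv (t \<otimes> b)) \<otimes> (t \<otimes> b \<otimes> b \<otimes> inv t) \<otimes> a"
    unfolding at' by (simp add: m_assoc inv_mult_group)
  finally show "(t \<otimes> b \<otimes> b \<otimes> inv t) \<otimes> a \<otimes> (t \<otimes> b \<otimes> b \<otimes> inv t)
      = (t \<otimes> b \<otimes> a \<otimes> a \<otimes> inv (t \<otimes> b)) \<otimes> (t \<otimes> b \<otimes> b \<otimes> inv t) \<otimes> a" .
qed

end

text \<open>Elements satisfying the braid relations on \<open>N + 1\<close> strands, in an arbitrary
  group: combing is a consequence of the relations and is later applied inside a product of an
  automorphism group and a symmetric group.\<close>

locale braid_relations = group +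
  fixes s :: "nat \<Rightarrow> 'a" and N :: nat
  assumes s_closed: "i \<in> {1..N} \<Longrightarrow> s i \<in> carrier G"
    and far_commute: "1 \<le> i \<Longrightarrow> Suc i < k \<Longrightarrow> k \<le> N \<Longrightarrow> s i \<otimes> s k = s k \<otimes> s i"
    and braid: "1 \<le> i \<Longrightarrow> i < N \<Longrightarrow> s i \<otimes> s (Suc i) \<otimes> s i = s (Suc i) \<otimes> s i \<otimes> s (Suc i)"
begin

text \<open>The argument counts the factors, starting from \<open>s N\<close>; \<open>tau\<close>
  re-indexes by the last factor.\<close>

primrec tau_aux :: "nat \<Rightarrow> 'a" where
  "tau_aux 0 = \<one>"
| "tau_aux (Suc m) = tau_aux m \<otimes> s (N - m)"

text \<open>\<open>tau k = s N \<cdots> s k\<close> represents the coset of the braids moving strand \<open>k\<close> to position \<open>N + 1\<close>,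
  and \<open>pure_gen k\<close> lets the last strand wind once around strand \<open>k\<close>.\<close>

definition tau :: "nat \<Rightarrow> 'a" where
  "tau k = tau_aux (Suc N - k)"

definition pure_gen :: "nat \<Rightarrow> 'a" where
  "pure_gen k = tau (Suc k) \<otimes> s k \<otimes> s k \<otimes> inv (tau (Suc k))"

lemma tau_last: "tau (Suc N) = \<one>"
  by (simp add: tau_def)

lemma tau_rec: "k \<le> N \<Longrightarrow> tau k = tau (Suc k) \<otimes> s k"
  by (simp add: tau_def Suc_diff_le)

lemma tau_closed: "1 \<le> k \<Longrightarrow> tau k \<in> carrier G"
proof -
  have "m \<le> N \<Longrightarrow> tau_aux m \<in> carrier G" for m
    by (induction m) (auto intro!: s_closed)
  then show "1 \<le> k \<Longrightarrow> tau k \<in> carrier G" by (simp add: tau_def)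
qed

lemma pure_gen_closed: "k \<in> {1..N} \<Longrightarrow> pure_gen k \<in> carrier G"
  using s_closed tau_closed [of "Suc k"] by (simp add: pure_gen_def)

lemma pure_gen_generate: "k \<in> {1..N} \<Longrightarrow> pure_gen k \<in> generate G (s ` {1..N})"
proof -
  assume k: "k \<in> {1..N}"
  have "m \<le> N \<Longrightarrow> tau_aux m \<in> generate G (s ` {1..N})" for m
  proof (induction m)
    case (Suc m)
    then have "s (N - m) \<in> generate G (s ` {1..N})" by (intro generate.incl) auto
    then show ?case using Suc by (simp add: generate.eng)
  qed (simp add: generate.one)
  then have tau: "tau (Suc k) \<in> generate G (s ` {1..N})" by (simp add: tau_def)
  moreover have "inv (tau (Suc k)) \<in> generate G (s ` {1..N})"
    using s_closed by (intro generate_m_inv_closed tau) auto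
  moreover have "s k \<in> generate G (s ` {1..N})" using k by (intro generate.incl) blast
  ultimately show ?thesis unfolding pure_gen_def by (intro generate.eng)
qed

lemma s_tau_commute:
  "1 \<le> i \<Longrightarrow> Suc i < k \<Longrightarrow> k \<le> Suc N \<Longrightarrow> s i \<otimes> tau k = tau k \<otimes> s i"
proof (induction "Suc N - k" arbitrary: k)
  case 0
  then have "k = Suc N" by simp
  then show ?case using 0 s_closed [of i] by (simp add: tau_last)
next
  case (Suc m)
  then have "k \<le> N" by simp
  moreover have "s i \<otimes> tau (Suc k) = tau (Suc k) \<otimes> s i" using Suc by simp
  ultimately show ?case
    using Suc.prems far_commute [of i k] s_closed tau_closed [of "Suc k"]
    by (simp add: tau_rec commute_mult)
qed

text \<open>In \<open>s N ... s k s (i+1)\<close> the last factor moves left past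
  \<open>s k, ..., s (i-1)\<close>, the braid relation turns \<open>s (i+1) s i s (i+1)\<close> into
  \<open>s i s (i+1) s i\<close>, and the leading \<open>s i\<close> commutes with the rest.\<close>

lemma tau_s_shift:
  "1 \<le> k \<Longrightarrow> k \<le> i \<Longrightarrow> i < N \<Longrightarrow> tau k \<otimes> s (Suc i) = s i \<otimes> tau k"
proof (induction "Suc N - k" arbitrary: k)
  case 0
  then show ?case by simp
next
  case (Suc m)
  have c [simp]: "s k \<in> carrier G" "s (Suc k) \<in> carrier G" "s i \<in> carrier G" "s (Suc i) \<in> carrier G"
    "tau (Suc k) \<in> carrier G" "tau (Suc (Suc k)) \<in> carrier G"
    using Suc.prems by (auto intro!: s_closed tau_closed)
  show ?case
  proof (cases "k = i")
    case True
    let ?t = "tau (Suc (Suc i))"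
    have tk: "tau k = ?t \<otimes> s (Suc i) \<otimes> s i" using Suc.prems True by (simp add: tau_rec)
    have "tau k \<otimes> s (Suc i) = ?t \<otimes> (s (Suc i) \<otimes> s i \<otimes> s (Suc i))"
      unfolding tk using c True by (simp add: m_assoc)
    also have "s (Suc i) \<otimes> s i \<otimes> s (Suc i) = s i \<otimes> s (Suc i) \<otimes> s i"
      using True Suc.prems by (intro braid [symmetric]) auto
    also have "?t \<otimes> (s i \<otimes> s (Suc i) \<otimes> s i) = (?t \<otimes> s i) \<otimes> (s (Suc i) \<otimes> s i)"
      using c True by (simp add: m_assoc)
    also have "?t \<otimes> s i = s i \<otimes> ?t" using Suc.prems True by (intro s_tau_commute [symmetric]) auto
    finally show ?thesis unfolding tk using c True by (simp add: m_assoc)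
  next
    case False
    then have tk: "tau k = tau (Suc k) \<otimes> s k" using Suc.prems by (simp add: tau_rec)
    have "tau k \<otimes> s (Suc i) = tau (Suc k) \<otimes> (s k \<otimes> s (Suc i))" by (simp add: tk m_assoc)
    also have "s k \<otimes> s (Suc i) = s (Suc i) \<otimes> s k"
      using False Suc.prems by (intro far_commute) auto
    also have "tau (Suc k) \<otimes> (s (Suc i) \<otimes> s k) = (tau (Suc k) \<otimes> s (Suc i)) \<otimes> s k"
      by (simp add: m_assoc)
    also have "tau (Suc k) \<otimes> s (Suc i) = s i \<otimes> tau (Suc k)"
      using False Suc by simp
    finally show ?thesis by (simp add: tk m_assoc)
  qed
qed

text \<open>If \<open>i + 1 < k\<close>, then \<open>s i\<close> commutes with every factor. If
  \<open>k < i\<close>, moving it past \<open>tau (Suc k)\<close> changes it into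
  \<open>s (i+1)\<close>, which commutes with \<open>s k\<close>, and moving on past the inverse
  changes it back.\<close>

lemma s_pure_gen_commute:
  assumes "i \<in> {1..<N}" "k \<in> {1..N}" "k \<noteq> i" "k \<noteq> Suc i"
  shows "s i \<otimes> pure_gen k = pure_gen k \<otimes> s i"
proof -
  have c [simp]: "s k \<in> carrier G" "s i \<in> carrier G" "s (Suc i) \<in> carrier G" "tau (Suc k) \<in> carrier G"
    using assms by (auto intro!: s_closed tau_closed)
  show ?thesis
  proof (cases "Suc i < k")
    case True
    then have 1: "s i \<otimes> tau (Suc k) = tau (Suc k) \<otimes> s i" and 2: "s i \<otimes> s k = s k \<otimes> s i"
      using assms by (auto intro: s_tau_commute far_commute)
    show ?thesis
      unfolding pure_gen_def
      by (intro commute_mult commute_inv 1 2) simp_all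
  next
    case False
    let ?t = "tau (Suc k)"
    have 1: "?t \<otimes> s (Suc i) = s i \<otimes> ?t" and 2: "s k \<otimes> s (Suc i) = s (Suc i) \<otimes> s k"
      using assms False by (auto intro: tau_s_shift far_commute)
    have "s i \<otimes> pure_gen k = (s i \<otimes> ?t) \<otimes> (s k \<otimes> s k \<otimes> inv ?t)"
      by (simp add: pure_gen_def m_assoc)
    also have "\<dots> = ?t \<otimes> (s (Suc i) \<otimes> (s k \<otimes> s k)) \<otimes> inv ?t"
      unfolding 1 [symmetric] by (simp add: m_assoc)
    also have "s (Suc i) \<otimes> (s k \<otimes> s k) = (s k \<otimes> s k) \<otimes> s (Suc i)"
      by (intro commute_mult 2 [symmetric]) simp_all
    also have "?t \<otimes> (s k \<otimes> s k \<otimes> s (Suc i)) \<otimes> inv ?t = ?t \<otimes> s k \<otimes> s k \<otimes> inv ?t \<otimes> (?t \<otimes> s (Suc i)) \<otimes> inv ?t"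
      by (simp add: m_assoc)
    also have "\<dots> = pure_gen k \<otimes> s i"
      unfolding 1 by (simp add: pure_gen_def m_assoc)
    finally show ?thesis .
  qed
qed

lemma s_pure_gen:
  assumes "1 \<le> k" "k < N"
  shows "s k \<otimes> pure_gen k = pure_gen (Suc k) \<otimes> s k"
    and "pure_gen (Suc k) \<otimes> s k \<otimes> pure_gen (Suc k) = pure_gen k \<otimes> pure_gen (Suc k) \<otimes> s k"
proof -
  have t: "tau (Suc k) = tau (Suc (Suc k)) \<otimes> s (Suc k)" using assms by (simp add: tau_rec)
  have c: "s k \<in> carrier G" "s (Suc k) \<in> carrier G" "tau (Suc (Suc k)) \<in> carrier G"
    using assms by (auto intro!: s_closed tau_closed)
  have 1: "s k \<otimes> tau (Suc (Suc k)) = tau (Suc (Suc k)) \<otimes> s k"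
    using assms by (intro s_tau_commute) auto
  show "s k \<otimes> pure_gen k = pure_gen (Suc k) \<otimes> s k"
    "pure_gen (Suc k) \<otimes> s k \<otimes> pure_gen (Suc k) = pure_gen k \<otimes> pure_gen (Suc k) \<otimes> s k"
    unfolding pure_gen_def t
    using braid_conj_commuting [OF c 1 braid [OF assms]] by simp_all
qed

lemma pure_gen_rec:
  assumes "1 \<le> k" "k < N"
  shows "pure_gen k = inv (s k) \<otimes> pure_gen (Suc k) \<otimes> s k"
proof -
  have c [simp]: "s k \<in> carrier G" "pure_gen k \<in> carrier G" "pure_gen (Suc k) \<in> carrier G"
    using assms by (auto intro!: s_closed pure_gen_closed)
  have "inv (s k) \<otimes> (s k \<otimes> pure_gen k) = inv (s k) \<otimes> (pure_gen (Suc k) \<otimes> s k)"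
    unfolding s_pure_gen(1) [OF assms] ..
  then show ?thesis by (simp add: m_assoc)
qed

lemma pure_gen_last: "1 \<le> N \<Longrightarrow> pure_gen N = s N \<otimes> s N"
  using s_closed by (simp add: pure_gen_def tau_last)

text \<open>With \<open>A_k\<close> for \<open>pure_gen k\<close>: \<open>s i\<close> conjugates
  \<open>A_i\<close> to \<open>A_(i+1)\<close> and \<open>A_(i+1)\<close> to
  \<open>A_(i+1)^-1 A_i A_(i+1)\<close>, its inverse conjugates them to
  \<open>A_i A_(i+1) A_i^-1\<close> and \<open>A_i\<close>, and all other \<open>A_k\<close> are
  fixed.\<close>

lemma pure_gen_conj:
  assumes i: "i \<in> {1..<N}" and k: "k \<in> {1..N}"
  shows "s i \<otimes> pure_gen k \<otimes> inv (s i) \<in> generate G (pure_gen ` {1..N})"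
    and "inv (s i) \<otimes> pure_gen k \<otimes> s i \<in> generate G (pure_gen ` {1..N})"
proof -
  let ?K = "generate G (pure_gen ` {1..N})"
  have sub: "pure_gen ` {1..N} \<subseteq> carrier G" using pure_gen_closed by auto
  have gen: "pure_gen l \<in> ?K" if "l \<in> {1..N}" for l using that by (intro generate.incl) auto
  have c [simp]: "s i \<in> carrier G" "pure_gen k \<in> carrier G" "pure_gen i \<in> carrier G"
      "pure_gen (Suc i) \<in> carrier G"
    using i k by (auto intro!: s_closed pure_gen_closed)
  have i': "1 \<le> i" "i < N" using i by auto
  let ?a = "pure_gen i" and ?b = "pure_gen (Suc i)"
  consider "k = i" | "k = Suc i" | "k \<noteq> i" "k \<noteq> Suc i" by blast
  then have "s i \<otimes> pure_gen k \<otimes> inv (s i) \<in> ?K \<and> inv (s i) \<otimes> pure_gen k \<otimes> s i \<in> ?K"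
  proof cases
    case 1
    have "s i \<otimes> ?a \<otimes> inv (s i) = ?b"
      unfolding s_pure_gen(1) [OF i'] by (simp add: m_assoc)
    moreover have "inv (s i) \<otimes> ?a \<otimes> s i = ?a \<otimes> ?b \<otimes> inv ?a"
    proof -
      have a: "?a = ?b \<otimes> s i \<otimes> ?b \<otimes> inv (s i) \<otimes> inv ?b"
        unfolding s_pure_gen(2) [OF i'] by (simp add: m_assoc)
      have ba: "inv (s i) \<otimes> ?b \<otimes> s i = ?a" using pure_gen_rec [OF i'] by simp
      have "inv (s i) \<otimes> (?b \<otimes> s i \<otimes> ?b \<otimes> inv (s i) \<otimes> inv ?b) \<otimes> s i
          = (inv (s i) \<otimes> ?b \<otimes> s i) \<otimes> ?b \<otimes> inv (inv (s i) \<otimes> ?b \<otimes> s i)"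
        by (simp add: m_assoc inv_mult_group)
      then show ?thesis unfolding ba a [symmetric] .
    qed
    moreover have "?a \<otimes> ?b \<otimes> inv ?a \<in> ?K"
      using gen i' generate_m_inv_closed [OF sub] by (intro generate.eng) auto
    ultimately show ?thesis using 1 gen i' by simp
  next
    case 2
    have "inv (s i) \<otimes> ?b \<otimes> s i = ?a" using pure_gen_rec [OF i'] by simp
    moreover have "s i \<otimes> ?b \<otimes> inv (s i) = inv ?b \<otimes> ?a \<otimes> ?b"
    proof -
      have "s i \<otimes> ?b \<otimes> inv (s i) = inv ?b \<otimes> (?b \<otimes> s i \<otimes> ?b) \<otimes> inv (s i)"
        by (simp add: m_assoc)
      then show ?thesis unfolding s_pure_gen(2) [OF i'] by (simp add: m_assoc)
    qed
    moreover have "inv ?b \<otimes> ?a \<otimes> ?b \<in> ?K"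
      using gen i' generate_m_inv_closed [OF sub] by (intro generate.eng) auto
    ultimately show ?thesis using 2 gen i' by simp
  next
    case 3
    then have comm: "s i \<otimes> pure_gen k = pure_gen k \<otimes> s i" using s_pure_gen_commute i k by blast
    have "s i \<otimes> pure_gen k \<otimes> inv (s i) = pure_gen k"
      unfolding comm by (simp add: m_assoc)
    moreover have "inv (s i) \<otimes> pure_gen k \<otimes> s i = pure_gen k"
      using comm by (simp add: m_assoc comm [symmetric])
    ultimately show ?thesis using gen k by simp
  qed
  then show "s i \<otimes> pure_gen k \<otimes> inv (s i) \<in> ?K" "inv (s i) \<otimes> pure_gen k \<otimes> s i \<in> ?K" by auto
qed

text \<open>The Schreier table for the cosets represented by \<open>tau k\<close>. A factor
  \<open>pure_gen\<close> arises only for \<open>k = i\<close>, where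
  \<open>tau i s_i = tau (i+1) s_i s_i\<close>; the other entries are 1, \<open>s i\<close> or
  \<open>s (i-1)\<close>.\<close>

lemma tau_s_coset:
  assumes i: "i \<in> {1..N}" and k: "k \<in> {1..Suc N}"
  shows "\<exists>r\<in>generate G (pure_gen ` {1..N} \<union> s ` {1..<N}). tau k \<otimes> s i = r \<otimes> tau (transpose i (Suc i) k)"
proof -
  let ?S = "generate G (pure_gen ` {1..N} \<union> s ` {1..<N})"
  have s_in: "s l \<in> ?S" if "l \<in> {1..<N}" for l using that by (intro generate.incl) auto
  have a_in: "pure_gen l \<in> ?S" if "l \<in> {1..N}" for l using that by (intro generate.incl) auto
  consider "Suc i < k" | "k = Suc i" | "k = i" | "k < i" by linarith
  then show ?thesis
  proof cases
    case 1
    then have "tau k \<otimes> s i = s i \<otimes> tau k" using i k s_tau_commute [of i k] by simp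
    then show ?thesis using 1 s_in [of i] i k by (auto simp: transpose_def)
  next
    case 2
    then have "tau k \<otimes> s i = \<one> \<otimes> tau i" using i tau_closed [of i] by (simp add: tau_rec)
    then show ?thesis using 2 generate.one by (auto simp: transpose_def)
  next
    case 3
    have c: "s i \<in> carrier G" "tau (Suc i) \<in> carrier G" using i by (auto intro!: s_closed tau_closed)
    have "tau k \<otimes> s i = pure_gen i \<otimes> tau (Suc i)"
      using 3 i c by (simp add: tau_rec pure_gen_def m_assoc)
    then show ?thesis using 3 a_in i by (auto simp: transpose_def)
  next
    case 4
    then obtain l where l: "i = Suc l" "k \<le> l" by (cases i) auto
    then have "tau k \<otimes> s i = s l \<otimes> tau k" using tau_s_shift [of k l] i k by simp
    then show ?thesis using 4 l s_in [of l] i k by (auto simp: transpose_def)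
  qed
qed

lemma braid_cosets:
  assumes g: "g \<in> generate G (s ` {1..N})"
  shows "\<exists>r\<in>generate G (pure_gen ` {1..N} \<union> s ` {1..<N}). \<exists>k\<in>{1..Suc N}. g = r \<otimes> tau k"
proof -
  let ?S = "generate G (pure_gen ` {1..N} \<union> s ` {1..<N})"
  have sub: "pure_gen ` {1..N} \<union> s ` {1..<N} \<subseteq> carrier G"
    using pure_gen_closed s_closed by auto
  note Sc = generate_in_carrier [OF sub]
  have sc: "s ` {1..N} \<subseteq> carrier G" using s_closed by auto
  have step: "\<exists>r'\<in>?S. \<exists>k'\<in>{1..Suc N}. r \<otimes> tau k \<otimes> g = r' \<otimes> tau k'"
    if "r \<in> ?S" "k \<in> {1..Suc N}" for r k
    using g that
  proof (induction g arbitrary: r k rule: generate.induct)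
    case one
    then have "r \<otimes> tau k \<otimes> \<one> = r \<otimes> tau k" using Sc tau_closed by simp
    then show ?case using one by blast
  next
    case (incl x)
    then obtain i where i: "i \<in> {1..N}" "x = s i" by auto
    let ?k = "transpose i (Suc i) k"
    have k': "?k \<in> {1..Suc N}" using i incl.prems by (auto simp: transpose_def)
    obtain q where q: "q \<in> ?S" "tau k \<otimes> s i = q \<otimes> tau ?k" using tau_s_coset i incl.prems by blast
    have "r \<otimes> tau k \<otimes> x = (r \<otimes> q) \<otimes> tau ?k"
      using q i incl.prems Sc s_closed [OF i(1)] tau_closed [of k] tau_closed [of ?k] k'
      by (simp add: m_assoc)
    moreover have "r \<otimes> q \<in> ?S" using incl.prems q by (blast intro: generate.eng)
    ultimately show ?case using k' by blast
  next
    case (inv x)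
    then obtain i where i: "i \<in> {1..N}" "x = s i" by auto
    let ?k = "transpose i (Suc i) k"
    have k': "?k \<in> {1..Suc N}" using i inv.prems by (auto simp: transpose_def)
    \<comment> \<open>A transposition is an involution, so the table entry at the swapped strand,
      solved for the inverse generator, covers inverse letters.\<close>
    obtain q where q: "q \<in> ?S" "tau ?k \<otimes> s i = q \<otimes> tau k"
      using tau_s_coset [OF i(1) k'] by auto
    have c [simp]: "r \<in> carrier G" "q \<in> carrier G" "s i \<in> carrier G" "tau k \<in> carrier G" "tau ?k \<in> carrier G"
      using inv.prems q(1) Sc s_closed [OF i(1)] k' tau_closed [of k] tau_closed [of ?k] by auto
    have "tau k \<otimes> inv (s i) = inv q \<otimes> (q \<otimes> tau k) \<otimes> inv (s i)" by (simp add: m_assoc)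
    also have "\<dots> = inv q \<otimes> tau ?k" unfolding q(2) [symmetric] by (simp add: m_assoc)
    finally have "r \<otimes> tau k \<otimes> inv x = (r \<otimes> inv q) \<otimes> tau ?k"
      by (simp add: i m_assoc)
    moreover have "r \<otimes> inv q \<in> ?S"
      using inv.prems q generate_m_inv_closed [OF sub] by (blast intro: generate.eng)
    ultimately show ?case using k' by blast
  next
    case (eng x y)
    obtain r1 k1 where 1: "r1 \<in> ?S" "k1 \<in> {1..Suc N}" "r \<otimes> tau k \<otimes> x = r1 \<otimes> tau k1"
      using eng by blast
    obtain r2 k2 where 2: "r2 \<in> ?S" "k2 \<in> {1..Suc N}" "r1 \<otimes> tau k1 \<otimes> y = r2 \<otimes> tau k2"
      using eng 1 by blast
    have "x \<in> carrier G" "y \<in> carrier G" using eng.hyps generate_in_carrier [OF sc] by auto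
    then have "r \<otimes> tau k \<otimes> (x \<otimes> y) = r2 \<otimes> tau k2"
      using 1 2 eng.prems Sc tau_closed [of k] by (simp add: m_assoc [symmetric])
    then show ?case using 2 by blast
  qed
  have "\<exists>r\<in>?S. \<exists>k\<in>{1..Suc N}. \<one> \<otimes> tau (Suc N) \<otimes> g = r \<otimes> tau k"
    using step [of \<one> "Suc N"] generate.one by auto
  then show ?thesis using generate_in_carrier [OF sc g] by (simp add: tau_last)
qed

lemma braid_combing:
  assumes "g \<in> generate G (s ` {1..N})"
  shows "\<exists>c\<in>generate G (pure_gen ` {1..N}). \<exists>b\<in>generate G (s ` {1..<N}). \<exists>k\<in>{1..Suc N}.
    g = c \<otimes> b \<otimes> tau k"
proof -
  obtain r k where r: "r \<in> generate G (pure_gen ` {1..N} \<union> s ` {1..<N})" and k: "k \<in> {1..Suc N}"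
    and g: "g = r \<otimes> tau k" using braid_cosets assms by blast
  have "\<exists>c\<in>generate G (pure_gen ` {1..N}). \<exists>b\<in>generate G (s ` {1..<N}). r = c \<otimes> b"
    using pure_gen_closed s_closed pure_gen_conj
    by (intro generate_normalized_product [OF _ _ _ _ r]) auto
  then show ?thesis using k g by blast
qed

end

section \<open>The Artin action\<close>

lemma group_hom_compose:
  "group_hom G H f \<Longrightarrow> group_hom H K g \<Longrightarrow> group_hom G K (\<lambda>x. g (f x))"
  by (auto simp: group_hom_def group_hom_axioms_def hom_def)

abbreviation BraidSpace :: "nat \<Rightarrow> ((word \<Rightarrow> word) \<times> (nat \<Rightarrow> nat)) monoid" where
  "BraidSpace n \<equiv> AutF n \<times>\<times> sym_group n"

interpretation A: group "AutF n" for n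
  by (rule F.AutoGroup)

interpretation Sym: group "sym_group n" for n
  by (rule sym_group_is_group)

interpretation BS: group "BraidSpace n" for n
  by (intro DirProd_group F.AutoGroup sym_group_is_group)

lemma AutF_eqI:
  assumes "\<alpha> \<in> auto (FreeGrp n)" "\<beta> \<in> auto (FreeGrp n)"
    and "\<And>t. t \<in> {1..n} \<Longrightarrow> \<alpha> (gen t) = \<beta> (gen t)"
  shows "\<alpha> = \<beta>"
proof (rule F.auto_eqI [OF assms(1,2)])
  fix w assume "w \<in> carrier (FreeGrp n)"
  then show "\<alpha> w = \<beta> w"
    using FreeGrp_hom_eqI [OF F.auto_group_hom [OF assms(1)] F.auto_group_hom [OF assms(2)]] assms(3)
    by blast
qed

definition artin_image :: "nat \<Rightarrow> nat \<Rightarrow> word" where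
  "artin_image i t = (if t = i then [(i, True), (Suc i, True), (i, False)]
     else if t = Suc i then [(i, True)] else [(t, True)])"

text \<open>The generator images under the inverse of \<open>\<sigma>_i\<close>; that both
  substitutions cancel on generators proves \<open>artin_gen\<close> bijective.\<close>

definition artin_inv_image :: "nat \<Rightarrow> nat \<Rightarrow> word" where
  "artin_inv_image i t = (if t = i then [(Suc i, True)]
     else if t = Suc i then [(Suc i, False), (i, True), (Suc i, True)] else [(t, True)])"

lemma artin_gen_apply: "w \<in> carrier (FreeGrp n) \<Longrightarrow> artin_gen n i w = subst_hom (artin_image i) w"
  by (simp add: artin_gen_def artin_image_def [abs_def])

lemma artin_image_closed:
  assumes "1 \<le> i" "i < n" "t \<in> {1..n}"
  shows "artin_image i t \<in> carrier (FreeGrp n)" "artin_inv_image i t \<in> carrier (FreeGrp n)"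
  using assms by (auto simp: artin_image_def artin_inv_image_def carrier_FreeGrp inverse_letters_def)

lemmas word_eval = subst_hom_Cons word_inv_def inverse_letters_def

lemma artin_gen_auto:
  assumes i: "1 \<le> i" "i < n"
  shows "artin_gen n i \<in> auto (FreeGrp n)"
proof -
  have h: "group_hom (FreeGrp n) (FreeGrp n) (subst_hom (artin_image i))"
    and h': "group_hom (FreeGrp n) (FreeGrp n) (subst_hom (artin_inv_image i))"
    using artin_image_closed i by (auto intro!: group_hom_subst_hom)
  interpret h: group_hom "FreeGrp n" "FreeGrp n" "subst_hom (artin_image i)" by (rule h)
  interpret h': group_hom "FreeGrp n" "FreeGrp n" "subst_hom (artin_inv_image i)" by (rule h')
  have id: "group_hom (FreeGrp n) (FreeGrp n) (\<lambda>w. w)"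
    by (simp add: group_hom_def group_hom_axioms_def hom_def group_FreeGrp)
  have 1: "subst_hom (artin_image i) (subst_hom (artin_inv_image i) w) = w"
    if "w \<in> carrier (FreeGrp n)" for w
    by (rule FreeGrp_hom_eqI [OF group_hom_compose [OF h' h] id _ that])
      (auto simp: artin_image_def artin_inv_image_def word_eval)
  have 2: "subst_hom (artin_inv_image i) (subst_hom (artin_image i) w) = w"
    if "w \<in> carrier (FreeGrp n)" for w
    by (rule FreeGrp_hom_eqI [OF group_hom_compose [OF h h'] id _ that])
      (auto simp: artin_image_def artin_inv_image_def word_eval)
  have "bij_betw (subst_hom (artin_image i)) (carrier (FreeGrp n)) (carrier (FreeGrp n))"
    by (rule bij_betw_byWitness [where f' = "subst_hom (artin_inv_image i)"]) (use 1 2 in auto)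
  then have "bij_betw (artin_gen n i) (carrier (FreeGrp n)) (carrier (FreeGrp n))"
    by (rule bij_betw_cong [THEN iffD1, rotated]) (simp add: artin_gen_apply)
  moreover have "artin_gen n i \<in> hom (FreeGrp n) (FreeGrp n)"
  proof (rule homI)
    fix v w assume v: "v \<in> carrier (FreeGrp n)" and w: "w \<in> carrier (FreeGrp n)"
    show "artin_gen n i (v \<otimes>\<^bsub>FreeGrp n\<^esub> w) = artin_gen n i v \<otimes>\<^bsub>FreeGrp n\<^esub> artin_gen n i w"
      using h.hom_mult [OF v w] F.m_closed [OF v w] v w by (simp add: artin_gen_apply)
  qed (simp add: artin_gen_apply)
  moreover have "artin_gen n i \<in> extensional (carrier (FreeGrp n))"
    by (simp add: artin_gen_def)
  ultimately show ?thesis by (simp add: auto_def Bij_def)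
qed

lemma artin_gen_gen:
  "1 \<le> i \<Longrightarrow> i < n \<Longrightarrow> t \<in> {1..n} \<Longrightarrow> artin_gen n i (gen t) = artin_image i t"
  using gen_closed [of t n] artin_image_closed(1) [of i n t]
  by (simp add: artin_gen_apply subst_hom_gen carrier_FreeGrp)

lemma artin_gen_image:
  "1 \<le> i \<Longrightarrow> i < n \<Longrightarrow> 1 \<le> k \<Longrightarrow> k < n \<Longrightarrow> t \<in> {1..n} \<Longrightarrow>
    artin_gen n k (artin_gen n i (gen t)) = subst_hom (artin_image k) (artin_image i t)"
  using artin_image_closed(1) [of i n t] by (simp add: artin_gen_gen artin_gen_apply)

lemma artin_far_commute:
  assumes "1 \<le> i" "Suc i < k" "k < n"
  shows "artin_gen n i \<otimes>\<^bsub>AutF n\<^esub> artin_gen n k = artin_gen n k \<otimes>\<^bsub>AutF n\<^esub> artin_gen n i"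
proof (rule AutF_eqI)
  have a: "artin_gen n i \<in> auto (FreeGrp n)" "artin_gen n k \<in> auto (FreeGrp n)"
    using assms by (auto intro: artin_gen_auto)
  then show "artin_gen n i \<otimes>\<^bsub>AutF n\<^esub> artin_gen n k \<in> auto (FreeGrp n)"
    "artin_gen n k \<otimes>\<^bsub>AutF n\<^esub> artin_gen n i \<in> auto (FreeGrp n)"
    using A.m_closed [of _ n] by simp_all
  fix t assume t: "t \<in> {1..n}"
  have "subst_hom (artin_image i) (artin_image k t) = subst_hom (artin_image k) (artin_image i t)"
    using assms by (auto simp: artin_image_def word_eval)
  then show "(artin_gen n i \<otimes>\<^bsub>AutF n\<^esub> artin_gen n k) (gen t) = (artin_gen n k \<otimes>\<^bsub>AutF n\<^esub> artin_gen n i) (gen t)"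
    using assms a t gen_closed [OF t] by (simp add: F.auto_mult_apply artin_gen_image)
qed

lemma artin_braid:
  assumes "1 \<le> i" "Suc i < n"
  shows "artin_gen n i \<otimes>\<^bsub>AutF n\<^esub> artin_gen n (Suc i) \<otimes>\<^bsub>AutF n\<^esub> artin_gen n i
    = artin_gen n (Suc i) \<otimes>\<^bsub>AutF n\<^esub> artin_gen n i \<otimes>\<^bsub>AutF n\<^esub> artin_gen n (Suc i)"
proof (rule AutF_eqI)
  let ?i = "artin_gen n i" and ?k = "artin_gen n (Suc i)"
  have a: "?i \<in> auto (FreeGrp n)" "?k \<in> auto (FreeGrp n)"
    using assms by (auto intro: artin_gen_auto)
  have ab: "?i \<otimes>\<^bsub>AutF n\<^esub> ?k \<in> auto (FreeGrp n)" "?k \<otimes>\<^bsub>AutF n\<^esub> ?i \<in> auto (FreeGrp n)"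
    using a A.m_closed [of _ n] by simp_all
  then show "?i \<otimes>\<^bsub>AutF n\<^esub> ?k \<otimes>\<^bsub>AutF n\<^esub> ?i \<in> auto (FreeGrp n)"
    "?k \<otimes>\<^bsub>AutF n\<^esub> ?i \<otimes>\<^bsub>AutF n\<^esub> ?k \<in> auto (FreeGrp n)"
    using a A.m_closed [of _ n] by simp_all
  fix t assume t: "t \<in> {1..n}"
  have c: "artin_gen n k (artin_gen n l (gen t)) \<in> carrier (FreeGrp n)"
    if "k = i \<or> k = Suc i" "l = i \<or> l = Suc i" for k l
    using that a gen_closed [OF t] by auto
  have "subst_hom (artin_image i) (subst_hom (artin_image (Suc i)) (artin_image i t))
      = subst_hom (artin_image (Suc i)) (subst_hom (artin_image i) (artin_image (Suc i) t))"
    using assms by (auto simp: artin_image_def word_eval)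
  then have "?i (?k (?i (gen t))) = ?k (?i (?k (gen t)))"
    using artin_gen_apply [OF c, of "Suc i" i i] artin_gen_apply [OF c, of i "Suc i" "Suc i"] assms t
    by (simp add: artin_gen_image)
  then show "(?i \<otimes>\<^bsub>AutF n\<^esub> ?k \<otimes>\<^bsub>AutF n\<^esub> ?i) (gen t) = (?k \<otimes>\<^bsub>AutF n\<^esub> ?i \<otimes>\<^bsub>AutF n\<^esub> ?k) (gen t)"
    using a ab gen_closed [OF t] by (simp add: F.auto_mult_apply)
qed

section \<open>Braids as pairs of an automorphism and a permutation\<close>

definition braid_gen :: "nat \<Rightarrow> nat \<Rightarrow> (word \<Rightarrow> word) \<times> (nat \<Rightarrow> nat)" where
  "braid_gen n i = (artin_gen n i, transpose i (Suc i))"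

lemma braid_graph_eq: "braid_graph n = generate (BraidSpace n) (braid_gen n ` {1..<n})"
proof -
  have "{(artin_gen n i, transpose i (Suc i)) | i. 1 \<le> i \<and> i < n} = braid_gen n ` {1..<n}"
    by (auto simp: braid_gen_def)
  then show ?thesis by (simp add: braid_graph_def)
qed

lemma braid_gen_closed: "i \<in> {1..<n} \<Longrightarrow> braid_gen n i \<in> carrier (BraidSpace n)"
  using artin_gen_auto by (auto simp: braid_gen_def DirProd_def sym_group_def intro!: permutes_swap_id)

lemma braid_gen_far_commute:
  assumes "1 \<le> i" "Suc i < k" "k < n"
  shows "braid_gen n i \<otimes>\<^bsub>BraidSpace n\<^esub> braid_gen n k = braid_gen n k \<otimes>\<^bsub>BraidSpace n\<^esub> braid_gen n i"
proof -
  have "transpose i (Suc i) \<circ> transpose k (Suc k) = transpose k (Suc k) \<circ> transpose i (Suc i)"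
    using assms by (auto simp: fun_eq_iff transpose_def)
  then show ?thesis
    using artin_far_commute [OF assms] by (simp add: braid_gen_def sym_group_mult)
qed

lemma braid_gen_braid:
  assumes "1 \<le> i" "Suc i < n"
  shows "braid_gen n i \<otimes>\<^bsub>BraidSpace n\<^esub> braid_gen n (Suc i) \<otimes>\<^bsub>BraidSpace n\<^esub> braid_gen n i
    = braid_gen n (Suc i) \<otimes>\<^bsub>BraidSpace n\<^esub> braid_gen n i \<otimes>\<^bsub>BraidSpace n\<^esub> braid_gen n (Suc i)"
proof -
  have "transpose i (Suc i) \<circ> transpose (Suc i) (Suc (Suc i)) \<circ> transpose i (Suc i)
      = transpose (Suc i) (Suc (Suc i)) \<circ> transpose i (Suc i) \<circ> transpose (Suc i) (Suc (Suc i))"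
    by (auto simp: fun_eq_iff transpose_def)
  then show ?thesis
    using artin_braid [OF assms] by (simp add: braid_gen_def sym_group_mult)
qed

text \<open>With the inverses of the Artin generators as standard generators, the pure braid
  \<open>pure_braid n k\<close> below acts on the last free generator as conjugation by \<open>x\<^sub>k\<close> itself.\<close>

abbreviation inv_gen_braid :: "nat \<Rightarrow> nat \<Rightarrow> (word \<Rightarrow> word) \<times> (nat \<Rightarrow> nat)" where
  "inv_gen_braid n \<equiv> (\<lambda>i. inv\<^bsub>BraidSpace (Suc n)\<^esub> braid_gen (Suc n) i)"

text \<open>Both sides of the braid relation are palindromes, so inverting it gives the same
  relation between the inverse generators; commutation is likewise preserved.\<close>

interpretation Br: braid_relations "BraidSpace (Suc n)" "inv_gen_braid n" n for n
proof
  let ?G = "BraidSpace (Suc n)" and ?b = "braid_gen (Suc n)"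
  show "inv\<^bsub>?G\<^esub> ?b i \<in> carrier ?G" if "i \<in> {1..n}" for i
    using that by (intro BS.inv_closed braid_gen_closed) auto
  show "inv\<^bsub>?G\<^esub> ?b i \<otimes>\<^bsub>?G\<^esub> inv\<^bsub>?G\<^esub> ?b k = inv\<^bsub>?G\<^esub> ?b k \<otimes>\<^bsub>?G\<^esub> inv\<^bsub>?G\<^esub> ?b i"
    if ik: "1 \<le> i" "Suc i < k" "k \<le> n" for i k
  proof -
    have c: "?b i \<in> carrier ?G" "?b k \<in> carrier ?G" using ik braid_gen_closed by auto
    have "inv\<^bsub>?G\<^esub> (?b k \<otimes>\<^bsub>?G\<^esub> ?b i) = inv\<^bsub>?G\<^esub> (?b i \<otimes>\<^bsub>?G\<^esub> ?b k)"
      using braid_gen_far_commute [of i k "Suc n"] ik by simp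
    then show ?thesis using BS.inv_mult_group [OF c] BS.inv_mult_group [OF c(2,1)] by simp
  qed
  show "inv\<^bsub>?G\<^esub> ?b i \<otimes>\<^bsub>?G\<^esub> inv\<^bsub>?G\<^esub> ?b (Suc i) \<otimes>\<^bsub>?G\<^esub> inv\<^bsub>?G\<^esub> ?b i
      = inv\<^bsub>?G\<^esub> ?b (Suc i) \<otimes>\<^bsub>?G\<^esub> inv\<^bsub>?G\<^esub> ?b i \<otimes>\<^bsub>?G\<^esub> inv\<^bsub>?G\<^esub> ?b (Suc i)"
    if i: "1 \<le> i" "i < n" for i
  proof -
    have c: "?b i \<in> carrier ?G" "?b (Suc i) \<in> carrier ?G" using i braid_gen_closed by auto
    have inv3: "inv\<^bsub>?G\<^esub> (x \<otimes>\<^bsub>?G\<^esub> y \<otimes>\<^bsub>?G\<^esub> x) = inv\<^bsub>?G\<^esub> x \<otimes>\<^bsub>?G\<^esub> inv\<^bsub>?G\<^esub> y \<otimes>\<^bsub>?G\<^esub> inv\<^bsub>?G\<^esub> x"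
      if "x \<in> carrier ?G" "y \<in> carrier ?G" for x y
      using that BS.inv_mult_group BS.m_assoc BS.m_closed BS.inv_closed by metis
    show ?thesis
      using braid_gen_braid [of i "Suc n"] i inv3 [OF c] inv3 [OF c(2,1)] by simp
  qed
qed

definition pure_braid :: "nat \<Rightarrow> nat \<Rightarrow> (word \<Rightarrow> word) \<times> (nat \<Rightarrow> nat)" where
  "pure_braid n k = inv\<^bsub>BraidSpace (Suc n)\<^esub> Br.pure_gen n k"

lemma BraidSpace_inv:
  "x \<in> carrier (BraidSpace n) \<Longrightarrow>
    inv\<^bsub>BraidSpace n\<^esub> x = (inv\<^bsub>AutF n\<^esub> fst x, inv\<^bsub>sym_group n\<^esub> snd x)"
  by (cases x) (simp add: A.is_group Sym.is_group)

lemma inv_transpose_sym_group: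
  assumes "i \<in> {1..<n}"
  shows "inv\<^bsub>sym_group n\<^esub> transpose i (Suc i) = transpose i (Suc i)"
  using assms by (intro Sym.inv_equality)
    (auto simp: sym_group_def intro!: permutes_swap_id)

lemma generate_inv_gen_braid:
  assumes "m \<le> Suc n"
  shows "generate (BraidSpace (Suc n)) (inv_gen_braid n ` {1..<m})
    = generate (BraidSpace (Suc n)) (braid_gen (Suc n) ` {1..<m})"
proof -
  have "braid_gen (Suc n) ` {1..<m} \<subseteq> carrier (BraidSpace (Suc n))"
    using assms braid_gen_closed [of _ "Suc n"] by force
  from BS.generate_inv_image [OF this] show ?thesis by (simp only: image_image)
qed

lemma snd_tau:
  assumes "1 \<le> k" "k \<le> Suc n"
  shows "snd (Br.tau n k) k = Suc n"
  using assms
proof (induction "Suc n - k" arbitrary: k)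
  case 0
  then have "k = Suc n" by simp
  then show ?case by (simp add: Br.tau_last sym_group_one)
next
  case (Suc m)
  then have k: "k \<in> {1..<Suc n}" by auto
  have "snd (inv_gen_braid n k) = transpose k (Suc k)"
    unfolding BraidSpace_inv [OF braid_gen_closed [OF k]]
    using inv_transpose_sym_group [OF k] by (simp add: braid_gen_def)
  then have "snd (Br.tau n k) = snd (Br.tau n (Suc k)) \<circ> transpose k (Suc k)"
    using k by (simp add: Br.tau_rec mult_DirProd' sym_group_mult)
  then show ?case using Suc by simp
qed

section \<open>Killing the last free generator\<close>

definition forget :: "nat \<Rightarrow> word \<Rightarrow> word" where
  "forget n = subst_hom (\<lambda>i. if i \<le> n then gen i else [])"

lemma group_hom_forget: "group_hom (FreeGrp m) (FreeGrp n) (forget n)"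
  unfolding forget_def by (intro group_hom_subst_hom) (auto simp: carrier_FreeGrp)

lemma forget_gen: "forget n (gen i) = (if i \<le> n then gen i else [])"
  by (simp add: forget_def subst_hom_gen)

lemma forget_id: "w \<in> carrier (FreeGrp n) \<Longrightarrow> forget n w = w"
proof -
  assume w: "w \<in> carrier (FreeGrp n)"
  have id: "group_hom (FreeGrp n) (FreeGrp n) (\<lambda>w. w)"
    by (simp add: group_hom_def group_hom_axioms_def hom_def group_FreeGrp)
  show ?thesis by (rule FreeGrp_hom_eqI [OF group_hom_forget id _ w]) (simp add: forget_gen)
qed

text \<open>Words over fewer letters are words over more: \<open>F_n\<close> is literally contained
  in \<open>F_(n+1)\<close>, so that \<open>forget\<close> is a retraction and passing to
  \<open>F_n\<close> a restriction of functions.\<close>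

lemma FreeGrp_mono: "carrier (FreeGrp n) \<subseteq> carrier (FreeGrp (Suc n))"
  by (force simp: carrier_FreeGrp)

lemma forget_artin:
  assumes k: "1 \<le> k" "k < n" and w: "w \<in> carrier (FreeGrp (Suc n))"
  shows "forget n (artin_gen (Suc n) k w) = artin_gen n k (forget n w)"
proof (rule FreeGrp_hom_eqI [OF _ _ _ w])
  show "group_hom (FreeGrp (Suc n)) (FreeGrp n) (\<lambda>w. forget n (artin_gen (Suc n) k w))"
    using k by (intro group_hom_compose [OF F.auto_group_hom group_hom_forget] artin_gen_auto) auto
  show "group_hom (FreeGrp (Suc n)) (FreeGrp n) (\<lambda>w. artin_gen n k (forget n w))"
    using k by (intro group_hom_compose [OF group_hom_forget] F.auto_group_hom artin_gen_auto) auto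
  fix t assume t: "t \<in> {1..Suc n}"
  show "forget n (artin_gen (Suc n) k (gen t)) = artin_gen n k (forget n (gen t))"
  proof (cases "t \<le> n")
    case True
    then show ?thesis
      using k t artin_image_closed(1) [of k n t] by (simp add: artin_gen_gen forget_gen forget_id)
  next
    case False
    then have "artin_gen (Suc n) k (gen t) = gen t"
      using k t by (simp add: artin_gen_gen artin_image_def)
    moreover have "artin_gen n k [] = []"
      by (simp add: artin_gen_apply carrier_FreeGrp subst_hom_Cons)
    ultimately show ?thesis using False by (simp add: forget_gen)
  qed
qed

section \<open>The pure braids winding the last strand around another one\<close>

lemma pure_gen_carrier: "k \<in> {1..n} \<Longrightarrow> Br.pure_gen n k \<in> carrier (BraidSpace (Suc n))"
  by (rule Br.pure_gen_closed)

lemma pure_braid_last: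
  assumes "1 \<le> n"
  shows "pure_braid n n = braid_gen (Suc n) n \<otimes>\<^bsub>BraidSpace (Suc n)\<^esub> braid_gen (Suc n) n"
proof -
  have c: "braid_gen (Suc n) n \<in> carrier (BraidSpace (Suc n))"
    using assms by (intro braid_gen_closed) auto
  show ?thesis
    unfolding pure_braid_def Br.pure_gen_last [OF assms]
    by (simp only: BS.inv_mult_group BS.inv_closed BS.inv_inv c)
qed

lemma pure_braid_rec:
  assumes "1 \<le> k" "k < n"
  shows "pure_braid n k = braid_gen (Suc n) k \<otimes>\<^bsub>BraidSpace (Suc n)\<^esub> pure_braid n (Suc k)
    \<otimes>\<^bsub>BraidSpace (Suc n)\<^esub> inv\<^bsub>BraidSpace (Suc n)\<^esub> braid_gen (Suc n) k"
proof -
  have c: "braid_gen (Suc n) k \<in> carrier (BraidSpace (Suc n))"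
    using assms by (intro braid_gen_closed) auto
  have p: "Br.pure_gen n (Suc k) \<in> carrier (BraidSpace (Suc n))"
    using assms by (intro pure_gen_carrier) auto
  show ?thesis
    unfolding pure_braid_def Br.pure_gen_rec [OF assms]
    by (simp only: BS.inv_mult_group BS.inv_closed BS.m_closed BS.inv_inv BS.m_assoc c p)
qed

text \<open>Induction downwards from \<open>k = n\<close>, where the braid is the square of
  \<open>\<sigma>_n\<close>. Conjugation by \<open>\<sigma>_k\<close> leads from
  \<open>k + 1\<close> to \<open>k\<close>, because \<open>\<sigma>_k\<close> fixes
  \<open>x_(n+1)\<close>, sends \<open>x_(k+1)\<close> to \<open>x_k\<close> and commutes with
  \<open>forget\<close>.\<close>

lemma pure_braid_action:
  assumes "k \<in> {1..n}"
  shows "fst (pure_braid n k) \<in> auto (FreeGrp (Suc n)) \<and> snd (pure_braid n k) = id \<and>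
    fst (pure_braid n k) (gen (Suc n)) = [(k, True), (Suc n, True), (k, False)] \<and>
    (\<forall>w\<in>carrier (FreeGrp (Suc n)). forget n (fst (pure_braid n k) w) = forget n w)"
  using assms
proof (induction "n - k" arbitrary: k)
  case 0
  then have k: "k = n" and n: "1 \<le> n" by auto
  let ?a = "artin_gen (Suc n) n"
  have a: "?a \<in> auto (FreeGrp (Suc n))" using n by (intro artin_gen_auto) auto
  have p: "pure_braid n k = (?a \<otimes>\<^bsub>AutF (Suc n)\<^esub> ?a, id)"
    unfolding k pure_braid_last [OF n] by (simp add: braid_gen_def sym_group_mult)
  have aa: "?a \<otimes>\<^bsub>AutF (Suc n)\<^esub> ?a \<in> auto (FreeGrp (Suc n))"
    using a A.m_closed [of ?a "Suc n" ?a] by simp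
  have gen: "(?a \<otimes>\<^bsub>AutF (Suc n)\<^esub> ?a) (gen t) = subst_hom (artin_image n) (artin_image n t)"
    if "t \<in> {1..Suc n}" for t
    using that n a gen_closed [OF that] by (simp add: F.auto_mult_apply artin_gen_image)
  have "forget n ((?a \<otimes>\<^bsub>AutF (Suc n)\<^esub> ?a) w) = forget n w" if w: "w \<in> carrier (FreeGrp (Suc n))" for w
  proof (rule FreeGrp_hom_eqI [OF group_hom_compose [OF F.auto_group_hom [OF aa] group_hom_forget] group_hom_forget _ w])
    fix t assume t: "t \<in> {1..Suc n}"
    show "forget n ((?a \<otimes>\<^bsub>AutF (Suc n)\<^esub> ?a) (gen t)) = forget n (gen t)"
      using t n by (auto simp: gen artin_image_def word_eval forget_def)
  qed
  moreover have "(?a \<otimes>\<^bsub>AutF (Suc n)\<^esub> ?a) (gen (Suc n)) = [(k, True), (Suc n, True), (k, False)]"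
    using n by (simp add: gen k artin_image_def word_eval)
  ultimately show ?case using aa by (simp add: p)
next
  case (Suc m)
  then have k: "1 \<le> k" "k < n" by auto
  let ?a = "artin_gen (Suc n) k" and ?p = "fst (pure_braid n (Suc k))"
  let ?a' = "inv\<^bsub>AutF (Suc n)\<^esub> ?a"
  have a: "?a \<in> auto (FreeGrp (Suc n))" using k by (intro artin_gen_auto) auto
  have a': "?a' \<in> auto (FreeGrp (Suc n))" using F.auto_inv_apply(1) [OF a F.one_closed] .
  have IH: "?p \<in> auto (FreeGrp (Suc n))" "snd (pure_braid n (Suc k)) = id"
    "?p (gen (Suc n)) = [(Suc k, True), (Suc n, True), (Suc k, False)]"
    "\<And>w. w \<in> carrier (FreeGrp (Suc n)) \<Longrightarrow> forget n (?p w) = forget n w"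
    using Suc k by auto
  have b: "braid_gen (Suc n) k \<in> carrier (BraidSpace (Suc n))"
    using k by (intro braid_gen_closed) auto
  let ?q = "?a \<otimes>\<^bsub>AutF (Suc n)\<^esub> ?p \<otimes>\<^bsub>AutF (Suc n)\<^esub> ?a'"
  have p: "pure_braid n k = (?q, id)"
    unfolding pure_braid_rec [OF k] BraidSpace_inv [OF b] using IH(2) k inv_transpose_sym_group [of k "Suc n"]
    by (simp add: mult_DirProd' braid_gen_def sym_group_mult)
  have ap: "?a \<otimes>\<^bsub>AutF (Suc n)\<^esub> ?p \<in> auto (FreeGrp (Suc n))"
    using a IH(1) A.m_closed [of ?a "Suc n" ?p] by simp
  then have q: "?q \<in> auto (FreeGrp (Suc n))"
    using a' A.m_closed [of _ "Suc n" ?a'] by simp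
  have q_apply: "?q w = ?a (?p (?a' w))" if "w \<in> carrier (FreeGrp (Suc n))" for w
    using a a' ap IH(1) that F.auto_closed [OF a' that] by (simp add: F.auto_mult_apply)
  have N: "gen (Suc n) \<in> carrier (FreeGrp (Suc n))" by (intro gen_closed) auto
  have "?a (gen (Suc n)) = gen (Suc n)" using k by (simp add: artin_gen_gen artin_image_def)
  then have "?a' (gen (Suc n)) = gen (Suc n)" using F.auto_inv_apply(3) [OF a N] by simp
  moreover have "?a [(Suc k, True), (Suc n, True), (Suc k, False)] = [(k, True), (Suc n, True), (k, False)]"
    using k by (simp add: artin_gen_apply carrier_FreeGrp artin_image_def word_eval)
  ultimately have "?q (gen (Suc n)) = [(k, True), (Suc n, True), (k, False)]"
    using q_apply [OF N] IH(3) by simp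
  moreover have "forget n (?q w) = forget n w" if w: "w \<in> carrier (FreeGrp (Suc n))" for w
  proof -
    have a'w: "?a' w \<in> carrier (FreeGrp (Suc n))" using F.auto_closed [OF a' w] .
    have "forget n (?q w) = artin_gen n k (forget n (?p (?a' w)))"
      using q_apply [OF w] forget_artin [OF k] F.auto_closed [OF IH(1) a'w] by simp
    also have "\<dots> = artin_gen n k (forget n (?a' w))" using IH(4) a'w by simp
    also have "\<dots> = forget n (?a (?a' w))" using forget_artin [OF k a'w] by simp
    finally show ?thesis using F.auto_inv_apply(2) [OF a w] by simp
  qed
  ultimately show ?case using q by (simp add: p)
qed

section \<open>Pure braids act trivially on the abelianisation\<close>

text \<open>The generating set is left open to cover both \<open>P_n\<close> and the pure braids on
  \<open>n + 1\<close> strands that come from the first \<open>n - 1\<close> generators.\<close>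

lemma subgroup_trivial_permutation:
  assumes S: "S \<subseteq> carrier (BraidSpace n)"
  shows "subgroup {\<alpha>. (\<alpha>, id) \<in> generate (BraidSpace n) S} (AutF n)" (is "subgroup ?P _")
proof -
  note carrier = BS.generate_in_carrier [OF S]
  show ?thesis
  proof (rule A.subgroupI)
    show "?P \<subseteq> carrier (AutF n)" using carrier by force
    have "\<one>\<^bsub>AutF n\<^esub> \<in> ?P"
      using generate.one [of "BraidSpace n"] by (simp add: sym_group_one)
    then show "?P \<noteq> {}" by blast
  next
    fix \<alpha> assume "\<alpha> \<in> ?P"
    then have \<alpha>: "(\<alpha>, id) \<in> generate (BraidSpace n) S" by simp
    then have "inv\<^bsub>BraidSpace n\<^esub> (\<alpha>, id) \<in> generate (BraidSpace n) S"
      using BS.generate_m_inv_closed [OF S] by blast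
    moreover have "inv\<^bsub>sym_group n\<^esub> id = id" using Sym.inv_one by (simp add: sym_group_one)
    ultimately show "inv\<^bsub>AutF n\<^esub> \<alpha> \<in> ?P"
      using BraidSpace_inv [OF carrier [OF \<alpha>]] by simp
  next
    fix \<alpha> \<beta> assume "\<alpha> \<in> ?P" "\<beta> \<in> ?P"
    then have "(\<alpha>, id) \<otimes>\<^bsub>BraidSpace n\<^esub> (\<beta>, id) \<in> generate (BraidSpace n) S"
      by (blast intro: generate.eng)
    then show "\<alpha> \<otimes>\<^bsub>AutF n\<^esub> \<beta> \<in> ?P" by (simp add: sym_group_mult)
  qed
qed

lemma subgroup_PureBraid: "subgroup (PureBraid n) (AutF n)"
  unfolding PureBraid_def braid_graph_eq
  using braid_gen_closed by (intro subgroup_trivial_permutation) blast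

lemma PureBraid_auto: "\<alpha> \<in> PureBraid n \<Longrightarrow> \<alpha> \<in> auto (FreeGrp n)"
  using subgroup.mem_carrier [OF subgroup_PureBraid] by simp

text \<open>Modulo \<open>\<Gamma>_2\<close> a generator \<open>\<sigma>_i\<close> merely swaps
  \<open>x_i\<close> and \<open>x_(i+1)\<close>, so a braid acts on the abelianisation through its
  permutation, which is trivial for pure braids.\<close>

lemma PureBraid_andreadakis: "PureBraid n \<subseteq> andreadakis (FreeGrp n) 1"
proof
  fix \<beta> assume "\<beta> \<in> PureBraid n"
  then have \<beta>: "(\<beta>, id) \<in> generate (BraidSpace n) (braid_gen n ` {1..<n})"
    by (simp add: PureBraid_def braid_graph_eq)
  let ?F = "FreeGrp n" and ?N = "lcs (FreeGrp n) 2"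
  have "?N \<lhd> ?F" by (rule F.lcs_normal)
  then obtain Q :: "word set monoid" and h where "quotient_hom ?F Q h ?N"
    using F.quotient_hom_exists by blast
  then interpret q: quotient_hom ?F Q h ?N .
  have comm: "h x \<otimes>\<^bsub>Q\<^esub> h y = h y \<otimes>\<^bsub>Q\<^esub> h x" if "x \<in> carrier ?F" "y \<in> carrier ?F" for x y
    using that q.commute_iff [OF that] F.commutator_lcs [of 1 x n y] by (simp add: numeral_2_eq_2)
  \<comment> \<open>Automorphisms preserve \<open>\<Gamma>_2\<close>, hence act on the
    abelianisation; this allows congruences to be composed and inverted.\<close>
  have auto_cong: "h (\<alpha> x) = h (\<alpha> y)"
    if \<alpha>: "\<alpha> \<in> auto ?F" and x: "x \<in> carrier ?F" and y: "y \<in> carrier ?F" and "h x = h y" for \<alpha> x y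
  proof -
    interpret a: group_hom ?F ?F \<alpha> using F.auto_group_hom [OF \<alpha>] .
    have "x \<otimes>\<^bsub>?F\<^esub> inv\<^bsub>?F\<^esub> y \<in> ?N" using q.hom_eq_iff that by blast
    then have "\<alpha> (x \<otimes>\<^bsub>?F\<^esub> inv\<^bsub>?F\<^esub> y) \<in> ?N" using a.hom_image_lcs by blast
    then have "\<alpha> x \<otimes>\<^bsub>?F\<^esub> inv\<^bsub>?F\<^esub> \<alpha> y \<in> ?N"
      using a.hom_mult [OF x F.inv_closed [OF y]] a.hom_inv [OF y] by simp
    then show ?thesis using q.hom_eq_iff x y a.hom_closed by blast
  qed
  have gen_h: "h (artin_gen n i (gen t)) = h (gen (transpose i (Suc i) t))"
    if i: "i \<in> {1..<n}" and t: "t \<in> {1..n}" for i t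
  proof (cases "t = i")
    case True
    have c: "gen i \<in> carrier ?F" "gen (Suc i) \<in> carrier ?F" using i by (auto intro!: gen_closed)
    have "artin_gen n i (gen t) = gen i \<otimes>\<^bsub>?F\<^esub> gen (Suc i) \<otimes>\<^bsub>?F\<^esub> inv\<^bsub>?F\<^esub> gen i"
      using i t True inv_gen [of i n]
      by (simp add: artin_gen_gen artin_image_def inverse_letters_def)
    then have "h (artin_gen n i (gen t)) = h (gen i) \<otimes>\<^bsub>Q\<^esub> h (gen (Suc i)) \<otimes>\<^bsub>Q\<^esub> inv\<^bsub>Q\<^esub> h (gen i)"
      using c q.hom_mult q.hom_inv F.m_closed F.inv_closed by metis
    also have "\<dots> = h (gen (Suc i))"
      using comm [OF c] q.hom_closed [OF c(1)] q.hom_closed [OF c(2)] by (simp add: q.H.m_assoc)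
    finally show ?thesis using True by simp
  next
    case False
    then show ?thesis using i t by (simp add: artin_gen_gen artin_image_def transpose_def)
  qed
  have "fst x \<in> auto ?F \<and> snd x permutes {1..n} \<and>
      (\<forall>t\<in>{1..n}. h (fst x (gen t)) = h (gen (snd x t)))"
    if "x \<in> generate (BraidSpace n) (braid_gen n ` {1..<n})" for x
    using that
  proof (induction x rule: generate.induct)
    case one
    then show ?case
      using A.one_closed [of n] gen_closed by (simp add: sym_group_one F.auto_one_apply permutes_def)
  next
    case (incl x)
    then obtain i where i: "i \<in> {1..<n}" and x: "x = braid_gen n i" by blast
    show ?case
      using braid_gen_closed [OF i] gen_h [OF i] by (simp add: x braid_gen_def sym_group_def)
  next
    case (inv x)
    then obtain i where i: "i \<in> {1..<n}" and x: "x = braid_gen n i" by blast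
    let ?a = "artin_gen n i" and ?s = "transpose i (Suc i)"
    let ?a' = "inv\<^bsub>AutF n\<^esub> ?a"
    have a: "?a \<in> auto ?F" using i by (intro artin_gen_auto) auto
    have a': "?a' \<in> auto ?F" using F.auto_inv_apply(1) [OF a F.one_closed] .
    have s: "?s permutes {1..n}" using i by (intro permutes_swap_id) auto
    have "h (?a' (gen t)) = h (gen (?s t))" if t: "t \<in> {1..n}" for t
    proof -
      have st: "?s t \<in> {1..n}" using permutes_in_image [OF s] t by simp
      note c = gen_closed [OF t] gen_closed [OF st]
      have "h (?a (gen (?s t))) = h (gen t)" using gen_h [OF i st] by simp
      then have "h (?a' (?a (gen (?s t)))) = h (?a' (gen t))"
        using auto_cong [OF a'] F.auto_closed [OF a c(2)] c by blast
      then show ?thesis using F.auto_inv_apply(3) [OF a c(2)] by simp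
    qed
    then show ?case
      using BraidSpace_inv [OF braid_gen_closed [OF i]] inv_transpose_sym_group [OF i] a' s
      by (simp add: x braid_gen_def)
  next
    case (eng x y)
    then have x: "fst x \<in> auto ?F" and y: "fst y \<in> auto ?F" by auto
    have "h ((fst x \<otimes>\<^bsub>AutF n\<^esub> fst y) (gen t)) = h (gen (snd x (snd y t)))" if t: "t \<in> {1..n}" for t
    proof -
      have yt: "snd y t \<in> {1..n}" using eng permutes_in_image t by metis
      note c = gen_closed [OF t] gen_closed [OF yt]
      have "h (fst y (gen t)) = h (gen (snd y t))" using eng t by blast
      then have "h (fst x (fst y (gen t))) = h (fst x (gen (snd y t)))"
        using auto_cong [OF x] F.auto_closed [OF y c(1)] c by blast
      also have "\<dots> = h (gen (snd x (snd y t)))" using eng yt by blast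
      finally show ?thesis using F.auto_mult_apply [OF x y c(1)] by simp
    qed
    moreover have "fst x \<otimes>\<^bsub>AutF n\<^esub> fst y \<in> auto ?F" using A.m_closed [of _ n] x y by simp
    moreover have "snd x \<circ> snd y permutes {1..n}" using eng permutes_compose by blast
    ultimately show ?case by (simp add: mult_DirProd' sym_group_mult comp_def)
  qed
  from this [OF \<beta>] have b: "\<beta> \<in> auto ?F" and gens: "\<And>t. t \<in> {1..n} \<Longrightarrow> h (\<beta> (gen t)) = h (gen t)"
    by auto
  have "h (\<beta> w) = h w" if w: "w \<in> carrier ?F" for w
    using FreeGrp_hom_eqI [OF group_hom_compose [OF F.auto_group_hom [OF b] q.group_hom_axioms]
        q.group_hom_axioms _ w] gens by blast
  then have "\<beta> w \<otimes>\<^bsub>?F\<^esub> inv\<^bsub>?F\<^esub> w \<in> ?N" if "w \<in> carrier ?F" for w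
    using q.hom_eq_iff [of "\<beta> w" w] F.auto_closed [OF b that] that by blast
  then show "\<beta> \<in> andreadakis ?F 1" using b by (simp add: andreadakis_def numeral_2_eq_2)
qed

section \<open>Pushing the last strand\<close>

text \<open>Substitution of 0 for the variable \<open>X_a\<close>, which is the effect of
  \<open>forget\<close> on Magnus expansions.\<close>

definition suppress :: "nat \<Rightarrow> series \<Rightarrow> series" where
  "suppress a f = Series (\<lambda>u. if a \<in> set u then 0 else mcoeff f u)"

lemma coeff_suppress [simp]: "mcoeff (suppress a f) u = (if a \<in> set u then 0 else mcoeff f u)"
  by (simp add: suppress_def)

lemma suppress_mult: "suppress a (f * g) = suppress a f * suppress a g"
proof (rule series_eqI)
  fix u :: "nat list"
  show "mcoeff (suppress a (f * g)) u = mcoeff (suppress a f * suppress a g) u"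
  proof (cases "a \<in> set u")
    case True
    then have "a \<in> set (take k u) \<or> a \<in> set (drop k u)" for k
      by (metis Un_iff append_take_drop_id set_append)
    then have "mcoeff (suppress a f) (take k u) * mcoeff (suppress a g) (drop k u) = 0" for k
      by auto
    then have "(\<Sum>k\<le>length u. mcoeff (suppress a f) (take k u) * mcoeff (suppress a g) (drop k u)) = 0"
      by (intro sum.neutral) blast
    then show ?thesis using True by (simp only: coeff_mult conv_eq_sum coeff_suppress if_True)
  next
    case False
    then have "a \<notin> set (take k u)" "a \<notin> set (drop k u)" for k
      by (auto dest: in_set_takeD in_set_dropD)
    then show ?thesis using False by (simp add: coeff_mult conv_eq_sum)
  qed
qed

lemma suppress_sletter: "suppress a (sletter l) = (if fst l = a then 1 else sletter l)"
proof (rule series_eqI)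
  fix u :: "nat list"
  show "mcoeff (suppress a (sletter l)) u = mcoeff (if fst l = a then 1 else sletter l) u"
    by (cases u) (auto simp: sletter_def)
qed

lemma magnus_forget:
  "set w \<subseteq> {1..Suc n} \<times> UNIV \<Longrightarrow> magnus (forget n w) = suppress (Suc n) (magnus w)"
proof (induction w)
  case Nil
  have "suppress (Suc n) 1 = 1" by (rule series_eqI) auto
  then show ?case by (simp add: forget_def subst_hom_Cons)
next
  case (Cons l w)
  obtain i b where l: "l = (i, b)" by (cases l)
  have IH: "magnus (forget n w) = suppress (Suc n) (magnus w)" using Cons by simp
  have i: "i \<le> n \<or> i = Suc n" using Cons.prems l by auto
  have "forget n (l # w) = word_mult (if i \<le> n then [(i, b)] else []) (forget n w)"
    by (simp add: l forget_def subst_hom_Cons word_inv_def)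
  then have "magnus (forget n (l # w)) = (if i \<le> n then sletter l else 1) * suppress (Suc n) (magnus w)"
    by (simp only: magnus_word_mult IH) (simp add: l)
  then show ?case using i by (auto simp: suppress_mult suppress_sletter l)
qed

text \<open>If \<open>[w, x\<^sub>n\<^sub>+\<^sub>1]\<close> lies deep in the lower central series, so does \<open>M(w) X - X M(w)\<close>, where \<open>X\<close> is
  the last variable; for a monomial \<open>u\<close> not involving \<open>X\<close>, its coefficient at \<open>u X\<close> is that of \<open>M(w)\<close> at \<open>u\<close>.\<close>

lemma commutator_last_gen:
  assumes w: "w \<in> carrier (FreeGrp (Suc n))"
    and comm: "commutator (FreeGrp (Suc n)) w (gen (Suc n)) \<in> lcs (FreeGrp (Suc n)) (Suc j)"
  shows "forget n w \<in> lcs (FreeGrp n) j"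
proof -
  let ?F = "FreeGrp (Suc n)" and ?x = "gen (Suc n)"
  let ?c = "commutator ?F w ?x" and ?X = "svar (Suc n)" and ?W = "magnus w"
  have x: "?x \<in> carrier ?F" by (intro gen_closed) auto
  have "word_mult ?c (word_mult ?x w) = word_mult w ?x"
    using F.commutator_mult [OF w x] by simp
  then have "magnus ?c * (magnus ?x * ?W) = ?W * magnus ?x"
    by (simp only: magnus_word_mult [symmetric])
  then have "?W * magnus ?x - magnus ?x * ?W = (magnus ?c - 1) * (magnus ?x * ?W)"
    by (simp add: left_diff_distrib)
  moreover have "magnus ?x = 1 + ?X" by (simp add: sletter_def)
  ultimately have "?W * ?X - ?X * ?W = (magnus ?c - 1) * (magnus ?x * ?W)"
    by (simp add: distrib_left distrib_right)
  then have van: "vanishes (Suc j) (?W * ?X - ?X * ?W)"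
    using vanishes_mult_left [OF lcs_vanishes [OF comm]] by simp
  \<comment> \<open>A nonempty \<open>u\<close> without the letter \<open>n + 1\<close> does not
    begin with it, so the monomial \<open>u X\<close> cannot occur in \<open>X M(w)\<close>. Its
    degree \<open>|u| + 1\<close> is below \<open>j + 1\<close>, where the difference
    vanishes.\<close>
  have zero: "mcoeff ?W u = 0" if u: "length u < j" "u \<noteq> []" "Suc n \<notin> set u" for u
  proof -
    obtain a v where av: "u = a # v" using u by (cases u) auto
    have "mcoeff (?W * ?X - ?X * ?W) (u @ [Suc n]) = 0"
      using van u by (simp add: vanishes_def)
    moreover have "mcoeff (?X * ?W) (u @ [Suc n]) = 0"
      using u by (simp add: av coeff_svar_mult)
    ultimately show ?thesis by (simp add: coeff_mult_svar)
  qed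
  have "magnus (forget n w) = suppress (Suc n) ?W"
    using w by (intro magnus_forget) (simp add: carrier_FreeGrp)
  then have "vanishes j (magnus (forget n w) - 1)"
    using zero by (auto simp: vanishes_def)
  moreover have "forget n w \<in> carrier (FreeGrp n)"
    using group_hom.hom_closed [OF group_hom_forget w] .
  ultimately show ?thesis by (intro vanishes_imp_lcs)
qed

section \<open>The push homomorphism\<close>

abbreviation PB :: "nat \<Rightarrow> (word \<Rightarrow> word) monoid" where
  "PB n \<equiv> (AutF n)\<lparr>carrier := PureBraid n\<rparr>"

interpretation PB: group "PB n" for n
  by (rule A.subgroup_imp_group [OF subgroup_PureBraid])

lemma pure_gen_eq_inv: "k \<in> {1..n} \<Longrightarrow> Br.pure_gen n k = inv\<^bsub>BraidSpace (Suc n)\<^esub> pure_braid n k"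
  unfolding pure_braid_def using BS.inv_inv [OF pure_gen_carrier] by simp

lemma pure_braid_carrier: "k \<in> {1..n} \<Longrightarrow> pure_braid n k \<in> carrier (BraidSpace (Suc n))"
  unfolding pure_braid_def by (intro BS.inv_closed pure_gen_carrier)

lemma fst_pure_gen_PureBraid:
  assumes k: "k \<in> {1..n}"
  shows "fst (Br.pure_gen n k) \<in> PureBraid (Suc n)"
proof -
  have "Br.pure_gen n k \<in> generate (BraidSpace (Suc n)) (inv_gen_braid n ` {1..<Suc n})"
    using Br.pure_gen_generate [OF k] by (simp add: atLeastLessThanSuc_atLeastAtMost)
  then have "Br.pure_gen n k \<in> braid_graph (Suc n)"
    unfolding braid_graph_eq generate_inv_gen_braid [OF order_refl] .
  moreover have "snd (Br.pure_gen n k) = id"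
    unfolding pure_gen_eq_inv [OF k] BraidSpace_inv [OF pure_braid_carrier [OF k]]
    using pure_braid_action [OF k] Sym.inv_one [of "Suc n"] by (simp add: sym_group_one)
  ultimately show ?thesis by (simp add: PureBraid_def prod_eq_iff) (metis prod.collapse)
qed

text \<open>The point-pushing map of the punctured disc. Its target is \<open>P_(n+1)\<close> and
  not merely the automorphism group, so that \<open>\<Gamma>_j(F_n)\<close> lands in
  \<open>\<Gamma>_j(P_(n+1))\<close>.\<close>

definition push :: "nat \<Rightarrow> word \<Rightarrow> word \<Rightarrow> word" where
  "push n = free_lift (PB (Suc n)) (\<lambda>k. fst (Br.pure_gen n k))"

lemma group_hom_push: "group_hom (FreeGrp n) (PB (Suc n)) (push n)"
  unfolding push_def using fst_pure_gen_PureBraid by (intro group_hom_free_lift PB.is_group) simp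

text \<open>The last clause says that a braid moving only the last strand is determined by the
  conjugator \<open>w\<close> of its action on the last free generator, taken modulo that generator.\<close>

definition last_strand_push :: "nat \<Rightarrow> (word \<Rightarrow> word) \<Rightarrow> bool" where
  "last_strand_push n \<kappa> \<longleftrightarrow> \<kappa> \<in> auto (FreeGrp (Suc n)) \<and>
     (\<forall>w\<in>carrier (FreeGrp (Suc n)). forget n (\<kappa> w) = forget n w) \<and>
     (\<exists>w\<in>carrier (FreeGrp (Suc n)).
        \<kappa> (gen (Suc n)) = w \<otimes>\<^bsub>FreeGrp (Suc n)\<^esub> gen (Suc n) \<otimes>\<^bsub>FreeGrp (Suc n)\<^esub> inv\<^bsub>FreeGrp (Suc n)\<^esub> w \<and>
        \<kappa> \<otimes>\<^bsub>AutF (Suc n)\<^esub> push n (forget n w) = \<one>\<^bsub>AutF (Suc n)\<^esub>)"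

lemma push_auto: "v \<in> carrier (FreeGrp n) \<Longrightarrow> push n v \<in> auto (FreeGrp (Suc n))"
  using group_hom.hom_closed [OF group_hom_push] PureBraid_auto by fastforce

lemma push_mult:
  assumes "v \<in> carrier (FreeGrp n)" "w \<in> carrier (FreeGrp n)"
  shows "push n (v \<otimes>\<^bsub>FreeGrp n\<^esub> w) = push n v \<otimes>\<^bsub>AutF (Suc n)\<^esub> push n w"
  using group_hom.hom_mult [OF group_hom_push assms] by simp

lemma push_one: "push n \<one>\<^bsub>FreeGrp n\<^esub> = \<one>\<^bsub>AutF (Suc n)\<^esub>"
  using group_hom.hom_one [OF group_hom_push] by simp

text \<open>Applying the inverse of \<open>\<kappa>\<close> to \<open>\<kappa>(x) = w x w^-1\<close>
  shows that the inverse has conjugator \<open>\<kappa>^-1(w)^-1\<close>, and \<open>forget\<close>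
  sends this to the inverse of \<open>forget n w\<close>.\<close>

lemma last_strand_push_inv:
  assumes "last_strand_push n \<kappa>"
  shows "last_strand_push n (inv\<^bsub>AutF (Suc n)\<^esub> \<kappa>)"
proof -
  let ?F = "FreeGrp (Suc n)" and ?x = "gen (Suc n)" and ?k = "inv\<^bsub>AutF (Suc n)\<^esub> \<kappa>"
  interpret f: group_hom ?F "FreeGrp n" "forget n" by (rule group_hom_forget)
  obtain w where \<kappa>: "\<kappa> \<in> auto ?F" and fg: "\<And>w. w \<in> carrier ?F \<Longrightarrow> forget n (\<kappa> w) = forget n w"
    and w: "w \<in> carrier ?F" and \<kappa>x: "\<kappa> ?x = w \<otimes>\<^bsub>?F\<^esub> ?x \<otimes>\<^bsub>?F\<^esub> inv\<^bsub>?F\<^esub> w"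
    and \<kappa>w: "\<kappa> \<otimes>\<^bsub>AutF (Suc n)\<^esub> push n (forget n w) = \<one>\<^bsub>AutF (Suc n)\<^esub>"
    using assms unfolding last_strand_push_def by blast
  have x: "?x \<in> carrier ?F" by (intro gen_closed) auto
  have k: "?k \<in> auto ?F" using F.auto_inv_apply(1) [OF \<kappa> x] .
  interpret k: group_hom ?F ?F ?k using F.auto_group_hom [OF k] .
  have fk: "forget n (?k v) = forget n v" if v: "v \<in> carrier ?F" for v
    using fg [of "?k v"] F.auto_inv_apply(2) [OF \<kappa> v] F.auto_closed [OF k v] by simp
  let ?v = "inv\<^bsub>?F\<^esub> ?k w"
  have kw: "?k w \<in> carrier ?F" and kx: "?k ?x \<in> carrier ?F" using w x by auto
  have "?x = ?k w \<otimes>\<^bsub>?F\<^esub> ?k ?x \<otimes>\<^bsub>?F\<^esub> inv\<^bsub>?F\<^esub> ?k w"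
    using F.auto_inv_apply(3) [OF \<kappa> x] unfolding \<kappa>x
    by (simp only: k.hom_mult k.hom_inv F.m_closed F.inv_closed w x)
  then have "?v \<otimes>\<^bsub>?F\<^esub> ?x \<otimes>\<^bsub>?F\<^esub> inv\<^bsub>?F\<^esub> ?v
      = ?v \<otimes>\<^bsub>?F\<^esub> (?k w \<otimes>\<^bsub>?F\<^esub> ?k ?x \<otimes>\<^bsub>?F\<^esub> inv\<^bsub>?F\<^esub> ?k w) \<otimes>\<^bsub>?F\<^esub> inv\<^bsub>?F\<^esub> ?v"
    by simp
  also have "\<dots> = ?k ?x"
    by (simp only: F.m_assoc F.inv_mult_cancel F.inv_inv F.m_closed F.inv_closed F.l_inv F.r_one kw kx)
  finally have kx': "?k ?x = ?v \<otimes>\<^bsub>?F\<^esub> ?x \<otimes>\<^bsub>?F\<^esub> inv\<^bsub>?F\<^esub> ?v" ..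
  have fw: "forget n w \<in> carrier (FreeGrp n)" using w by simp
  have fv: "forget n ?v = inv\<^bsub>FreeGrp n\<^esub> forget n w"
    using f.hom_inv [OF kw] fk [OF w] by simp
  let ?p = "push n (forget n w)" and ?q = "push n (inv\<^bsub>FreeGrp n\<^esub> forget n w)"
  have pq: "?p \<otimes>\<^bsub>AutF (Suc n)\<^esub> ?q = \<one>\<^bsub>AutF (Suc n)\<^esub>"
    unfolding push_mult [OF fw F.inv_closed [OF fw], symmetric] F.r_inv [OF fw] by (rule push_one)
  have c: "\<kappa> \<in> carrier (AutF (Suc n))" "?p \<in> carrier (AutF (Suc n))" "?q \<in> carrier (AutF (Suc n))"
    using \<kappa> push_auto fw F.inv_closed [OF fw] by auto
  have "?q = \<kappa>"
  proof -
    have "\<kappa> \<otimes>\<^bsub>AutF (Suc n)\<^esub> ?p \<otimes>\<^bsub>AutF (Suc n)\<^esub> ?q = \<kappa> \<otimes>\<^bsub>AutF (Suc n)\<^esub> (?p \<otimes>\<^bsub>AutF (Suc n)\<^esub> ?q)"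
      by (rule A.m_assoc [OF c])
    then show ?thesis unfolding \<kappa>w pq using A.l_one [OF c(3)] A.r_one [OF c(1)] by simp
  qed
  then have "?k \<otimes>\<^bsub>AutF (Suc n)\<^esub> push n (forget n ?v) = \<one>\<^bsub>AutF (Suc n)\<^esub>"
    using fv A.l_inv [OF c(1)] by simp
  then show ?thesis
    unfolding last_strand_push_def using k fk kx' F.inv_closed [OF kw] by blast
qed

text \<open>If \<open>\<kappa>\<close> and \<open>\<mu>\<close> have conjugators \<open>v\<close>
  and \<open>w\<close>, the composite has \<open>\<kappa>(w) v\<close>, which \<open>forget\<close>
  sends to the product of the images of \<open>w\<close> and \<open>v\<close> in this order. The
  reversal fits the form \<open>\<kappa> push(v) = 1\<close> of the condition.\<close>

lemma last_strand_push_mult: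
  assumes "last_strand_push n \<kappa>" "last_strand_push n \<mu>"
  shows "last_strand_push n (\<kappa> \<otimes>\<^bsub>AutF (Suc n)\<^esub> \<mu>)"
proof -
  let ?F = "FreeGrp (Suc n)" and ?x = "gen (Suc n)" and ?A = "AutF (Suc n)"
  interpret f: group_hom ?F "FreeGrp n" "forget n" by (rule group_hom_forget)
  obtain v where \<kappa>: "\<kappa> \<in> auto ?F" and f\<kappa>: "\<And>w. w \<in> carrier ?F \<Longrightarrow> forget n (\<kappa> w) = forget n w"
    and v: "v \<in> carrier ?F" and \<kappa>x: "\<kappa> ?x = v \<otimes>\<^bsub>?F\<^esub> ?x \<otimes>\<^bsub>?F\<^esub> inv\<^bsub>?F\<^esub> v"
    and \<kappa>v: "\<kappa> \<otimes>\<^bsub>?A\<^esub> push n (forget n v) = \<one>\<^bsub>?A\<^esub>"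
    using assms(1) unfolding last_strand_push_def by blast
  obtain w where \<mu>: "\<mu> \<in> auto ?F" and f\<mu>: "\<And>w. w \<in> carrier ?F \<Longrightarrow> forget n (\<mu> w) = forget n w"
    and w: "w \<in> carrier ?F" and \<mu>x: "\<mu> ?x = w \<otimes>\<^bsub>?F\<^esub> ?x \<otimes>\<^bsub>?F\<^esub> inv\<^bsub>?F\<^esub> w"
    and \<mu>w: "\<mu> \<otimes>\<^bsub>?A\<^esub> push n (forget n w) = \<one>\<^bsub>?A\<^esub>"
    using assms(2) unfolding last_strand_push_def by blast
  have x: "?x \<in> carrier ?F" by (intro gen_closed) auto
  interpret k: group_hom ?F ?F \<kappa> using F.auto_group_hom [OF \<kappa>] .
  have \<kappa>w: "\<kappa> w \<in> carrier ?F" using w by simp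
  let ?u = "\<kappa> w \<otimes>\<^bsub>?F\<^esub> v"
  have u: "?u \<in> carrier ?F" using F.m_closed [OF \<kappa>w v] .
  have "(\<kappa> \<otimes>\<^bsub>?A\<^esub> \<mu>) ?x = \<kappa> (w \<otimes>\<^bsub>?F\<^esub> ?x \<otimes>\<^bsub>?F\<^esub> inv\<^bsub>?F\<^esub> w)"
    using F.auto_mult_apply [OF \<kappa> \<mu> x] \<mu>x by simp
  also have "\<dots> = \<kappa> w \<otimes>\<^bsub>?F\<^esub> (v \<otimes>\<^bsub>?F\<^esub> ?x \<otimes>\<^bsub>?F\<^esub> inv\<^bsub>?F\<^esub> v) \<otimes>\<^bsub>?F\<^esub> inv\<^bsub>?F\<^esub> \<kappa> w"
    by (simp only: k.hom_mult k.hom_inv F.m_closed F.inv_closed w x \<kappa>x)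
  also have "\<dots> = ?u \<otimes>\<^bsub>?F\<^esub> ?x \<otimes>\<^bsub>?F\<^esub> inv\<^bsub>?F\<^esub> ?u"
    by (simp only: F.m_assoc F.inv_mult_group F.m_closed F.inv_closed \<kappa>w v x)
  finally have ux: "(\<kappa> \<otimes>\<^bsub>?A\<^esub> \<mu>) ?x = ?u \<otimes>\<^bsub>?F\<^esub> ?x \<otimes>\<^bsub>?F\<^esub> inv\<^bsub>?F\<^esub> ?u" .
  have fvw: "forget n v \<in> carrier (FreeGrp n)" "forget n w \<in> carrier (FreeGrp n)" using v w by auto
  have fu: "forget n ?u = forget n w \<otimes>\<^bsub>FreeGrp n\<^esub> forget n v"
    using f.hom_mult [OF \<kappa>w v] f\<kappa> [OF w] by simp
  let ?p = "push n (forget n v)" and ?q = "push n (forget n w)"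
  have c: "\<kappa> \<in> carrier ?A" "\<mu> \<in> carrier ?A" "?p \<in> carrier ?A" "?q \<in> carrier ?A"
    using \<kappa> \<mu> push_auto fvw by auto
  have "(\<kappa> \<otimes>\<^bsub>?A\<^esub> \<mu>) \<otimes>\<^bsub>?A\<^esub> push n (forget n ?u) = \<kappa> \<otimes>\<^bsub>?A\<^esub> \<mu> \<otimes>\<^bsub>?A\<^esub> (?q \<otimes>\<^bsub>?A\<^esub> ?p)"
    unfolding fu push_mult [OF fvw(2,1)] ..
  also have "\<dots> = \<kappa> \<otimes>\<^bsub>?A\<^esub> (\<mu> \<otimes>\<^bsub>?A\<^esub> ?q) \<otimes>\<^bsub>?A\<^esub> ?p"
    by (simp only: A.m_assoc A.m_closed c)
  also have "\<dots> = \<one>\<^bsub>?A\<^esub>" by (simp only: \<mu>w A.r_one c \<kappa>v)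
  finally have pu: "(\<kappa> \<otimes>\<^bsub>?A\<^esub> \<mu>) \<otimes>\<^bsub>?A\<^esub> push n (forget n ?u) = \<one>\<^bsub>?A\<^esub>" .
  have "forget n ((\<kappa> \<otimes>\<^bsub>?A\<^esub> \<mu>) y) = forget n y" if y: "y \<in> carrier ?F" for y
    using F.auto_mult_apply [OF \<kappa> \<mu> y] f\<kappa> f\<mu> y F.auto_closed [OF \<mu> y] by simp
  moreover have "\<kappa> \<otimes>\<^bsub>?A\<^esub> \<mu> \<in> auto ?F" using A.m_closed [OF c(1,2)] by simp
  ultimately show ?thesis unfolding last_strand_push_def using ux pu u by blast
qed

lemma last_strand_push_pure_braid:
  assumes k: "k \<in> {1..n}"
  shows "last_strand_push n (fst (pure_braid n k))"
proof -
  let ?F = "FreeGrp (Suc n)" and ?A = "AutF (Suc n)"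
  have act: "fst (pure_braid n k) \<in> auto ?F"
    "fst (pure_braid n k) (gen (Suc n)) = [(k, True), (Suc n, True), (k, False)]"
    "\<forall>w\<in>carrier ?F. forget n (fst (pure_braid n k) w) = forget n w"
    using pure_braid_action [OF k] by auto
  have c: "gen k \<in> carrier ?F" using k by (intro gen_closed) auto
  have "[(k, True), (Suc n, True), (k, False)] = gen k \<otimes>\<^bsub>?F\<^esub> gen (Suc n) \<otimes>\<^bsub>?F\<^esub> inv\<^bsub>?F\<^esub> gen k"
    using k inv_gen [of k "Suc n"] by (simp add: inverse_letters_def)
  moreover have "push n (forget n (gen k)) = fst (Br.pure_gen n k)"
    using k fst_pure_gen_PureBraid [OF k] free_lift_gen [OF PB.is_group, of "\<lambda>k. fst (Br.pure_gen n k)" k]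
    by (simp add: forget_gen push_def)
  moreover have "fst (pure_braid n k) \<otimes>\<^bsub>?A\<^esub> fst (Br.pure_gen n k) = \<one>\<^bsub>?A\<^esub>"
    using BS.l_inv [OF pure_gen_carrier [OF k]] unfolding pure_braid_def
    by (simp add: mult_DirProd')
  ultimately show ?thesis unfolding last_strand_push_def using act c by metis
qed

lemma generate_pure_gen:
  assumes "x \<in> generate (BraidSpace (Suc n)) (Br.pure_gen n ` {1..n})"
  shows "snd x = id \<and> last_strand_push n (fst x)"
  using assms
proof (induction x rule: generate.induct)
  case one
  have c: "[] \<in> carrier (FreeGrp m)" for m by (simp add: carrier_FreeGrp)
  have "last_strand_push n \<one>\<^bsub>AutF (Suc n)\<^esub>"
    unfolding last_strand_push_def
  proof (intro conjI ballI bexI)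
    show "\<one>\<^bsub>AutF (Suc n)\<^esub> \<in> auto (FreeGrp (Suc n))" using A.one_closed [of "Suc n"] by simp
    show "forget n (\<one>\<^bsub>AutF (Suc n)\<^esub> w) = forget n w" if "w \<in> carrier (FreeGrp (Suc n))" for w
      using that by (simp add: F.auto_one_apply)
    show "\<one>\<^bsub>AutF (Suc n)\<^esub> (gen (Suc n)) = \<one>\<^bsub>FreeGrp (Suc n)\<^esub> \<otimes>\<^bsub>FreeGrp (Suc n)\<^esub> gen (Suc n)
        \<otimes>\<^bsub>FreeGrp (Suc n)\<^esub> inv\<^bsub>FreeGrp (Suc n)\<^esub> \<one>\<^bsub>FreeGrp (Suc n)\<^esub>"
      using gen_closed [of "Suc n" "Suc n"] c [of "Suc n"]
      by (simp add: F.auto_one_apply inv_FreeGrp word_inv_def)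
    show "\<one>\<^bsub>AutF (Suc n)\<^esub> \<otimes>\<^bsub>AutF (Suc n)\<^esub> push n (forget n \<one>\<^bsub>FreeGrp (Suc n)\<^esub>) = \<one>\<^bsub>AutF (Suc n)\<^esub>"
      using group_hom.hom_one [OF group_hom_forget [of "Suc n" n]] push_one [of n] A.l_one [OF A.one_closed]
      by simp
  qed (rule F.one_closed)
  then show ?case by (simp add: sym_group_one)
next
  case (incl x)
  then obtain k where k: "k \<in> {1..n}" and x: "x = Br.pure_gen n k" by blast
  then show ?case
    unfolding x pure_gen_eq_inv [OF k] BraidSpace_inv [OF pure_braid_carrier [OF k]]
    using last_strand_push_inv [OF last_strand_push_pure_braid [OF k]] pure_braid_action [OF k]
      Sym.inv_one [of "Suc n"] by (simp add: sym_group_one)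
next
  case (inv x)
  then obtain k where k: "k \<in> {1..n}" and x: "x = Br.pure_gen n k" by blast
  have "inv\<^bsub>BraidSpace (Suc n)\<^esub> x = pure_braid n k" by (simp only: x pure_braid_def)
  then show ?case
    using last_strand_push_pure_braid [OF k] pure_braid_action [OF k] by simp
next
  case (eng x y)
  then show ?case using last_strand_push_mult by (simp add: mult_DirProd' sym_group_mult)
qed

section \<open>Forgetting the last strand\<close>

text \<open>Automorphisms respecting the splitting of \<open>F_(n+1)\<close> into \<open>F_n\<close>
  and the last generator. Equality of the image with \<open>F_n\<close> makes the restriction
  surjective and passes to inverses directly.\<close>

definition fixes_last :: "nat \<Rightarrow> (word \<Rightarrow> word) set" where
  "fixes_last n = {\<alpha> \<in> auto (FreeGrp (Suc n)). \<alpha> (gen (Suc n)) = gen (Suc n) \<and>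
     \<alpha> ` carrier (FreeGrp n) = carrier (FreeGrp n)}"

abbreviation cut :: "nat \<Rightarrow> (word \<Rightarrow> word) \<Rightarrow> word \<Rightarrow> word" where
  "cut n \<alpha> \<equiv> restrict \<alpha> (carrier (FreeGrp n))"

lemma subgroup_fixes_last: "subgroup (fixes_last n) (AutF (Suc n))"
proof -
  let ?F = "FreeGrp (Suc n)" and ?x = "gen (Suc n)"
  have x: "?x \<in> carrier ?F" by (intro gen_closed) auto
  note mono = subsetD [OF FreeGrp_mono [of n]]
  show ?thesis
  proof (rule A.subgroupI)
    show "fixes_last n \<subseteq> carrier (AutF (Suc n))" by (auto simp: fixes_last_def)
    have "\<one>\<^bsub>AutF (Suc n)\<^esub> \<in> fixes_last n"
      using A.one_closed [of "Suc n"] x mono by (simp add: fixes_last_def F.auto_one_apply)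
    then show "fixes_last n \<noteq> {}" by blast
  next
    fix \<alpha> assume "\<alpha> \<in> fixes_last n"
    then have \<alpha>: "\<alpha> \<in> auto ?F" "\<alpha> ?x = ?x" "\<alpha> ` carrier (FreeGrp n) = carrier (FreeGrp n)"
      by (auto simp: fixes_last_def)
    let ?b = "inv\<^bsub>AutF (Suc n)\<^esub> \<alpha>"
    have "?b ` carrier (FreeGrp n) = ?b ` \<alpha> ` carrier (FreeGrp n)" using \<alpha>(3) by simp
    also have "\<dots> = carrier (FreeGrp n)"
      using F.auto_inv_apply(3) [OF \<alpha>(1) mono] by (simp add: image_image)
    finally show "?b \<in> fixes_last n"
      using F.auto_inv_apply(1,3) [OF \<alpha>(1) x] \<alpha>(2) by (simp add: fixes_last_def)
  next
    fix \<alpha> \<beta> assume "\<alpha> \<in> fixes_last n" "\<beta> \<in> fixes_last n"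
    then have \<alpha>: "\<alpha> \<in> auto ?F" "\<alpha> ?x = ?x" "\<alpha> ` carrier (FreeGrp n) = carrier (FreeGrp n)"
      and \<beta>: "\<beta> \<in> auto ?F" "\<beta> ?x = ?x" "\<beta> ` carrier (FreeGrp n) = carrier (FreeGrp n)"
      by (auto simp: fixes_last_def)
    have "(\<alpha> \<otimes>\<^bsub>AutF (Suc n)\<^esub> \<beta>) ` carrier (FreeGrp n) = \<alpha> ` \<beta> ` carrier (FreeGrp n)"
      using F.auto_mult_apply [OF \<alpha>(1) \<beta>(1) mono] by (simp add: image_image)
    then show "\<alpha> \<otimes>\<^bsub>AutF (Suc n)\<^esub> \<beta> \<in> fixes_last n"
      using \<alpha> \<beta> F.auto_mult_apply [OF \<alpha>(1) \<beta>(1) x] A.m_closed [of \<alpha> "Suc n" \<beta>]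
      by (simp add: fixes_last_def)
  qed
qed

lemma cut_auto:
  assumes "\<alpha> \<in> fixes_last n"
  shows "cut n \<alpha> \<in> auto (FreeGrp n)"
proof -
  have \<alpha>: "\<alpha> \<in> auto (FreeGrp (Suc n))" and im: "\<alpha> ` carrier (FreeGrp n) = carrier (FreeGrp n)"
    using assms by (auto simp: fixes_last_def)
  interpret a: group_hom "FreeGrp (Suc n)" "FreeGrp (Suc n)" \<alpha> using F.auto_group_hom [OF \<alpha>] .
  note mono = subsetD [OF FreeGrp_mono [of n]]
  have "cut n \<alpha> \<in> hom (FreeGrp n) (FreeGrp n)"
  proof (rule homI)
    fix v w assume v: "v \<in> carrier (FreeGrp n)" and w: "w \<in> carrier (FreeGrp n)"
    show "cut n \<alpha> (v \<otimes>\<^bsub>FreeGrp n\<^esub> w) = cut n \<alpha> v \<otimes>\<^bsub>FreeGrp n\<^esub> cut n \<alpha> w"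
      using a.hom_mult [OF mono [OF v] mono [OF w]] F.m_closed [OF v w] v w by simp
  qed (use im in auto)
  moreover have "inj_on \<alpha> (carrier (FreeGrp n))"
    using \<alpha> FreeGrp_mono by (auto simp: auto_def Bij_def bij_betw_def intro: inj_on_subset)
  then have "bij_betw (cut n \<alpha>) (carrier (FreeGrp n)) (carrier (FreeGrp n))"
    using im by (simp add: bij_betw_def)
  ultimately show ?thesis by (simp add: auto_def Bij_def)
qed

lemma group_hom_cut: "group_hom ((AutF (Suc n))\<lparr>carrier := fixes_last n\<rparr>) (AutF n) (cut n)"
proof -
  have "cut n \<in> hom ((AutF (Suc n))\<lparr>carrier := fixes_last n\<rparr>) (AutF n)"
  proof (rule homI)
    fix \<alpha> \<beta>
    assume ab: "\<alpha> \<in> carrier ((AutF (Suc n))\<lparr>carrier := fixes_last n\<rparr>)"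
      "\<beta> \<in> carrier ((AutF (Suc n))\<lparr>carrier := fixes_last n\<rparr>)"
    then have auts: "\<alpha> \<in> auto (FreeGrp (Suc n))" "\<beta> \<in> auto (FreeGrp (Suc n))"
      and im: "\<beta> ` carrier (FreeGrp n) = carrier (FreeGrp n)" by (auto simp: fixes_last_def)
    have m: "\<alpha> \<otimes>\<^bsub>AutF (Suc n)\<^esub> \<beta> \<in> fixes_last n"
      using subgroup.m_closed [OF subgroup_fixes_last] ab by simp
    have c: "cut n \<alpha> \<in> auto (FreeGrp n)" "cut n \<beta> \<in> auto (FreeGrp n)" using cut_auto ab by auto
    have "cut n (\<alpha> \<otimes>\<^bsub>AutF (Suc n)\<^esub> \<beta>) = cut n \<alpha> \<otimes>\<^bsub>AutF n\<^esub> cut n \<beta>"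
    proof (rule F.auto_eqI)
      show "cut n (\<alpha> \<otimes>\<^bsub>AutF (Suc n)\<^esub> \<beta>) \<in> auto (FreeGrp n)" using cut_auto m by blast
      show "cut n \<alpha> \<otimes>\<^bsub>AutF n\<^esub> cut n \<beta> \<in> auto (FreeGrp n)"
        using A.m_closed [of "cut n \<alpha>" n "cut n \<beta>"] c by simp
      fix w assume w: "w \<in> carrier (FreeGrp n)"
      then have "\<beta> w \<in> carrier (FreeGrp n)" using im by blast
      then show "cut n (\<alpha> \<otimes>\<^bsub>AutF (Suc n)\<^esub> \<beta>) w = (cut n \<alpha> \<otimes>\<^bsub>AutF n\<^esub> cut n \<beta>) w"
        using w F.auto_mult_apply [OF auts subsetD [OF FreeGrp_mono w]] F.auto_mult_apply [OF c w] by simp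
    qed
    then show "cut n (\<alpha> \<otimes>\<^bsub>(AutF (Suc n))\<lparr>carrier := fixes_last n\<rparr>\<^esub> \<beta>) = cut n \<alpha> \<otimes>\<^bsub>AutF n\<^esub> cut n \<beta>"
      by simp
  qed (use cut_auto in auto)
  then show ?thesis
    using A.subgroup_imp_group [OF subgroup_fixes_last]
    by (simp add: group_hom_def group_hom_axioms_def A.is_group)
qed

lemma cut_mult:
  assumes "\<alpha> \<in> fixes_last n" "\<beta> \<in> fixes_last n"
  shows "cut n (\<alpha> \<otimes>\<^bsub>AutF (Suc n)\<^esub> \<beta>) = cut n \<alpha> \<otimes>\<^bsub>AutF n\<^esub> cut n \<beta>"
  using group_hom.hom_mult [OF group_hom_cut, of \<alpha> n \<beta>] assms by simp

lemma cut_inv: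
  assumes "\<alpha> \<in> fixes_last n"
  shows "cut n (inv\<^bsub>AutF (Suc n)\<^esub> \<alpha>) = inv\<^bsub>AutF n\<^esub> cut n \<alpha>"
  using group_hom.hom_inv [OF group_hom_cut, of \<alpha> n] assms
    A.m_inv_consistent [OF subgroup_fixes_last assms] by simp

lemma cut_inj:
  assumes "\<alpha> \<in> fixes_last n" "\<beta> \<in> fixes_last n" "cut n \<alpha> = cut n \<beta>"
  shows "\<alpha> = \<beta>"
proof (rule AutF_eqI)
  show "\<alpha> \<in> auto (FreeGrp (Suc n))" "\<beta> \<in> auto (FreeGrp (Suc n))"
    using assms by (auto simp: fixes_last_def)
  fix t assume t: "t \<in> {1..Suc n}"
  show "\<alpha> (gen t) = \<beta> (gen t)"
  proof (cases "t = Suc n")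
    case True
    then show ?thesis using assms by (simp add: fixes_last_def)
  next
    case False
    then have "gen t \<in> carrier (FreeGrp n)" using t by (intro gen_closed) auto
    then show ?thesis using fun_cong [OF assms(3), of "gen t"] by simp
  qed
qed

lemma artin_gen_cut:
  assumes i: "i \<in> {1..<n}"
  shows "cut n (artin_gen (Suc n) i) = artin_gen n i" "artin_gen (Suc n) i \<in> fixes_last n"
proof -
  note mono = subsetD [OF FreeGrp_mono [of n]]
  have eq: "artin_gen (Suc n) i w = artin_gen n i w" if "w \<in> carrier (FreeGrp n)" for w
    using that mono by (simp add: artin_gen_apply)
  have a: "artin_gen n i \<in> auto (FreeGrp n)" using i by (intro artin_gen_auto) auto
  then have "artin_gen n i \<in> extensional (carrier (FreeGrp n))" by (simp add: auto_def Bij_def)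
  then show "cut n (artin_gen (Suc n) i) = artin_gen n i"
    using eq by (intro extensionalityI [of _ "carrier (FreeGrp n)"]) auto
  have "artin_gen (Suc n) i ` carrier (FreeGrp n) = artin_gen n i ` carrier (FreeGrp n)"
    using eq by (intro image_cong) auto
  also have "\<dots> = carrier (FreeGrp n)" using a by (simp add: auto_def Bij_def bij_betw_def)
  finally show "artin_gen (Suc n) i \<in> fixes_last n"
    using i artin_gen_auto [of i "Suc n"] by (simp add: fixes_last_def artin_gen_gen artin_image_def)
qed

section \<open>Braids on the first n strands\<close>

abbreviation lower_braids :: "nat \<Rightarrow> ((word \<Rightarrow> word) \<times> (nat \<Rightarrow> nat)) set" where
  "lower_braids n \<equiv> generate (BraidSpace (Suc n)) (braid_gen (Suc n) ` {1..<n})"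

lemma inv_braid_gen:
  assumes "i \<in> {1..<n}"
  shows "inv\<^bsub>BraidSpace n\<^esub> braid_gen n i = (inv\<^bsub>AutF n\<^esub> artin_gen n i, transpose i (Suc i))"
  unfolding BraidSpace_inv [OF braid_gen_closed [OF assms]]
  using inv_transpose_sym_group [OF assms] by (simp add: braid_gen_def)

lemma lower_braids_cut:
  assumes "x \<in> lower_braids n"
  shows "fst x \<in> fixes_last n \<and> snd x (Suc n) = Suc n \<and> (cut n (fst x), snd x) \<in> braid_graph n"
  using assms
proof (induction x rule: generate.induct)
  case one
  have "\<one>\<^bsub>AutF (Suc n)\<^esub> \<in> fixes_last n" using subgroup.one_closed [OF subgroup_fixes_last] .
  moreover have "cut n \<one>\<^bsub>AutF (Suc n)\<^esub> = \<one>\<^bsub>AutF n\<^esub>"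
    using group_hom.hom_one [OF group_hom_cut, of n] by simp
  ultimately show ?case
    using generate.one [of "BraidSpace n" "braid_gen n ` {1..<n}"]
    by (simp add: braid_graph_eq sym_group_one id_def)
next
  case (incl x)
  then obtain i where i: "i \<in> {1..<n}" and x: "x = braid_gen (Suc n) i" by blast
  have "braid_gen n i \<in> braid_graph n" unfolding braid_graph_eq using i by (intro generate.incl) blast
  then show ?case
    using i artin_gen_cut [OF i] by (simp add: x braid_gen_def)
next
  case (inv x)
  then obtain i where i: "i \<in> {1..<n}" and x: "x = braid_gen (Suc n) i" by blast
  have i': "i \<in> {1..<Suc n}" using i by auto
  have "inv\<^bsub>BraidSpace n\<^esub> braid_gen n i \<in> braid_graph n"
    unfolding braid_graph_eq using i by (intro generate.inv) blast
  moreover have "inv\<^bsub>AutF (Suc n)\<^esub> artin_gen (Suc n) i \<in> fixes_last n"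
    using subgroup.m_inv_closed [OF subgroup_fixes_last artin_gen_cut(2) [OF i]] .
  ultimately show ?case
    unfolding x inv_braid_gen [OF i'] inv_braid_gen [OF i]
    using i cut_inv [OF artin_gen_cut(2) [OF i]] artin_gen_cut(1) [OF i] by simp
next
  case (eng x y)
  then have "(cut n (fst x), snd x) \<otimes>\<^bsub>BraidSpace n\<^esub> (cut n (fst y), snd y) \<in> braid_graph n"
    unfolding braid_graph_eq by (blast intro: generate.eng)
  moreover have "fst x \<otimes>\<^bsub>AutF (Suc n)\<^esub> fst y \<in> fixes_last n"
    using eng subgroup.m_closed [OF subgroup_fixes_last] by blast
  ultimately show ?case
    using eng cut_mult [of "fst x" n "fst y"] by (simp add: mult_DirProd' sym_group_mult comp_def)
qed

text \<open>The same word in the generators, read with one strand more, is a lift.\<close>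

lemma braid_graph_lift:
  assumes "y \<in> braid_graph n"
  shows "\<exists>x\<in>lower_braids n. cut n (fst x) = fst y \<and> snd x = snd y"
  using assms unfolding braid_graph_eq
proof (induction y rule: generate.induct)
  case one
  have "cut n \<one>\<^bsub>AutF (Suc n)\<^esub> = \<one>\<^bsub>AutF n\<^esub>"
    using group_hom.hom_one [OF group_hom_cut, of n] by simp
  then show ?case
    by (intro bexI [OF _ generate.one]) (simp add: sym_group_one)
next
  case (incl y)
  then obtain i where i: "i \<in> {1..<n}" and y: "y = braid_gen n i" by blast
  have "braid_gen (Suc n) i \<in> lower_braids n" using i by (intro generate.incl) blast
  then show ?case using artin_gen_cut [OF i] by (intro bexI) (simp_all add: y braid_gen_def)
next
  case (inv y)
  then obtain i where i: "i \<in> {1..<n}" and y: "y = braid_gen n i" by blast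
  have i': "i \<in> {1..<Suc n}" using i by auto
  have "inv\<^bsub>BraidSpace (Suc n)\<^esub> braid_gen (Suc n) i \<in> lower_braids n"
    using i by (intro generate.inv) blast
  then show ?case
    unfolding y inv_braid_gen [OF i'] inv_braid_gen [OF i]
    using cut_inv [OF artin_gen_cut(2) [OF i]] artin_gen_cut(1) [OF i] by (intro bexI) simp_all
next
  case (eng y z)
  then obtain x x' where x: "x \<in> lower_braids n" "cut n (fst x) = fst y" "snd x = snd y"
    and x': "x' \<in> lower_braids n" "cut n (fst x') = fst z" "snd x' = snd z" by blast
  have "x \<otimes>\<^bsub>BraidSpace (Suc n)\<^esub> x' \<in> lower_braids n" using x x' by (intro generate.eng)
  moreover have "cut n (fst x \<otimes>\<^bsub>AutF (Suc n)\<^esub> fst x') = fst y \<otimes>\<^bsub>AutF n\<^esub> fst z"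
    using cut_mult lower_braids_cut x x' by metis
  ultimately show ?case
    using x x' by (intro bexI) (simp_all add: mult_DirProd' sym_group_mult)
qed

text \<open>Restriction maps the pure braids in \<open>lower_braids n\<close> onto
  \<open>P_n\<close>, so \<open>cut n \<alpha>\<close> has a preimage in their \<open>j\<close>-th
  lower central term; by injectivity that preimage is \<open>\<alpha>\<close>, and the term lies in
  the one of \<open>P_(n+1)\<close>.\<close>

lemma cut_lcs:
  assumes \<alpha>: "(\<alpha>, id) \<in> lower_braids n" and lcs: "cut n \<alpha> \<in> lcs (PB n) j"
  shows "\<alpha> \<in> lcs (PB (Suc n)) j"
proof -
  define P where "P = {\<alpha>. (\<alpha>, id) \<in> lower_braids n}"
  have "braid_gen (Suc n) ` {1..<n} \<subseteq> carrier (BraidSpace (Suc n))"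
    using braid_gen_closed [of _ "Suc n"] by force
  then have P: "subgroup P (AutF (Suc n))"
    unfolding P_def by (rule subgroup_trivial_permutation)
  have "braid_gen (Suc n) ` {1..<n} \<subseteq> braid_gen (Suc n) ` {1..<Suc n}" by auto
  then have P_sub: "P \<subseteq> PureBraid (Suc n)"
    using BS.mono_generate unfolding P_def PureBraid_def braid_graph_eq by blast
  have P_fix: "P \<subseteq> fixes_last n" using lower_braids_cut unfolding P_def by force
  let ?P = "(AutF (Suc n))\<lparr>carrier := P\<rparr>"
  interpret c: group_hom ?P "PB n" "cut n"
  proof (intro group_hom.intro group_hom_axioms.intro)
    show "group ?P" by (rule A.subgroup_imp_group [OF P])
    show "cut n \<in> hom ?P (PB n)"
    proof (rule homI)
      show "cut n \<alpha> \<in> carrier (PB n)" if "\<alpha> \<in> carrier ?P" for \<alpha>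
        using that lower_braids_cut [of "(\<alpha>, id)" n] by (simp add: P_def PureBraid_def)
      show "cut n (\<alpha> \<otimes>\<^bsub>?P\<^esub> \<beta>) = cut n \<alpha> \<otimes>\<^bsub>PB n\<^esub> cut n \<beta>"
        if "\<alpha> \<in> carrier ?P" "\<beta> \<in> carrier ?P" for \<alpha> \<beta>
        using that cut_mult P_fix by auto
    qed
  qed (rule PB.is_group)
  have "cut n ` carrier ?P = carrier (PB n)"
  proof (intro equalityI subsetI)
    fix \<beta> assume "\<beta> \<in> carrier (PB n)"
    then have "(\<beta>, id) \<in> braid_graph n" by (simp add: PureBraid_def)
    then obtain x where x: "x \<in> lower_braids n" "cut n (fst x) = \<beta>" "snd x = id"
      using braid_graph_lift by force
    then have "(fst x, id) \<in> lower_braids n" by (metis prod.collapse)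
    then have "fst x \<in> carrier ?P" by (simp add: P_def)
    then show "\<beta> \<in> cut n ` carrier ?P" using x(2) by blast
  next
    fix \<beta> assume "\<beta> \<in> cut n ` carrier ?P"
    then show "\<beta> \<in> carrier (PB n)" using c.hom_closed by blast
  qed
  then have "cut n ` lcs ?P j = lcs (PB n) j" by (rule c.surj_hom_image_lcs)
  then have "cut n \<alpha> \<in> cut n ` lcs ?P j" using lcs by simp
  then obtain \<beta> where \<beta>: "\<beta> \<in> lcs ?P j" "cut n \<alpha> = cut n \<beta>" by (rule imageE)
  have "\<beta> \<in> P" using c.G.lcs_closed [OF \<beta>(1)] by simp
  moreover have "\<alpha> \<in> P" using \<alpha> by (simp add: P_def)
  ultimately have "\<beta> = \<alpha>" using cut_inj [of \<beta> n \<alpha>] \<beta>(2) subsetD [OF P_fix] by simp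
  moreover have "lcs ?P j \<subseteq> lcs (PB (Suc n)) j"
    using PB.lcs_subgroup_mono [OF A.subgroup_incl [OF P subgroup_PureBraid P_sub]] by simp
  ultimately show ?thesis using \<beta>(1) by auto
qed

text \<open>Combing leaves a factor \<open>tau k\<close>. Its permutation sends \<open>k\<close> to
  \<open>n + 1\<close>, which the middle factor fixes and the first does not move; as the total
  permutation is trivial, \<open>k = n + 1\<close>, where \<open>tau\<close> is the
  identity.\<close>

lemma PureBraid_combing:
  assumes "\<beta> \<in> PureBraid (Suc n)"
  shows "\<exists>\<kappa> \<alpha>. last_strand_push n \<kappa> \<and> (\<alpha>, id) \<in> lower_braids n \<and> \<beta> = \<kappa> \<otimes>\<^bsub>AutF (Suc n)\<^esub> \<alpha>"
proof -
  have "(\<beta>, id) \<in> generate (BraidSpace (Suc n)) (inv_gen_braid n ` {1..<Suc n})"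
    unfolding generate_inv_gen_braid [OF order_refl]
    using assms by (simp add: PureBraid_def braid_graph_eq)
  then have "(\<beta>, id) \<in> generate (BraidSpace (Suc n)) (inv_gen_braid n ` {1..n})"
    by (simp only: atLeastLessThanSuc_atLeastAtMost)
  from Br.braid_combing [OF this] obtain x y k
    where x: "x \<in> generate (BraidSpace (Suc n)) (Br.pure_gen n ` {1..n})"
      and "y \<in> generate (BraidSpace (Suc n)) (inv_gen_braid n ` {1..<n})"
      and k: "k \<in> {1..Suc n}"
      and eq: "(\<beta>, id) = x \<otimes>\<^bsub>BraidSpace (Suc n)\<^esub> y \<otimes>\<^bsub>BraidSpace (Suc n)\<^esub> Br.tau n k"
    by blast
  then have y: "y \<in> lower_braids n" using generate_inv_gen_braid [of n n] by simp
  have x': "snd x = id" "last_strand_push n (fst x)" using generate_pure_gen [OF x] by auto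
  have perm: "id = snd x \<circ> snd y \<circ> snd (Br.tau n k)"
    using arg_cong [OF eq, of snd] by (simp add: mult_DirProd' sym_group_mult)
  have "k = snd y (snd (Br.tau n k) k)" using fun_cong [OF perm, of k] x'(1) by simp
  also have "\<dots> = Suc n" using snd_tau k lower_braids_cut [OF y] by simp
  finally have "Br.tau n k = \<one>\<^bsub>BraidSpace (Suc n)\<^esub>" using Br.tau_last by simp
  then have eq': "(\<beta>, id) = x \<otimes>\<^bsub>BraidSpace (Suc n)\<^esub> y \<otimes>\<^bsub>BraidSpace (Suc n)\<^esub> \<one>\<^bsub>BraidSpace (Suc n)\<^esub>"
    using eq by simp
  have "fst y \<in> auto (FreeGrp (Suc n))" using lower_braids_cut [OF y] by (simp add: fixes_last_def)
  moreover have "fst x \<in> auto (FreeGrp (Suc n))" using x' by (simp add: last_strand_push_def)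
  ultimately have "fst x \<otimes>\<^bsub>AutF (Suc n)\<^esub> fst y \<in> carrier (AutF (Suc n))"
    using A.m_closed [of "fst x" "Suc n" "fst y"] by simp
  then have "\<beta> = fst x \<otimes>\<^bsub>AutF (Suc n)\<^esub> fst y" and "snd y = id"
    using arg_cong [OF eq', of fst] arg_cong [OF eq', of snd] x'(1)
    by (simp_all add: mult_DirProd' sym_group_mult sym_group_one A.r_one)
  then have "(fst y, id) \<in> lower_braids n" using y by (metis prod.collapse)
  then show ?thesis using x'(2) \<open>\<beta> = fst x \<otimes>\<^bsub>AutF (Suc n)\<^esub> fst y\<close> by blast
qed

section \<open>The Andreadakis equality for pure braids\<close>

lemma andreadakis_PureBraid:
  assumes "1 \<le> j" "\<beta> \<in> PureBraid n" "\<beta> \<in> andreadakis (FreeGrp n) j"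
  shows "\<beta> \<in> lcs (PB n) j"
  using assms(2,3)
proof (induction n arbitrary: \<beta>)
  case 0
  then have "(\<beta>, id) \<in> generate (BraidSpace 0) {}" by (simp add: PureBraid_def braid_graph_eq)
  then have "\<beta> = \<one>\<^bsub>PB 0\<^esub>" using BS.generate_empty by simp
  then show ?case using PB.lcs_one [where n = 0] by simp
next
  case (Suc n)
  let ?F = "FreeGrp (Suc n)" and ?A = "AutF (Suc n)"
  obtain \<kappa> \<alpha> where \<kappa>: "last_strand_push n \<kappa>" and \<alpha>: "(\<alpha>, id) \<in> lower_braids n"
    and \<beta>: "\<beta> = \<kappa> \<otimes>\<^bsub>?A\<^esub> \<alpha>" using PureBraid_combing [OF Suc.prems(1)] by blast
  have \<alpha>_fix: "\<alpha> \<in> fixes_last n" and cut_PB: "cut n \<alpha> \<in> PureBraid n"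
    using lower_braids_cut [OF \<alpha>] by (auto simp: PureBraid_def)
  have \<alpha>_auto: "\<alpha> \<in> auto ?F" and \<alpha>_im: "\<alpha> ` carrier (FreeGrp n) = carrier (FreeGrp n)"
    using \<alpha>_fix by (auto simp: fixes_last_def)
  obtain w where \<kappa>_auto: "\<kappa> \<in> auto ?F"
    and \<kappa>_forget: "\<And>v. v \<in> carrier ?F \<Longrightarrow> forget n (\<kappa> v) = forget n v"
    and w: "w \<in> carrier ?F" and \<kappa>x: "\<kappa> (gen (Suc n)) = w \<otimes>\<^bsub>?F\<^esub> gen (Suc n) \<otimes>\<^bsub>?F\<^esub> inv\<^bsub>?F\<^esub> w"
    and \<kappa>w: "\<kappa> \<otimes>\<^bsub>?A\<^esub> push n (forget n w) = \<one>\<^bsub>?A\<^esub>"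
    using \<kappa> unfolding last_strand_push_def by blast
  interpret f: group_hom ?F "FreeGrp n" "forget n" by (rule group_hom_forget)
  \<comment> \<open>For \<open>v\<close> in \<open>F_n\<close>, \<open>forget\<close> absorbs
    \<open>\<kappa>\<close> and fixes \<open>\<alpha> v\<close>, so it maps
    \<open>\<beta>(v) v^-1\<close> to \<open>\<alpha>(v) v^-1\<close>, and homomorphisms respect
    \<open>lcs\<close>.\<close>
  have "cut n \<alpha> v \<otimes>\<^bsub>FreeGrp n\<^esub> inv\<^bsub>FreeGrp n\<^esub> v \<in> lcs (FreeGrp n) (Suc j)" if v: "v \<in> carrier (FreeGrp n)" for v
  proof -
    have v': "v \<in> carrier ?F" using v FreeGrp_mono by blast
    have \<alpha>v: "\<alpha> v \<in> carrier (FreeGrp n)" using \<alpha>_im v by blast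
    have \<beta>v: "\<beta> v = \<kappa> (\<alpha> v)" unfolding \<beta> using F.auto_mult_apply [OF \<kappa>_auto \<alpha>_auto v'] .
    have \<beta>v': "\<beta> v \<in> carrier ?F"
      unfolding \<beta>v using F.auto_closed [OF \<kappa>_auto] F.auto_closed [OF \<alpha>_auto v'] by blast
    have "forget n (\<beta> v \<otimes>\<^bsub>?F\<^esub> inv\<^bsub>?F\<^esub> v) = forget n (\<beta> v) \<otimes>\<^bsub>FreeGrp n\<^esub> inv\<^bsub>FreeGrp n\<^esub> forget n v"
      using f.hom_mult [OF \<beta>v' F.inv_closed [OF v']] f.hom_inv [OF v'] by simp
    also have "forget n (\<beta> v) = \<alpha> v"
      unfolding \<beta>v using \<kappa>_forget F.auto_closed [OF \<alpha>_auto v'] forget_id [OF \<alpha>v] by simp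
    also have "forget n v = v" using forget_id [OF v] .
    finally have "forget n (\<beta> v \<otimes>\<^bsub>?F\<^esub> inv\<^bsub>?F\<^esub> v) = cut n \<alpha> v \<otimes>\<^bsub>FreeGrp n\<^esub> inv\<^bsub>FreeGrp n\<^esub> v"
      using v by simp
    moreover have "\<beta> v \<otimes>\<^bsub>?F\<^esub> inv\<^bsub>?F\<^esub> v \<in> lcs ?F (Suc j)"
      using Suc.prems(2) v' by (simp add: andreadakis_def del: mult_FreeGrp)
    ultimately show ?thesis using f.hom_image_lcs [of "Suc j"] by force
  qed
  then have "cut n \<alpha> \<in> andreadakis (FreeGrp n) j"
    using cut_auto [OF \<alpha>_fix] by (simp add: andreadakis_def)
  then have "\<alpha> \<in> lcs (PB (Suc n)) j" using cut_lcs [OF \<alpha>] Suc.IH cut_PB by blast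
  \<comment> \<open>Membership in \<open>\<Gamma>_j(P_(n+1))\<close> puts \<open>\<alpha>\<close>
    into \<open>\<A>_j\<close> as an automorphism of \<open>F_(n+1)\<close>, not only after
    restriction to \<open>F_n\<close>; so \<open>\<kappa> = \<beta> \<alpha>^-1\<close>
    follows.\<close>
  then have \<alpha>_lcs: "\<alpha> \<in> lcs (PB (Suc n)) j" and "\<alpha> \<in> andreadakis ?F j"
    using F.lcs_andreadakis [OF subgroup_PureBraid PureBraid_andreadakis assms(1)] by auto
  then have "\<beta> \<otimes>\<^bsub>?A\<^esub> inv\<^bsub>?A\<^esub> \<alpha> \<in> andreadakis ?F j"
    using Suc.prems(2) subgroup.m_closed [OF F.subgroup_andreadakis]
      subgroup.m_inv_closed [OF F.subgroup_andreadakis] by blast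
  moreover have "\<beta> \<otimes>\<^bsub>?A\<^esub> inv\<^bsub>?A\<^esub> \<alpha> = \<kappa>"
    unfolding \<beta> using \<kappa>_auto \<alpha>_auto A.inv_closed [of \<alpha> "Suc n"] A.r_one [of \<kappa> "Suc n"]
    by (simp add: A.m_assoc)
  ultimately have "\<kappa> \<in> andreadakis ?F j" by simp
  moreover have "gen (Suc n) \<in> carrier ?F" by (intro gen_closed) auto
  ultimately have "\<kappa> (gen (Suc n)) \<otimes>\<^bsub>?F\<^esub> inv\<^bsub>?F\<^esub> gen (Suc n) \<in> lcs ?F (Suc j)"
    by (simp add: andreadakis_def del: mult_FreeGrp)
  then have "commutator ?F w (gen (Suc n)) \<in> lcs ?F (Suc j)"
    unfolding \<kappa>x commutator_def using w gen_closed [of "Suc n" "Suc n"]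
    by (simp add: F.m_assoc del: mult_FreeGrp)
  then have "forget n w \<in> lcs (FreeGrp n) j" by (rule commutator_last_gen [OF w])
  then have p: "push n (forget n w) \<in> lcs (PB (Suc n)) j"
    using group_hom.hom_image_lcs [OF group_hom_push] by blast
  have pPB: "push n (forget n w) \<in> PureBraid (Suc n)" using PB.lcs_closed [OF p] by simp
  have "\<kappa> = inv\<^bsub>?A\<^esub> push n (forget n w)"
    using A.inv_equality [OF \<kappa>w] PureBraid_auto [OF pPB] \<kappa>_auto by simp
  also have "\<dots> = inv\<^bsub>PB (Suc n)\<^esub> push n (forget n w)"
    using A.m_inv_consistent [OF subgroup_PureBraid pPB] by simp
  finally have "\<kappa> \<in> lcs (PB (Suc n)) j" using PB.lcs_inv_closed [OF p] by simp
  then show ?case using PB.lcs_m_closed [OF _ \<alpha>_lcs] unfolding \<beta> by force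
qed

lemma IA_eq_andreadakis: "IA n = andreadakis (FreeGrp n) 1"
proof -
  have "lcs (FreeGrp n) 2 #>\<^bsub>FreeGrp n\<^esub> \<sigma> x = lcs (FreeGrp n) 2 #>\<^bsub>FreeGrp n\<^esub> x
      \<longleftrightarrow> \<sigma> x \<otimes>\<^bsub>FreeGrp n\<^esub> inv\<^bsub>FreeGrp n\<^esub> x \<in> lcs (FreeGrp n) 2"
    if "\<sigma> \<in> auto (FreeGrp n)" "x \<in> carrier (FreeGrp n)" for \<sigma> x
    using F.rcos_eq_iff [OF F.lcs_subgroup F.auto_closed [OF that] that(2)] .
  then show ?thesis
    unfolding IA_def andreadakis_def numeral_2_eq_2 One_nat_def by blast
qed

theorem mainTheorem12:
  fixes n j :: nat
  assumes "j \<ge> 1"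
  shows "lcs ((AutF n)\<lparr>carrier := PureBraid n\<rparr>) j
           = lcs ((AutF n)\<lparr>carrier := IA n\<rparr>) j \<inter> PureBraid n
       \<and> lcs ((AutF n)\<lparr>carrier := IA n\<rparr>) j \<inter> PureBraid n
           = Afilt n j \<inter> PureBraid n"
proof -
  have A: "Afilt n j = andreadakis (FreeGrp n) j" by (simp only: Afilt_def andreadakis_def)
  have IA: "subgroup (IA n) (AutF n)"
    unfolding IA_eq_andreadakis by (rule F.subgroup_andreadakis)
  interpret IA: group "(AutF n)\<lparr>carrier := IA n\<rparr>" by (rule A.subgroup_imp_group [OF IA])
  have PB_IA: "PureBraid n \<subseteq> IA n" using PureBraid_andreadakis by (simp add: IA_eq_andreadakis)
  \<comment> \<open>These inclusions form a cycle inside \<open>P_n\<close>, which yields both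
    equalities at once.\<close>
  have "lcs (PB n) j \<subseteq> lcs ((AutF n)\<lparr>carrier := IA n\<rparr>) j"
    using IA.lcs_subgroup_mono [OF A.subgroup_incl [OF subgroup_PureBraid IA PB_IA]] by simp
  moreover have "lcs (PB n) j \<subseteq> PureBraid n" using PB.lcs_closed by fastforce
  moreover have "lcs ((AutF n)\<lparr>carrier := IA n\<rparr>) j \<subseteq> Afilt n j"
    unfolding A using IA by (rule F.lcs_andreadakis) (use assms in \<open>simp_all add: IA_eq_andreadakis\<close>)
  moreover have "Afilt n j \<inter> PureBraid n \<subseteq> lcs (PB n) j"
    unfolding A using andreadakis_PureBraid [OF assms] by blast
  ultimately show ?thesis by blast
qed

end
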